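(* Let $N\ge 3$, $1<p\le 2$, $q\ge\max\{2^*,3\}$ with $2^*=\frac{2N}{N-2}$, $\mu>0$, and let $\Omega\subset\mathbb{R}^N$ be a bounded convex domain with smooth boundary. Then there exists $\bar\rho>0$ such that for every $\rho>\bar\rho$ there is no pair $(\omega,u)\in\mathbb{R}\times H^1_0(\Omega)$ with $u$ a positive (classical) solution of $$-\Delta u+\omega u=\mu u^{p-1}+u^{q-1},\quad u>0 \text{ in }\Omega,\qquad u=0\text{ on }\partial\Omega,\qquad \int_\Omega u^2\,\mathrm{d}x=\rho.$$
   Context: The number $\omega\in\mathbb{R}$ is an unknown (Lagrange multiplier); such a pair is called a positive normalized solution. *)

theory Defs
  imports "HOL-Analysis.Analysis"
begin

definition pdiff :: "'n::finite \<Rightarrow> (real^'n \<Rightarrow> real) \<Rightarrow> real^'n \<Rightarrow> real" where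
  "pdiff i f x = deriv (\<lambda>t. f (x + t *\<^sub>R axis i 1)) 0"

fun iter_pdiff :: "'n::finite list \<Rightarrow> (real^'n \<Rightarrow> real) \<Rightarrow> real^'n \<Rightarrow> real" where
  "iter_pdiff [] f = f"
| "iter_pdiff (i # is) f = pdiff i (iter_pdiff is f)"

definition Ck_on :: "nat \<Rightarrow> (real^'n::finite) set \<Rightarrow> (real^'n \<Rightarrow> real) \<Rightarrow> bool" where
  "Ck_on k S f \<longleftrightarrow>
     (\<forall>is. length is \<le> k \<longrightarrow> continuous_on S (iter_pdiff is f)) \<and>
     (\<forall>is i x. length is < k \<longrightarrow> x \<in> S \<longrightarrow>
        ((\<lambda>t. iter_pdiff is f (x + t *\<^sub>R axis i 1)) has_real_derivative
           iter_pdiff (i # is) f x) (at 0))"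

definition smooth_on_set :: "(real^'n::finite) set \<Rightarrow> (real^'n \<Rightarrow> real) \<Rightarrow> bool" where
  "smooth_on_set S f \<longleftrightarrow> (\<forall>k. Ck_on k S f)"

definition laplacian :: "(real^'n::finite \<Rightarrow> real) \<Rightarrow> real^'n \<Rightarrow> real" where
  "laplacian u x = (\<Sum>i\<in>UNIV. iter_pdiff [i, i] u x)"

definition smooth_boundary :: "(real^'n::finite) set \<Rightarrow> bool" where
  "smooth_boundary \<Omega> \<longleftrightarrow>
     (\<forall>x0\<in>frontier \<Omega>. \<exists>r>0. \<exists>g. smooth_on_set UNIV g \<and>
        (\<exists>i. pdiff i g x0 \<noteq> 0) \<and>
        \<Omega> \<inter> ball x0 r = {y \<in> ball x0 r. g y < 0})"

text \<open>Membership in H^1_0(\<Omega>) for a function that is C^1 in \<Omega> (so its weak gradient is its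
  classical gradient): u is the H^1(\<Omega>)-limit of smooth functions with compact support in \<Omega>.\<close>
definition H10 :: "(real^'n::finite) set \<Rightarrow> (real^'n \<Rightarrow> real) \<Rightarrow> bool" where
  "H10 \<Omega> u \<longleftrightarrow>
     (\<exists>\<phi> :: nat \<Rightarrow> real^'n \<Rightarrow> real.
        (\<forall>k. smooth_on_set UNIV (\<phi> k) \<and>
             (\<exists>K. compact K \<and> K \<subseteq> \<Omega> \<and> (\<forall>x. x \<notin> K \<longrightarrow> \<phi> k x = 0)) \<and>
             (\<lambda>x. (u x - \<phi> k x)^2 + (\<Sum>i\<in>UNIV. (pdiff i u x - pdiff i (\<phi> k) x)^2))
               integrable_on \<Omega>) \<and>
        (\<lambda>k. integral \<Omega> (\<lambda>x. (u x - \<phi> k x)^2 +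
               (\<Sum>i\<in>UNIV. (pdiff i u x - pdiff i (\<phi> k) x)^2))) \<longlonglongrightarrow> 0)"

end

theory Submission
  imports Defs
begin

text \<open>
  Write \<open>f(t) = \<mu> t\<^sup>p\<^sup>-\<^sup>1 + t\<^sup>q\<^sup>-\<^sup>1 - \<omega> t\<close>, let \<open>F\<close> be its primitive, \<open>N\<close> the dimension, and
  let \<open>v\<close> be \<open>u\<close> extended by zero.

  For \<open>\<lambda> > 1\<close> compare \<open>v\<close> with the dilated function \<open>v\<^sub>\<lambda>(x) = v(x\<^sub>0 + \<lambda>(x - x\<^sub>0))\<close>, which by convexity
  vanishes in a layer of width comparable to \<open>\<lambda> - 1\<close> along the boundary. Expanding
  \<open>\<integral>|\<nabla>(v - v\<^sub>\<lambda>)|\<^sup>2\<close> by means of the equation and letting \<open>\<lambda>\<close> tend to 1 gives Pohozaev's inequality.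
  By Cauchy-Schwarz against a cut-off whose gradient lives in the layer, the same energy is at least
  a multiple of \<open>(\<lambda> - 1) (\<integral>f(v))\<^sup>2\<close>, so that
  \<open>(\<integral>f(v))\<^sup>2 \<le> C (2N \<integral>F(v) - (N - 2) \<integral>v f(v))\<close> with \<open>C\<close> depending on \<open>\<Omega>\<close> only. All steps are
  carried out for truncations of \<open>v\<close> with compact support in \<open>\<Omega>\<close>, which avoids boundary regularity.

  As \<open>q \<ge> 2N/(N - 2)\<close> and \<open>p \<le> 2\<close>, the right-hand side is at most \<open>C (2N\<mu> (|\<Omega>| + \<rho>) - 2\<omega>\<rho>)\<close>. Its
  nonnegativity bounds \<open>\<omega>\<close> from above, and Picone's identity bounds \<open>\<omega>\<close> from below, so it is \<open>O(1 + \<rho>)\<close>.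
  As \<open>q \<ge> 3\<close>, \<open>\<integral>f(v) \<ge> \<rho>/2 - O(1)\<close>, and therefore \<open>\<rho>\<close> is bounded.
\<close>

section \<open>Integration over the whole space\<close>

text \<open>If \<open>u\<close> were smooth up to the boundary, the key estimate would be classical.
  Pohozaev's identity equates 2N\<integral>F - (N-2)\<integral>vf with the boundary integral of
  |\<partial>u/\<partial>\<nu>|^2 weighted by (x - x0) \<cdot> \<nu>; a ball of radius
  \<open>r\<close> about \<open>x0\<close> inside a convex domain makes the weight at least
  \<open>r\<close>; the divergence theorem turns \<integral>f into the flux; Cauchy-Schwarz on the
  boundary finishes. Here \<open>u\<close> is only continuous on the closure, so no normal
  derivative is at hand, and the difference of \<open>v\<close> and its dilation stands in for it.
  Its energy is of order \<lambda> - 1. The cut-off has gradient of order 1/(\<lambda> - 1) on a set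
  of volume of order \<lambda> - 1, so its energy is of order 1/(\<lambda> - 1), and the product
  stays finite as \<lambda> tends to 1. The truncation level goes to zero first, with \<lambda>
  fixed: the cut-off and the dilated function then live on compact sets where \<open>v\<close> has a
  positive minimum. The first-order expansion in \<lambda> - 1 needs an L1 bound for the difference,
  because no bound on \<nabla>u near the boundary is available.\<close>

lemma integrable_continuous_bounded_support:
  fixes f :: "'a::euclidean_space \<Rightarrow> real"
  assumes "continuous_on UNIV f" "bounded S" "\<And>x. x \<notin> S \<Longrightarrow> f x = 0"
  shows "f integrable_on UNIV"
proof -
  obtain a where a: "S \<subseteq> cbox (-a) a"
    using bounded_subset_cbox_symmetric[OF assms(2)] by blast
  have "f integrable_on cbox (-a) a"
    using assms(1) continuous_on_subset integrable_continuous by blast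
  then show ?thesis
    by (rule integrable_on_superset) (use a assms(3) in auto)
qed

lemma bounded_continuous_bounded_support:
  fixes f :: "'a::euclidean_space \<Rightarrow> real"
  assumes "continuous_on UNIV f" "bounded S" "\<And>x. x \<notin> S \<Longrightarrow> f x = 0"
  shows "\<exists>B>0. \<forall>x. \<bar>f x\<bar> \<le> B"
proof -
  have "compact (f ` closure S)"
    using assms(1,2) by (intro compact_continuous_image) (auto intro: continuous_on_subset)
  then obtain B where B: "\<forall>y\<in>f ` closure S. norm y \<le> B" "B > 0"
    using compact_imp_bounded bounded_pos by blast
  have "\<bar>f x\<bar> \<le> B" for x
  proof (cases "x \<in> S")
    case True
    then have "f x \<in> f ` closure S" using closure_subset[of S] by blast
    then show ?thesis using B(1) by force
  next
    case False
    then show ?thesis using assms(3) B(2) by simp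
  qed
  with B(2) show ?thesis by blast
qed

lemma integrable_const_ball:
  "(\<lambda>x::'a::euclidean_space. if x \<in> cball a R then B else (0::real)) integrable_on UNIV"
  unfolding integrable_restrict_UNIV[where f="\<lambda>x. B" and s="cball a R"]
  by (intro integrable_on_const) (rule lmeasurable_cball)

text \<open>A constant on a ball around the common support is the integrable majorant. Every passage
  to the limit under an integral below has this form.\<close>

lemma dominated_bounded_support:
  fixes f :: "nat \<Rightarrow> 'a::euclidean_space \<Rightarrow> real"
  assumes cont: "\<And>k. continuous_on UNIV (f k)" and S: "bounded S"
    and supp: "\<And>k x. x \<notin> S \<Longrightarrow> f k x = 0"
    and le: "\<And>k x. \<bar>f k x\<bar> \<le> B" and lim: "\<And>x. (\<lambda>k. f k x) \<longlonglongrightarrow> g x"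
  shows "(\<lambda>k. integral UNIV (f k)) \<longlonglongrightarrow> integral UNIV g"
proof -
  obtain R where R: "S \<subseteq> cball 0 R"
    using bounded_subset_ballD[OF S, of 0] ball_subset_cball[of 0] by (meson order_trans)
  show ?thesis
  proof (rule dominated_convergence(2))
    show "f k integrable_on UNIV" for k
      by (rule integrable_continuous_bounded_support[OF cont S supp])
    show "(\<lambda>x. if x \<in> cball 0 R then B else 0) integrable_on (UNIV :: 'a set)"
      by (rule integrable_const_ball)
    show "norm (f k x) \<le> (if x \<in> cball 0 R then B else 0)" for k x
      using le[of k x] supp[of x k] subsetD[OF R, of x] by (cases "x \<in> S") auto
  qed (use lim in auto)
qed

text \<open>Functions are extended by zero and integrated over the whole space, so that translations
  and dilations cost a Jacobian but no change of domain.\<close>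

lemma integral_affinity_UNIV:
  fixes f :: "'a::euclidean_space \<Rightarrow> real"
  assumes "continuous_on UNIV f" "bounded S" "\<And>x. x \<notin> S \<Longrightarrow> f x = 0" and "m > 0"
  shows "integral UNIV (\<lambda>x. f (m *\<^sub>R x + c)) = integral UNIV f / m ^ DIM('a)"
proof -
  obtain a where a: "S \<subseteq> cbox (-a) a"
    using bounded_subset_cbox_symmetric[OF assms(2)] by blast
  let ?I = "integral UNIV f"
  have f0: "f x = 0" if "x \<notin> cbox (-a) a" for x
    using a assms(3) that by blast
  have "(f has_integral ?I) UNIV"
    by (intro integrable_integral integrable_continuous_bounded_support[OF assms(1-3)])
  then have "((\<lambda>x. if x \<in> cbox (-a) a then f x else 0) has_integral ?I) UNIV"
    by (rule has_integral_eq[rotated]) (use f0 in auto)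
  then have "(f has_integral ?I) (cbox (-a) a)"
    by (simp add: has_integral_restrict_UNIV)
  from has_integral_affinity'[OF this assms(4), of c]
  have h: "((\<lambda>x. f (m *\<^sub>R x + c)) has_integral ?I /\<^sub>R m ^ DIM('a)) (cbox ((- a - c) /\<^sub>R m) ((a - c) /\<^sub>R m))" .
  have "f (m *\<^sub>R x + c) = 0" if "x \<notin> cbox ((- a - c) /\<^sub>R m) ((a - c) /\<^sub>R m)" for x
  proof (rule f0, rule notI)
    assume "m *\<^sub>R x + c \<in> cbox (-a) a"
    then have "x \<in> cbox ((- a - c) /\<^sub>R m) ((a - c) /\<^sub>R m)"
      using assms(4) by (auto simp: mem_box inner_simps field_simps)
    with that show False by simp
  qed
  then have "((\<lambda>x. f (m *\<^sub>R x + c)) has_integral ?I /\<^sub>R m ^ DIM('a)) UNIV"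
    by (intro has_integral_on_superset[OF h]) auto
  then show ?thesis
    by (simp add: integral_unique divide_inverse_commute)
qed

text \<open>Difference quotients integrate to zero by translation invariance. The mean value theorem
  bounds them by the maximum of \<open>g'\<close>, so dominated convergence carries the zero over to
  the derivative without any iterated integral.\<close>

lemma integral_directional_derivative_zero:
  fixes g :: "'a::euclidean_space \<Rightarrow> real"
  assumes der: "\<And>x. ((\<lambda>t. g (x + t *\<^sub>R e)) has_real_derivative g' x) (at 0)"
    and contg: "continuous_on UNIV g" and cont: "continuous_on UNIV g'"
    and S: "bounded S" and g0: "\<And>x. x \<notin> S \<Longrightarrow> g x = 0" and g'0: "\<And>x. x \<notin> S \<Longrightarrow> g' x = 0"
  shows "integral UNIV g' = 0"
proof -
  obtain B where B: "B > 0" "\<forall>x. \<bar>g' x\<bar> \<le> B"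
    using bounded_continuous_bounded_support[OF cont S g'0] by auto
  obtain R where R: "S \<subseteq> cball 0 R"
    using bounded_subset_ballD[OF S, of 0] ball_subset_cball[of 0] by (meson order_trans)
  \<comment> \<open>The hypothesis speaks of parameter 0 only; moving the base point along the line
    gives the derivative at every parameter, as the mean value theorem requires.\<close>
  have der': "((\<lambda>t. g (x + t *\<^sub>R e)) has_real_derivative g' (x + t *\<^sub>R e)) (at t)" for x t
  proof -
    have "((\<lambda>s. g ((x + t *\<^sub>R e) + s *\<^sub>R e)) has_real_derivative g' (x + t *\<^sub>R e)) (at 0)"
      by (rule der)
    then have "((\<lambda>s. g (x + (s + t) *\<^sub>R e)) has_real_derivative g' (x + t *\<^sub>R e)) (at 0)"
      by (simp add: algebra_simps)
    then show ?thesis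
      using DERIV_shift[of "\<lambda>s. g (x + s *\<^sub>R e)" "g' (x + t *\<^sub>R e)" 0 t] by simp
  qed
  define q where "q k x = (g (x + (1 / real (Suc k)) *\<^sub>R e) - g x) * real (Suc k)" for k x
  have contq: "continuous_on UNIV (\<lambda>x. g (x + s *\<^sub>R e))" for s
    by (rule continuous_on_compose2[OF contg]) (auto intro!: continuous_intros)
  \<comment> \<open>All shifts have length at most \<open>norm e\<close>, so one enlarged ball
    contains the supports of all difference quotients.\<close>
  have suppq: "g (x + s *\<^sub>R e) = 0" if "x \<notin> cball 0 (R + norm e)" "0 \<le> s" "s \<le> 1" for x s
  proof (rule g0, rule notI)
    assume "x + s *\<^sub>R e \<in> S"
    then have "norm (x + s *\<^sub>R e) \<le> R" using R by auto
    moreover have "norm x \<le> norm (x + s *\<^sub>R e) + norm (s *\<^sub>R e)"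
      using norm_triangle_ineq4[of "x + s *\<^sub>R e" "s *\<^sub>R e"] by simp
    moreover have "norm (s *\<^sub>R e) \<le> norm e"
      using that by (simp add: mult_left_le_one_le)
    ultimately show False using that by simp
  qed
  have intq: "integral UNIV (q k) = 0" for k
  proof -
    let ?s = "1 / real (Suc k)"
    have s: "0 \<le> ?s" "?s \<le> 1" by auto
    have "integral UNIV (\<lambda>x. g (1 *\<^sub>R x + ?s *\<^sub>R e)) = integral UNIV g / 1 ^ DIM('a)"
      by (rule integral_affinity_UNIV[OF contg S g0]) auto
    moreover have "(\<lambda>x. g (x + ?s *\<^sub>R e)) integrable_on UNIV"
      by (rule integrable_continuous_bounded_support[OF contq bounded_cball suppq[OF _ s]])
    moreover have "g integrable_on UNIV"
      by (rule integrable_continuous_bounded_support[OF contg S g0])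
    ultimately show ?thesis
      unfolding q_def by (simp add: integral_diff)
  qed
  have "(\<lambda>k. integral UNIV (q k)) \<longlonglongrightarrow> integral UNIV g'"
  proof (rule dominated_bounded_support)
    show "continuous_on UNIV (q k)" for k
      unfolding q_def by (intro continuous_intros contq contg)
    show "bounded (cball (0::'a) (R + norm e))" by simp
    show "q k x = 0" if "x \<notin> cball 0 (R + norm e)" for k x
      using suppq[OF that, of "1 / real (Suc k)"] suppq[OF that, of 0] by (simp add: q_def)
    show "\<bar>q k x\<bar> \<le> B" for k x
    proof -
      let ?s = "1 / real (Suc k)"
      have "\<exists>z>0. z < ?s \<and> g (x + ?s *\<^sub>R e) - g (x + 0 *\<^sub>R e) = (?s - 0) * g' (x + z *\<^sub>R e)"
        by (rule MVT2) (auto intro: der')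
      then obtain z where "g (x + ?s *\<^sub>R e) - g x = ?s * g' (x + z *\<^sub>R e)" by auto
      then have "q k x = g' (x + z *\<^sub>R e)" by (simp add: q_def)
      then show ?thesis using B(2) by simp
    qed
    show "(\<lambda>k. q k x) \<longlonglongrightarrow> g' x" for x
    proof -
      have "((\<lambda>h. (g (x + h *\<^sub>R e) - g x) / h) \<longlongrightarrow> g' x) (at 0)"
        using der[of x] by (simp add: DERIV_def)
      moreover have "filterlim (\<lambda>k. 1 / real (Suc k)) (at 0) sequentially"
        unfolding filterlim_at using LIMSEQ_inverse_real_of_nat
        by (simp add: inverse_eq_divide)
      ultimately have "(\<lambda>k. (g (x + (1 / real (Suc k)) *\<^sub>R e) - g x) / (1 / real (Suc k))) \<longlonglongrightarrow> g' x"
        by (rule filterlim_compose)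
      then show ?thesis by (simp add: q_def)
    qed
  qed
  then show ?thesis
    using intq by (simp add: LIMSEQ_const_iff)
qed

section \<open>Extension by zero of functions with compact support in an open set\<close>

lemma continuous_on_extend_zero:
  fixes g :: "'a::t2_space \<Rightarrow> real"
  assumes "open \<Omega>" "compact S" "S \<subseteq> \<Omega>" "continuous_on \<Omega> g" "\<And>x. x \<in> \<Omega> - S \<Longrightarrow> g x = 0"
  shows "continuous_on UNIV (\<lambda>x. if x \<in> \<Omega> then g x else 0)"
proof -
  have U: "UNIV = \<Omega> \<union> - S" using assms(3) by auto
  have "continuous_on (\<Omega> \<union> - S) (\<lambda>x. if x \<in> \<Omega> then g x else 0)"
  proof (rule continuous_on_open_Un)
    show "continuous_on \<Omega> (\<lambda>x. if x \<in> \<Omega> then g x else 0)"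
      using assms(4) by (rule continuous_on_eq) auto
    show "continuous_on (- S) (\<lambda>x. if x \<in> \<Omega> then g x else 0)"
      by (rule continuous_on_eq[where f="\<lambda>x. 0"]) (use assms(5) in auto)
  qed (use assms compact_imp_closed in auto)
  with U show ?thesis by simp
qed

lemma eventually_line_open:
  fixes x e :: "'a::real_normed_vector"
  assumes "open T" "x \<in> T"
  shows "\<forall>\<^sub>F t in nhds (0::real). x + t *\<^sub>R e \<in> T"
proof -
  have "open ((\<lambda>t::real. x + t *\<^sub>R e) -` T)"
    by (intro open_vimage assms) (auto intro!: continuous_intros)
  then show ?thesis
    unfolding eventually_nhds by (rule exI[where x="(\<lambda>t::real. x + t *\<^sub>R e) -` T", OF conjI]) (use assms in auto)
qed

lemma derivative_extend_zero:
  fixes g :: "'a::real_normed_vector \<Rightarrow> real"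
  assumes "open \<Omega>" "compact S" "S \<subseteq> \<Omega>" "\<And>x. x \<in> \<Omega> - S \<Longrightarrow> g x = 0"
    and der: "\<And>x. x \<in> \<Omega> \<Longrightarrow> ((\<lambda>t. g (x + t *\<^sub>R e)) has_real_derivative g' x) (at 0)"
  shows "((\<lambda>t. if x + t *\<^sub>R e \<in> \<Omega> then g (x + t *\<^sub>R e) else 0) has_real_derivative
            (if x \<in> \<Omega> then g' x else 0)) (at 0)"
proof (cases "x \<in> \<Omega>")
  case True
  have "\<forall>\<^sub>F t in nhds 0. g (x + t *\<^sub>R e) = (if x + t *\<^sub>R e \<in> \<Omega> then g (x + t *\<^sub>R e) else 0)"
    using eventually_line_open[OF assms(1) True] by (rule eventually_mono) auto
  from DERIV_cong_ev[OF refl this refl] der[OF True] show ?thesis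
    unfolding if_P[OF True] by blast
next
  case False
  have "x \<in> - S" using False assms(3) by auto
  from eventually_line_open[OF _ this, of e]
  have "\<forall>\<^sub>F t in nhds 0. 0 = (if x + t *\<^sub>R e \<in> \<Omega> then g (x + t *\<^sub>R e) else 0)"
    using assms(2,4) by (auto elim!: eventually_mono simp: compact_imp_closed open_Compl)
  from DERIV_cong_ev[OF refl this refl] DERIV_const show ?thesis
    unfolding if_not_P[OF False] by blast
qed

lemma derivative_zero_off_support:
  fixes g :: "'a::real_normed_vector \<Rightarrow> real"
  assumes "open \<Omega>" "compact S" "\<And>x. x \<in> \<Omega> - S \<Longrightarrow> g x = 0"
    and "((\<lambda>t. g (x + t *\<^sub>R e)) has_real_derivative d) (at 0)" "x \<in> \<Omega> - S"
  shows "d = 0"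
proof -
  have "\<forall>\<^sub>F t in nhds 0. g (x + t *\<^sub>R e) = 0"
    using eventually_line_open[of "\<Omega> - S" x e] assms
    by (auto elim!: eventually_mono simp: compact_imp_closed open_Diff)
  from DERIV_cong_ev[OF refl this refl] assms(4)
  have "((\<lambda>t. 0) has_real_derivative d) (at (0::real))"
    by blast
  then show ?thesis
    by (rule DERIV_unique[OF _ DERIV_const])
qed

text \<open>Since \<open>g\<close> vanishes on \<Omega> outside a compact subset, its extension by
  zero is as regular as \<open>g\<close> itself. Integration by parts inside \<Omega> therefore has
  no boundary term and asks nothing of the boundary.\<close>

lemma integral_derivative_compact_support:
  fixes g :: "'a::euclidean_space \<Rightarrow> real"
  assumes "open \<Omega>" "compact S" "S \<subseteq> \<Omega>" "\<And>x. x \<in> \<Omega> - S \<Longrightarrow> g x = 0"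
    and der: "\<And>x. x \<in> \<Omega> \<Longrightarrow> ((\<lambda>t. g (x + t *\<^sub>R e)) has_real_derivative g' x) (at 0)"
    and cont: "continuous_on \<Omega> g" "continuous_on \<Omega> g'"
  shows "integral UNIV (\<lambda>x. if x \<in> \<Omega> then g' x else 0) = 0"
proof (rule integral_directional_derivative_zero[where g="\<lambda>x. if x \<in> \<Omega> then g x else 0" and e=e and S=S])
  have g'0: "g' x = 0" if "x \<in> \<Omega> - S" for x
    using derivative_zero_off_support[OF assms(1,2,4) der that] that by auto
  show "((\<lambda>t. if x + t *\<^sub>R e \<in> \<Omega> then g (x + t *\<^sub>R e) else 0) has_real_derivative
            (if x \<in> \<Omega> then g' x else 0)) (at 0)" for x
    by (rule derivative_extend_zero[OF assms(1-4) der])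
  show "continuous_on UNIV (\<lambda>x. if x \<in> \<Omega> then g x else 0)"
    by (rule continuous_on_extend_zero[OF assms(1-3) cont(1) assms(4)])
  show "continuous_on UNIV (\<lambda>x. if x \<in> \<Omega> then g' x else 0)"
    by (rule continuous_on_extend_zero[OF assms(1-3) cont(2) g'0])
  show "bounded S" using assms(2) by (rule compact_imp_bounded)
  show "(if x \<in> \<Omega> then g x else 0) = 0" if "x \<notin> S" for x
    using assms(4) that by simp
  show "(if x \<in> \<Omega> then g' x else 0) = 0" if "x \<notin> S" for x
    using g'0 that by simp
qed

section \<open>Truncations and convex cut-offs\<close>

text \<open>An exponent of at least two removes the corner of the positive part. At 0 the difference
  quotient is \<open>max 0 h * max 0 h ^ n\<close>, where the separate first factor forces the limit
  0 even for \<open>n = 0\<close>.\<close>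

lemma DERIV_pos_part_power:
  fixes x :: real
  shows "((\<lambda>x. max 0 x ^ Suc (Suc n)) has_real_derivative real (Suc (Suc n)) * max 0 x ^ Suc n) (at x)"
proof -
  consider "x < 0" | "x > 0" | "x = 0" by linarith
  then show ?thesis
  proof cases
    case 1
    have "\<forall>\<^sub>F y in nhds x. 0 = max 0 y ^ Suc (Suc n)"
      using eventually_nhds_in_open[of "{..<0}" x] 1 by (auto elim!: eventually_mono)
    from DERIV_cong_ev[OF refl this refl] DERIV_const[of 0 "at x"] show ?thesis
      using 1 by simp
  next
    case 2
    have "\<forall>\<^sub>F y in nhds x. y ^ Suc (Suc n) = max 0 y ^ Suc (Suc n)"
      using eventually_nhds_in_open[of "{0<..}" x] 2 by (auto elim!: eventually_mono)
    from iffD1[OF DERIV_cong_ev[OF refl this refl] DERIV_pow]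
    have "((\<lambda>y. max 0 y ^ Suc (Suc n)) has_real_derivative real (Suc (Suc n)) * x ^ Suc n) (at x)"
      by (simp del: power_Suc)
    moreover have "max 0 x = x" using 2 by simp
    ultimately show ?thesis by (simp only:)
  next
    case 3
    have "((\<lambda>h::real. max 0 h * max 0 h ^ n) \<longlongrightarrow> max 0 0 * max 0 0 ^ n) (at 0)"
      by (intro tendsto_intros)
    moreover have "\<forall>\<^sub>F h::real in at 0. max 0 h * max 0 h ^ n = (max 0 (0 + h) ^ Suc (Suc n) - max 0 0 ^ Suc (Suc n)) / h"
      unfolding eventually_at_filter by (rule always_eventually) (auto simp: max_def)
    ultimately show ?thesis
      unfolding DERIV_def 3 by (auto intro: Lim_transform_eventually)
  qed
qed

text \<open>A convex \<open>C\<^sup>2\<close> approximation of the identity on the half-line that vanishes below \<open>\<epsilon>\<close>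
  and has slope 1 above \<open>3\<epsilon>\<close>, together with its first two derivatives.\<close>

definition trunc :: "real \<Rightarrow> real \<Rightarrow> real" where
  "trunc \<epsilon> t = \<epsilon> * (max 0 (t/\<epsilon> - 1) ^ 3 - 2 * max 0 (t/\<epsilon> - 2) ^ 3 + max 0 (t/\<epsilon> - 3) ^ 3) / 6"

definition trunc' :: "real \<Rightarrow> real \<Rightarrow> real" where
  "trunc' \<epsilon> t = (max 0 (t/\<epsilon> - 1) ^ 2 - 2 * max 0 (t/\<epsilon> - 2) ^ 2 + max 0 (t/\<epsilon> - 3) ^ 2) / 2"

definition trunc'' :: "real \<Rightarrow> real \<Rightarrow> real" where
  "trunc'' \<epsilon> t = (max 0 (t/\<epsilon> - 1) - 2 * max 0 (t/\<epsilon> - 2) + max 0 (t/\<epsilon> - 3)) / \<epsilon>"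

lemma DERIV_trunc:
  assumes "\<epsilon> > 0"
  shows "(trunc \<epsilon> has_real_derivative trunc' \<epsilon> t) (at t)"
    and "(trunc' \<epsilon> has_real_derivative trunc'' \<epsilon> t) (at t)"
proof -
  have lin: "((\<lambda>t. t/\<epsilon> - c) has_real_derivative 1/\<epsilon>) (at t)" for c
    using assms by (auto intro!: derivative_eq_intros)
  have p: "((\<lambda>t. max 0 (t/\<epsilon> - c) ^ Suc (Suc n)) has_real_derivative
      real (Suc (Suc n)) * max 0 (t/\<epsilon> - c) ^ Suc n * (1/\<epsilon>)) (at t)" for c n
    by (rule DERIV_chain2[OF DERIV_pos_part_power lin])
  have p3: "((\<lambda>t. max 0 (t/\<epsilon> - c) ^ 3) has_real_derivative 3 * max 0 (t/\<epsilon> - c) ^ 2 * (1/\<epsilon>)) (at t)" for c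
    using p[of c 1] by (simp add: numeral_eq_Suc)
  have p2: "((\<lambda>t. max 0 (t/\<epsilon> - c) ^ 2) has_real_derivative 2 * max 0 (t/\<epsilon> - c) * (1/\<epsilon>)) (at t)" for c
    using p[of c 0] by (simp add: numeral_eq_Suc)
  show "(trunc \<epsilon> has_real_derivative trunc' \<epsilon> t) (at t)"
    unfolding trunc_def[abs_def] trunc'_def
    by (rule DERIV_cong[OF DERIV_cdivide[OF DERIV_cmult[OF DERIV_add[OF DERIV_diff[OF p3 DERIV_cmult[OF p3]] p3]]]])
      (use assms in \<open>simp add: field_simps\<close>)
  show "(trunc' \<epsilon> has_real_derivative trunc'' \<epsilon> t) (at t)"
    unfolding trunc'_def[abs_def] trunc''_def
    by (rule DERIV_cong[OF DERIV_cdivide[OF DERIV_add[OF DERIV_diff[OF p2 DERIV_cmult[OF p2]] p2]]])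
      (use assms in \<open>simp add: field_simps\<close>)
qed

lemma trunc_below:
  assumes "\<epsilon> > 0" "t \<le> \<epsilon>"
  shows "trunc \<epsilon> t = 0" "trunc' \<epsilon> t = 0" "trunc'' \<epsilon> t = 0"
proof -
  have "t/\<epsilon> \<le> 1" using assms by (simp add: field_simps)
  then have "max 0 (t/\<epsilon> - 1) = 0" "max 0 (t/\<epsilon> - 2) = 0" "max 0 (t/\<epsilon> - 3) = 0" by auto
  then show "trunc \<epsilon> t = 0" "trunc' \<epsilon> t = 0" "trunc'' \<epsilon> t = 0"
    by (simp_all add: trunc_def trunc'_def trunc''_def)
qed

lemma trunc_above:
  assumes "\<epsilon> > 0" "3 * \<epsilon> \<le> t"
  shows "trunc \<epsilon> t = t - 2 * \<epsilon>" "trunc' \<epsilon> t = 1" "trunc'' \<epsilon> t = 0"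
proof -
  define x where "x = t/\<epsilon>"
  have x: "x \<ge> 3" and t: "t = \<epsilon> * x" using assms by (simp_all add: x_def field_simps)
  have "max 0 (x - 1) = x - 1" "max 0 (x - 2) = x - 2" "max 0 (x - 3) = x - 3" using x by auto
  then show "trunc \<epsilon> t = t - 2 * \<epsilon>" "trunc' \<epsilon> t = 1" "trunc'' \<epsilon> t = 0"
    unfolding trunc_def trunc'_def trunc''_def x_def[symmetric] t
    using assms(1) by (simp_all add: field_simps power2_eq_square power3_eq_cube)
qed

text \<open>In the variable t/\<epsilon> the bracket with coefficients 1, -2, 1 is the hat function
  on [1, 3] with peak at 2; \<open>trunc\<close> is its double primitive. The hat has area 1 and
  centre 2, hence the slope 1 and the offset \<open>2 * \<epsilon>\<close> above
  \<open>3 * \<epsilon>\<close>. Its sign is the convexity of \<open>trunc\<close>, which later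
  gives the error term of the truncation a sign.\<close>

lemma trunc''_nonneg:
  assumes "\<epsilon> > 0"
  shows "0 \<le> trunc'' \<epsilon> t"
proof -
  have "0 \<le> max 0 (x - 1) - 2 * max 0 (x - 2) + max 0 (x - 3)" for x :: real
    by (auto simp: max_def)
  then show ?thesis
    unfolding trunc''_def using assms by (intro divide_nonneg_pos)
qed

lemma trunc'_bounds:
  assumes "\<epsilon> > 0"
  shows "0 \<le> trunc' \<epsilon> t" "trunc' \<epsilon> t \<le> 1"
proof -
  have mono: "trunc' \<epsilon> s \<le> trunc' \<epsilon> t" if "s \<le> t" for s t
    using that
  proof (rule DERIV_nonneg_imp_nondecreasing)
    show "\<exists>y. (trunc' \<epsilon> has_real_derivative y) (at x) \<and> 0 \<le> y" for x
      using DERIV_trunc(2)[OF assms] trunc''_nonneg[OF assms] by blast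
  qed
  show "0 \<le> trunc' \<epsilon> t"
    using mono[of "min t \<epsilon>" t] trunc_below(2)[OF assms, of "min t \<epsilon>"] by simp
  show "trunc' \<epsilon> t \<le> 1"
    using mono[of t "max t (3 * \<epsilon>)"] trunc_above(2)[OF assms, of "max t (3 * \<epsilon>)"] by simp
qed

lemma trunc_bounds:
  assumes "\<epsilon> > 0" "0 \<le> t"
  shows "0 \<le> trunc \<epsilon> t" "trunc \<epsilon> t \<le> t"
proof -
  have "0 \<le> trunc \<epsilon> t \<and> trunc \<epsilon> t \<le> t"
  proof (cases "t = 0")
    case True
    then show ?thesis using trunc_below(1)[OF assms(1), of 0] assms by simp
  next
    case False
    then have "\<exists>z>0. z < t \<and> trunc \<epsilon> t - trunc \<epsilon> 0 = (t - 0) * trunc' \<epsilon> z"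
      using assms by (intro MVT2) (auto intro: DERIV_trunc)
    then obtain z where "trunc \<epsilon> t = t * trunc' \<epsilon> z"
      using trunc_below(1)[OF assms(1), of 0] assms by auto
    then show ?thesis
      using trunc'_bounds[OF assms(1), of z] assms(2) by (simp add: mult_left_le)
  qed
  then show "0 \<le> trunc \<epsilon> t" "trunc \<epsilon> t \<le> t" by auto
qed

lemma continuous_trunc:
  assumes "\<epsilon> > 0"
  shows "continuous_on UNIV (trunc \<epsilon>)" "continuous_on UNIV (trunc' \<epsilon>)" "continuous_on UNIV (trunc'' \<epsilon>)"
  unfolding trunc_def[abs_def] trunc'_def[abs_def] trunc''_def[abs_def]
  using assms by (auto intro!: continuous_intros)

lemma eventually_three_inverse_Suc_less:
  "t > 0 \<Longrightarrow> \<forall>\<^sub>F k in sequentially. 3 * inverse (real (Suc k)) \<le> t"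
proof -
  assume "t > 0"
  have "(\<lambda>k. 3 * inverse (real (Suc k))) \<longlonglongrightarrow> 3 * 0"
    by (intro tendsto_intros LIMSEQ_inverse_real_of_nat)
  with \<open>t > 0\<close> have "\<forall>\<^sub>F k in sequentially. 3 * inverse (real (Suc k)) < t"
    by (intro order_tendstoD) auto
  then show ?thesis by (rule eventually_mono) simp
qed

lemma trunc_tendsto:
  assumes "0 \<le> t"
  shows "(\<lambda>k. trunc (inverse (real (Suc k))) t) \<longlonglongrightarrow> t"
proof (cases "t = 0")
  case True
  then show ?thesis by (simp add: trunc_below)
next
  case False
  have "(\<lambda>k. t - 2 * inverse (real (Suc k))) \<longlonglongrightarrow> t - 2 * 0"
    by (intro tendsto_intros LIMSEQ_inverse_real_of_nat)
  moreover have "\<forall>\<^sub>F k in sequentially. t - 2 * inverse (real (Suc k)) = trunc (inverse (real (Suc k))) t"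
    using eventually_three_inverse_Suc_less[of t] assms False
    by (auto elim!: eventually_mono simp: trunc_above)
  ultimately show ?thesis
    by (auto intro: Lim_transform_eventually)
qed

text \<open>Strictness matters: at 0 all truncated slopes are 0. Where \<open>v\<close> vanishes the
  missing limit is made up for by \<open>f 0 = 0\<close>.\<close>

lemma trunc'_tendsto:
  assumes "0 < t"
  shows "(\<lambda>k. trunc' (inverse (real (Suc k))) t) \<longlonglongrightarrow> 1"
  by (rule tendsto_eventually)
    (use eventually_three_inverse_Suc_less[OF assms] in \<open>auto elim!: eventually_mono simp: trunc_above\<close>)

section \<open>Differentiable cut-offs from the distance to a convex set\<close>

lemma DERIV_if_quadratic_remainder:
  fixes q :: "real \<Rightarrow> real"
  assumes "\<And>t. \<bar>q t - q 0 - t * a\<bar> \<le> C * t\<^sup>2"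
  shows "(q has_real_derivative a) (at 0)"
proof -
  have "((\<lambda>h. (q h - q 0) / h - a) \<longlongrightarrow> 0) (at 0)"
  proof (rule Lim_null_comparison)
    show "\<forall>\<^sub>F h in at 0. norm ((q h - q 0) / h - a) \<le> C * \<bar>h\<bar>"
    proof (unfold eventually_at_filter, rule always_eventually, intro allI impI)
      fix h :: real assume "h \<noteq> 0"
      then have "(q h - q 0) / h - a = (q h - q 0 - h * a) / h" by (simp add: field_simps)
      then show "norm ((q h - q 0) / h - a) \<le> C * \<bar>h\<bar>"
        using assms[of h] \<open>h \<noteq> 0\<close> by (simp add: abs_divide divide_le_eq power2_eq_square abs_mult mult.assoc)
    qed
    have "((\<lambda>h::real. C * \<bar>h\<bar>) \<longlongrightarrow> C * \<bar>0\<bar>) (at 0)" by (intro tendsto_intros)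
    then show "((\<lambda>h::real. C * \<bar>h\<bar>) \<longlongrightarrow> 0) (at 0)" by simp
  qed
  then show ?thesis
    unfolding DERIV_def by (simp add: LIM_zero_iff)
qed

text \<open>Minimality of the projection at each of the two points, tested with the projection of
  the other, bounds the increment from above and from below. The two bounds differ by a quadratic
  term only, because the projection onto a convex set is nonexpansive.\<close>

lemma DERIV_sq_dist_convex:
  fixes K :: "'a::euclidean_space set"
  assumes "convex K" "closed K" "K \<noteq> {}"
  shows "((\<lambda>t. (norm (x + t *\<^sub>R e - closest_point K (x + t *\<^sub>R e)))\<^sup>2) has_real_derivative
           2 * ((x - closest_point K x) \<bullet> e)) (at 0)"
proof (rule DERIV_if_quadratic_remainder)
  fix t :: real
  let ?P = "closest_point K"
  let ?y = "x + t *\<^sub>R e"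
  have le: "(norm (a - ?P a))\<^sup>2 \<le> (norm (a - ?P b))\<^sup>2" for a b
    using closest_point_le[OF assms(2) closest_point_in_set[OF assms(2,3), of b], of a]
    by (simp add: dist_norm power_mono)
  have n2: "(norm (v + t *\<^sub>R e))\<^sup>2 = (norm v)\<^sup>2 + 2 * t * (v \<bullet> e) + t\<^sup>2 * (norm e)\<^sup>2" for v
    unfolding power2_norm_eq_inner
    by (simp add: inner_add_left inner_add_right inner_commute algebra_simps power2_eq_square)
  have up: "(norm (?y - ?P ?y))\<^sup>2 \<le> (norm (x - ?P x))\<^sup>2 + 2 * t * ((x - ?P x) \<bullet> e) + t\<^sup>2 * (norm e)\<^sup>2"
  proof -
    have e1: "?y - ?P x = (x - ?P x) + t *\<^sub>R e" by simp
    show ?thesis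
      using le[of ?y x] unfolding e1 n2 .
  qed
  have "(norm (?y - ?P ?y))\<^sup>2 = (norm ((x - ?P ?y) + t *\<^sub>R e))\<^sup>2" by (simp add: algebra_simps)
  also have "\<dots> = (norm (x - ?P ?y))\<^sup>2 + 2 * t * ((x - ?P ?y) \<bullet> e) + t\<^sup>2 * (norm e)\<^sup>2" by (rule n2)
  finally have eq: "(norm (?y - ?P ?y))\<^sup>2 = (norm (x - ?P ?y))\<^sup>2 + 2 * t * ((x - ?P ?y) \<bullet> e) + t\<^sup>2 * (norm e)\<^sup>2" .
  have "\<bar>t * ((?P x - ?P ?y) \<bullet> e)\<bar> \<le> \<bar>t\<bar> * (norm (?P x - ?P ?y) * norm e)"
    using Cauchy_Schwarz_ineq2[of "?P x - ?P ?y" e] by (simp add: abs_mult mult_left_mono)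
  also have "\<dots> \<le> \<bar>t\<bar> * (norm (t *\<^sub>R e) * norm e)"
    using closest_point_lipschitz[OF assms, of x ?y]
    by (intro mult_left_mono mult_right_mono) (auto simp: dist_norm)
  also have "\<dots> = t\<^sup>2 * (norm e)\<^sup>2" by (simp add: power2_eq_square)
  finally have "t * ((?P x - ?P ?y) \<bullet> e) \<ge> - (t\<^sup>2 * (norm e)\<^sup>2)" by linarith
  moreover have "t * ((x - ?P ?y) \<bullet> e) = t * ((x - ?P x) \<bullet> e) + t * ((?P x - ?P ?y) \<bullet> e)"
    by (simp add: inner_diff_left algebra_simps)
  ultimately have low: "(norm (?y - ?P ?y))\<^sup>2 \<ge> (norm (x - ?P x))\<^sup>2 + 2 * t * ((x - ?P x) \<bullet> e) - t\<^sup>2 * (norm e)\<^sup>2"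
    using eq le[of x ?y] by linarith
  show "\<bar>(norm (?y - ?P ?y))\<^sup>2 - (norm (x + 0 *\<^sub>R e - ?P (x + 0 *\<^sub>R e)))\<^sup>2 - t * (2 * ((x - ?P x) \<bullet> e))\<bar> \<le> (norm e)\<^sup>2 * t\<^sup>2"
    using up low by (simp add: abs_le_iff algebra_simps)
qed

text \<open>The cut-off is the square of the positive part of 1 - d^2/\<tau>^2, with d the distance
  to \<open>K\<close>. Using d^2 avoids the corner of d along \<open>K\<close>, and the outer square
  removes the corner at d = \<tau>. With m the positive part, the gradient has norm 4md/\<tau>^2,
  where m \<le> 1, and d \<le> \<tau> unless m = 0; this gives the 16.\<close>

lemma convex_cutoff:
  fixes K :: "(real^'n::finite) set"
  assumes "convex K" "closed K" "K \<noteq> {}" "\<tau> > 0"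
  shows "\<exists>\<eta> \<eta>'. continuous_on UNIV \<eta> \<and> (\<forall>i::'n. continuous_on UNIV (\<eta>' i)) \<and>
     (\<forall>i x. ((\<lambda>t. \<eta> (x + t *\<^sub>R axis i 1)) has_real_derivative \<eta>' i x) (at 0)) \<and>
     (\<forall>x. 0 \<le> \<eta> x \<and> \<eta> x \<le> 1) \<and> (\<forall>x\<in>K. \<eta> x = 1 \<and> (\<forall>i. \<eta>' i x = 0)) \<and>
     (\<forall>x. infdist x K \<ge> \<tau> \<longrightarrow> \<eta> x = 0 \<and> (\<forall>i. \<eta>' i x = 0)) \<and>
     (\<forall>x. (\<Sum>i\<in>UNIV. (\<eta>' i x)\<^sup>2) \<le> 16 / \<tau>\<^sup>2)"
proof -
  let ?P = "closest_point K"
  define m where "m x = max 0 (1 - (norm (x - ?P x))\<^sup>2 / \<tau>\<^sup>2)" for x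
  define \<eta> where "\<eta> x = (m x)\<^sup>2" for x
  define \<eta>' where "\<eta>' i x = 2 * m x * (- (2 * (x - ?P x) $ i) / \<tau>\<^sup>2)" for i x
  have cP: "continuous_on UNIV ?P"
    by (rule continuous_on_closest_point[OF assms(1-3)])
  have cm: "continuous_on UNIV m"
    unfolding m_def[abs_def] using assms(4) by (intro continuous_intros cP) auto
  have m01: "0 \<le> m x" "m x \<le> 1" for x
    by (auto simp: m_def)
  have inK: "norm (x - ?P x) = 0" if "x \<in> K" for x
    using that assms by (simp add: closest_point_self)
  have far: "m x = 0" if "infdist x K \<ge> \<tau>" for x
  proof -
    have "infdist x K \<le> dist x (?P x)"
      by (intro infdist_le closest_point_in_set assms)
    then have "\<tau> \<le> norm (x - ?P x)" using that by (simp add: dist_norm)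
    then have "\<tau>\<^sup>2 \<le> (norm (x - ?P x))\<^sup>2" using assms(4) by (simp add: power_mono)
    then show ?thesis using assms(4) by (simp add: m_def divide_le_eq field_simps)
  qed
  have der: "((\<lambda>t. \<eta> (x + t *\<^sub>R axis i 1)) has_real_derivative \<eta>' i x) (at 0)" for i x
  proof -
    let ?q = "\<lambda>t. (norm (x + t *\<^sub>R axis i 1 - ?P (x + t *\<^sub>R axis i 1)))\<^sup>2"
    have "(?q has_real_derivative 2 * (x - ?P x) $ i) (at 0)"
      using DERIV_sq_dist_convex[OF assms(1-3), of x "axis i 1"] by (simp add: inner_axis)
    then have "((\<lambda>t. 1 - ?q t / \<tau>\<^sup>2) has_real_derivative 0 - 2 * (x - ?P x) $ i / \<tau>\<^sup>2) (at 0)"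
      by (intro DERIV_diff DERIV_const DERIV_cdivide)
    from DERIV_chain2[OF DERIV_pos_part_power[of 0] this]
    have "((\<lambda>t. (max 0 (1 - ?q t / \<tau>\<^sup>2)) ^ Suc (Suc 0)) has_real_derivative \<eta>' i x) (at 0)"
      by (rule DERIV_cong) (simp add: \<eta>'_def m_def del: vector_minus_component)
    then show ?thesis
      unfolding \<eta>_def m_def numeral_2_eq_2 .
  qed
  have sum: "(\<Sum>i\<in>UNIV. (\<eta>' i x)\<^sup>2) \<le> 16 / \<tau>\<^sup>2" for x
  proof -
    let ?d = "norm (x - ?P x)"
    have "(\<Sum>i\<in>UNIV. (\<eta>' i x)\<^sup>2) = (\<Sum>i\<in>UNIV. (16 * (m x)\<^sup>2 / \<tau>^4) * ((x - ?P x) $ i)\<^sup>2)"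
      by (intro sum.cong) (auto simp: \<eta>'_def power_mult_distrib power_divide simp del: vector_minus_component)
    also have "\<dots> = 16 * (m x)\<^sup>2 / \<tau>^4 * ?d\<^sup>2"
      by (simp add: sum_distrib_left norm_vec_def L2_set_def sum_nonneg)
    also have "\<dots> \<le> 16 / \<tau>\<^sup>2"
    proof (cases "m x = 0")
      case False
      then have "?d\<^sup>2 \<le> \<tau>\<^sup>2" using assms(4) by (auto simp: m_def max_def field_simps split: if_splits)
      then have "(m x)\<^sup>2 * ?d\<^sup>2 \<le> 1 * \<tau>\<^sup>2"
        using m01[of x] by (intro mult_mono) (auto simp: power_le_one)
      then show ?thesis
        using assms(4) by (simp add: field_simps power4_eq_xxxx power2_eq_square)
    qed (use assms(4) in auto)
    finally show ?thesis .
  qed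
  have "continuous_on UNIV \<eta>" "continuous_on UNIV (\<eta>' i)" for i
    unfolding \<eta>_def[abs_def] \<eta>'_def[abs_def] using assms(4) by (intro continuous_intros cP cm; simp)+
  moreover have "0 \<le> \<eta> x" "\<eta> x \<le> 1" for x
    using m01[of x] by (auto simp: \<eta>_def power_le_one)
  moreover have "\<eta> x = 1" "\<eta>' i x = 0" if "x \<in> K" for x i
    using inK[OF that] by (auto simp: \<eta>_def \<eta>'_def m_def)
  moreover have "\<eta> x = 0" "\<eta>' i x = 0" if "infdist x K \<ge> \<tau>" for x i
    using far[OF that] by (auto simp: \<eta>_def \<eta>'_def)
  ultimately show ?thesis
    using der sum by (intro exI[of _ \<eta>] exI[of _ \<eta>'] conjI allI ballI impI)
qed

section \<open>Integration by parts for positive solutions\<close>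

text \<open>The multiplier is absorbed in \<open>f\<close>, so that the analysis does not see the
  particular powers. The condition \<open>f 0 = 0\<close> lets \<open>f (v x)\<close> vanish outside
  \<Omega> and stay continuous on the whole space.\<close>

locale positive_solution =
  fixes \<Omega> :: "(real^'n::finite) set" and u :: "real^'n \<Rightarrow> real" and f :: "real \<Rightarrow> real"
  assumes open_dom: "open \<Omega>" and bounded_dom: "bounded \<Omega>"
    and C2: "Ck_on 2 \<Omega> u" and cont_closure: "continuous_on (closure \<Omega>) u"
    and pos: "\<And>x. x \<in> \<Omega> \<Longrightarrow> 0 < u x" and bdry: "\<And>x. x \<in> frontier \<Omega> \<Longrightarrow> u x = 0"
    and pde: "\<And>x. x \<in> \<Omega> \<Longrightarrow> - laplacian u x = f (u x)"
    and cont_f: "continuous_on {0..} f" and f_0: "f 0 = 0"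
begin

definition v :: "real^'n \<Rightarrow> real" where
  "v x = (if x \<in> \<Omega> then u x else 0)"

definition trunc_grad :: "real \<Rightarrow> 'n \<Rightarrow> real^'n \<Rightarrow> real" where
  "trunc_grad \<epsilon> i x = (if x \<in> \<Omega> then trunc' \<epsilon> (u x) * pdiff i u x else 0)"

text \<open>The error term in the equation of the truncated solution: -\<Delta>(trunc \<epsilon> u)
  = trunc' \<epsilon> u f(u) - \<open>trunc_defect\<close>. It lives where \<epsilon> < v <
  3\<epsilon>, which is what allows test functions to avoid it.\<close>

definition trunc_defect :: "real \<Rightarrow> real^'n \<Rightarrow> real" where
  "trunc_defect \<epsilon> x = (if x \<in> \<Omega> then trunc'' \<epsilon> (u x) * (\<Sum>i\<in>UNIV. (pdiff i u x)\<^sup>2) else 0)"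

lemma cont_u: "continuous_on \<Omega> u"
  using cont_closure closure_subset by (rule continuous_on_subset)

lemma cont_pdiff: "continuous_on \<Omega> (pdiff i u)"
  and cont_pdiff2: "continuous_on \<Omega> (iter_pdiff [i, i] u)"
proof -
  have "continuous_on \<Omega> (iter_pdiff is u)" if "length is \<le> 2" for "is"
    using C2 that unfolding Ck_on_def by blast
  from this[of "[i]"] this[of "[i, i]"]
  show "continuous_on \<Omega> (pdiff i u)" "continuous_on \<Omega> (iter_pdiff [i, i] u)" by simp_all
qed

lemma DERIV_u: "x \<in> \<Omega> \<Longrightarrow> ((\<lambda>t. u (x + t *\<^sub>R axis i 1)) has_real_derivative pdiff i u x) (at 0)"
  and DERIV_pdiff: "x \<in> \<Omega> \<Longrightarrow>
    ((\<lambda>t. pdiff i u (x + t *\<^sub>R axis i 1)) has_real_derivative iter_pdiff [i, i] u x) (at 0)"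
proof -
  assume x: "x \<in> \<Omega>"
  have "((\<lambda>t. iter_pdiff is u (x + t *\<^sub>R axis i 1)) has_real_derivative iter_pdiff (i # is) u x) (at 0)"
    if "length is < 2" for "is"
    using C2 that x unfolding Ck_on_def by blast
  from this[of "[]"] this[of "[i]"]
  show "((\<lambda>t. u (x + t *\<^sub>R axis i 1)) has_real_derivative pdiff i u x) (at 0)"
    "((\<lambda>t. pdiff i u (x + t *\<^sub>R axis i 1)) has_real_derivative iter_pdiff [i, i] u x) (at 0)"
    by simp_all
qed

lemma v_outside: "x \<notin> \<Omega> \<Longrightarrow> v x = 0"
  by (simp add: v_def)

lemma v_nonneg: "0 \<le> v x"
  using pos[of x] by (auto simp: v_def)

lemma v_pos_iff: "0 < v x \<longleftrightarrow> x \<in> \<Omega>"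
  using pos[of x] by (auto simp: v_def)

lemma cont_v: "continuous_on UNIV v"
proof -
  have "continuous_on (closure \<Omega>) v"
  proof (rule continuous_on_eq[OF cont_closure])
    fix x assume "x \<in> closure \<Omega>"
    then show "u x = v x"
      using bdry[of x] open_dom by (auto simp: v_def frontier_def interior_open)
  qed
  moreover have "continuous_on (- \<Omega>) v"
    by (rule continuous_on_eq[where f="\<lambda>x. 0"]) (auto simp: v_def)
  moreover have "closed (- \<Omega>)" using open_dom by (simp add: closed_Compl)
  ultimately have "continuous_on (closure \<Omega> \<union> - \<Omega>) v"
    by (intro continuous_on_closed_Un) auto
  moreover have "closure \<Omega> \<union> - \<Omega> = UNIV" using closure_subset by auto
  ultimately show ?thesis by simp
qed

text \<open>The zero boundary values enter here: through the continuity of \<open>v\<close> they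
  make positive superlevel sets closed, so that everything truncated at height \<epsilon> has
  compact support inside \<Omega>.\<close>

lemma compact_superlevel:
  assumes "\<epsilon> > 0"
  shows "compact {x. \<epsilon> \<le> v x}" "{x. \<epsilon> \<le> v x} \<subseteq> \<Omega>"
proof -
  show sub: "{x. \<epsilon> \<le> v x} \<subseteq> \<Omega>"
    using assms by (auto simp: v_def split: if_splits)
  have "closed {x. \<epsilon> \<le> v x}"
    using cont_v by (intro closed_Collect_le) auto
  then show "compact {x. \<epsilon> \<le> v x}"
    using bounded_dom sub bounded_subset compact_eq_bounded_closed by blast
qed

lemma v_lower_bound_compact:
  assumes "compact S" "S \<subseteq> \<Omega>"
  shows "\<exists>m>0. \<forall>x\<in>S. m \<le> v x"
proof (cases "S = {}")
  case False
  then obtain z where "z \<in> S" "\<forall>x\<in>S. v z \<le> v x"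
    using continuous_attains_inf[OF assms(1)] continuous_on_subset[OF cont_v] by blast
  then show ?thesis using v_pos_iff assms(2) by blast
qed (auto intro: exI[of _ 1])

lemma integrable_dom:
  fixes h :: "real^'n \<Rightarrow> real"
  assumes "continuous_on UNIV h" "\<And>x. x \<notin> \<Omega> \<Longrightarrow> h x = 0"
  shows "h integrable_on UNIV"
  by (rule integrable_continuous_bounded_support[OF assms(1) bounded_dom assms(2)])

lemma integral_dom_mono:
  assumes "continuous_on UNIV g" "\<And>x. x \<notin> \<Omega> \<Longrightarrow> g x = 0"
    and "continuous_on UNIV h" "\<And>x. x \<notin> \<Omega> \<Longrightarrow> h x = 0"
    and "\<And>x. g x \<le> (h x :: real)"
  shows "integral UNIV g \<le> integral UNIV h"
  by (intro integral_le integrable_dom assms)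

lemma cont_comp_v:
  assumes "continuous_on {0..} g"
  shows "continuous_on UNIV (\<lambda>x. g (v x))"
  by (rule continuous_on_compose2[OF assms cont_v]) (auto simp: v_nonneg)

lemma cont_trunc_v:
  assumes "\<epsilon> > 0"
  shows "continuous_on UNIV (\<lambda>x. trunc \<epsilon> (v x))" "continuous_on UNIV (\<lambda>x. trunc' \<epsilon> (v x))"
  using continuous_trunc[OF assms] by (auto intro!: cont_comp_v intro: continuous_on_subset)

lemma cont_fv: "continuous_on UNIV (\<lambda>x. f (v x))"
  by (rule cont_comp_v[OF cont_f])

lemma fv_outside: "x \<notin> \<Omega> \<Longrightarrow> f (v x) = 0"
  by (simp add: v_outside f_0)

lemma DERIV_comp_u:
  assumes "x \<in> \<Omega>" "(g has_real_derivative d) (at (u x))"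
  shows "((\<lambda>t. g (u (x + t *\<^sub>R axis i 1))) has_real_derivative d * pdiff i u x) (at 0)"
  by (rule DERIV_chain2[where f=g and g="\<lambda>t. u (x + t *\<^sub>R axis i 1)" and x=0 and s=UNIV, OF _ DERIV_u[OF assms(1)]])
    (use assms(2) in simp)

lemma DERIV_trunc_v:
  assumes "\<epsilon> > 0"
  shows "((\<lambda>t. trunc \<epsilon> (v (x + t *\<^sub>R axis i 1))) has_real_derivative trunc_grad \<epsilon> i x) (at 0)"
proof -
  have "((\<lambda>t. if x + t *\<^sub>R axis i 1 \<in> \<Omega> then trunc \<epsilon> (u (x + t *\<^sub>R axis i 1)) else 0) has_real_derivative
            (if x \<in> \<Omega> then trunc' \<epsilon> (u x) * pdiff i u x else 0)) (at 0)"
  proof (rule derivative_extend_zero[OF open_dom compact_superlevel[OF assms]])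
    show "trunc \<epsilon> (u y) = 0" if "y \<in> \<Omega> - {x. \<epsilon> \<le> v x}" for y
      using that assms by (auto simp: v_def trunc_below)
  qed (rule DERIV_comp_u[OF _ DERIV_trunc(1)[OF assms]])
  moreover have "trunc \<epsilon> (v y) = (if y \<in> \<Omega> then trunc \<epsilon> (u y) else 0)" for y
    using assms by (simp add: v_def trunc_below)
  ultimately show ?thesis
    by (simp add: trunc_grad_def)
qed

lemma cont_trunc_u:
  assumes "\<epsilon> > 0"
  shows "continuous_on \<Omega> (\<lambda>x. trunc' \<epsilon> (u x))" "continuous_on \<Omega> (\<lambda>x. trunc'' \<epsilon> (u x))"
  using continuous_trunc[OF assms]
  by (auto intro!: continuous_on_compose2[OF _ cont_u])

lemma cont_trunc_grad:
  assumes "\<epsilon> > 0"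
  shows "continuous_on UNIV (trunc_grad \<epsilon> i)"
  unfolding trunc_grad_def[abs_def]
proof (rule continuous_on_extend_zero[OF open_dom compact_superlevel[OF assms]])
  show "trunc' \<epsilon> (u x) * pdiff i u x = 0" if "x \<in> \<Omega> - {x. \<epsilon> \<le> v x}" for x
    using that assms by (auto simp: v_def trunc_below)
qed (intro continuous_intros cont_trunc_u assms cont_pdiff)

lemma cont_trunc_defect:
  assumes "\<epsilon> > 0"
  shows "continuous_on UNIV (trunc_defect \<epsilon>)"
  unfolding trunc_defect_def[abs_def]
proof (rule continuous_on_extend_zero[OF open_dom compact_superlevel[OF assms]])
  show "trunc'' \<epsilon> (u x) * (\<Sum>i\<in>UNIV. (pdiff i u x)\<^sup>2) = 0" if "x \<in> \<Omega> - {x. \<epsilon> \<le> v x}" for x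
    using that assms by (auto simp: v_def trunc_below)
qed (intro continuous_intros cont_trunc_u assms cont_pdiff)

lemma trunc_defect_nonneg: "\<epsilon> > 0 \<Longrightarrow> 0 \<le> trunc_defect \<epsilon> x"
  by (simp add: trunc_defect_def trunc''_nonneg sum_nonneg)

lemma trunc_grad_outside: "x \<notin> \<Omega> \<Longrightarrow> trunc_grad \<epsilon> i x = 0"
  and trunc_defect_outside: "x \<notin> \<Omega> \<Longrightarrow> trunc_defect \<epsilon> x = 0"
  by (simp_all add: trunc_grad_def trunc_defect_def)

text \<open>The field \<open>trunc' \<epsilon> (u) \<nabla>u\<close> has compact support in \<open>\<Omega>\<close>, so no regularity of \<open>u\<close> at
  the boundary is involved.\<close>

lemma weak_form:
  assumes \<epsilon>: "\<epsilon> > 0" and V: "continuous_on UNIV V" "\<And>i. continuous_on UNIV (V' i)"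
    and derV: "\<And>i x. ((\<lambda>t. V (x + t *\<^sub>R axis i 1)) has_real_derivative V' i x) (at 0)"
  shows "(\<Sum>i\<in>UNIV. integral UNIV (\<lambda>x. trunc_grad \<epsilon> i x * V' i x)) =
    integral UNIV (\<lambda>x. V x * (trunc' \<epsilon> (v x) * f (v x))) - integral UNIV (\<lambda>x. V x * trunc_defect \<epsilon> x)"
proof -
  let ?S = "{x. \<epsilon> \<le> v x}"
  \<comment> \<open>The partial derivative in direction \<open>i\<close> of \<open>V\<close> times
    the \<open>i\<close>-th component of the truncated gradient; its integral vanishes, and summing
    over \<open>i\<close> brings in the Laplacian.\<close>
  define h where "h i x = V' i x * (trunc' \<epsilon> (u x) * pdiff i u x) +
     V x * (trunc'' \<epsilon> (u x) * pdiff i u x * pdiff i u x + trunc' \<epsilon> (u x) * iter_pdiff [i, i] u x)" for i x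
  have h0: "integral UNIV (\<lambda>x. if x \<in> \<Omega> then h i x else 0) = 0" for i
  proof (rule integral_derivative_compact_support[OF open_dom compact_superlevel[OF \<epsilon>],
        where g="\<lambda>x. V x * (trunc' \<epsilon> (u x) * pdiff i u x)" and e="axis i 1"])
    show "V x * (trunc' \<epsilon> (u x) * pdiff i u x) = 0" if "x \<in> \<Omega> - ?S" for x
      using that \<epsilon> by (auto simp: v_def trunc_below)
    show "((\<lambda>t. V (x + t *\<^sub>R axis i 1) * (trunc' \<epsilon> (u (x + t *\<^sub>R axis i 1)) * pdiff i u (x + t *\<^sub>R axis i 1)))
        has_real_derivative h i x) (at 0)" if "x \<in> \<Omega>" for x
      by (rule DERIV_cong[OF DERIV_mult[OF derV DERIV_mult[OF DERIV_comp_u[OF that DERIV_trunc(2)[OF \<epsilon>]] DERIV_pdiff[OF that]]]])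
        (simp add: h_def algebra_simps)
    have "continuous_on \<Omega> V" "continuous_on \<Omega> (V' i)"
      using V continuous_on_subset by blast+
    note c = this
    show "continuous_on \<Omega> (\<lambda>x. V x * (trunc' \<epsilon> (u x) * pdiff i u x))"
      by (intro continuous_intros cont_trunc_u \<epsilon> cont_pdiff c)
    show "continuous_on \<Omega> (h i)"
      unfolding h_def[abs_def] by (intro continuous_intros cont_trunc_u \<epsilon> cont_pdiff cont_pdiff2 c)
  qed
  define H where "H x = (\<Sum>i\<in>UNIV. if x \<in> \<Omega> then h i x else 0)" for x
  have Heq: "H x = (\<Sum>i\<in>UNIV. trunc_grad \<epsilon> i x * V' i x) + V x * trunc_defect \<epsilon> x
      - V x * (trunc' \<epsilon> (v x) * f (v x))" for x
  proof (cases "x \<in> \<Omega>")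
    case True
    have "H x = (\<Sum>i\<in>UNIV. trunc_grad \<epsilon> i x * V' i x + V x * (trunc'' \<epsilon> (u x) * (pdiff i u x)\<^sup>2)
          + V x * trunc' \<epsilon> (u x) * iter_pdiff [i, i] u x)"
      unfolding H_def using True
      by (intro sum.cong) (auto simp: h_def trunc_grad_def algebra_simps power2_eq_square)
    also have "\<dots> = (\<Sum>i\<in>UNIV. trunc_grad \<epsilon> i x * V' i x) + V x * trunc_defect \<epsilon> x
          + V x * trunc' \<epsilon> (u x) * laplacian u x"
      using True by (simp add: sum.distrib trunc_defect_def laplacian_def sum_distrib_left)
    also have "laplacian u x = - f (v x)"
      using pde[OF True] True by (simp add: v_def)
    finally show ?thesis using True by (simp add: v_def)
  next
    case False
    then show ?thesis by (simp add: H_def trunc_grad_def trunc_defect_def fv_outside)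
  qed
  have ig: "(\<lambda>x. trunc_grad \<epsilon> i x * V' i x) integrable_on UNIV" for i
    by (rule integrable_dom) (auto intro!: continuous_intros cont_trunc_grad \<epsilon> V simp: trunc_grad_outside)
  have idf: "(\<lambda>x. V x * trunc_defect \<epsilon> x) integrable_on UNIV"
    by (rule integrable_dom) (auto intro!: continuous_intros cont_trunc_defect \<epsilon> V simp: trunc_defect_outside)
  have iff: "(\<lambda>x. V x * (trunc' \<epsilon> (v x) * f (v x))) integrable_on UNIV"
    by (rule integrable_dom) (auto intro!: continuous_intros cont_trunc_v \<epsilon> cont_fv V simp: fv_outside)
  have ih: "(\<lambda>x. if x \<in> \<Omega> then h i x else 0) integrable_on UNIV" for i
  proof (rule integrable_dom)
    show "continuous_on UNIV (\<lambda>x. if x \<in> \<Omega> then h i x else 0)"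
    proof (rule continuous_on_extend_zero[OF open_dom compact_superlevel[OF \<epsilon>]])
      have "continuous_on \<Omega> V" "continuous_on \<Omega> (V' i)"
        using V continuous_on_subset by blast+
      then show "continuous_on \<Omega> (h i)"
        unfolding h_def[abs_def] by (intro continuous_intros cont_trunc_u \<epsilon> cont_pdiff cont_pdiff2)
      show "h i x = 0" if "x \<in> \<Omega> - ?S" for x
        using that \<epsilon> by (auto simp: v_def trunc_below h_def)
    qed
  qed auto
  have "integral UNIV H = (\<Sum>i\<in>UNIV. integral UNIV (\<lambda>x. if x \<in> \<Omega> then h i x else 0))"
    unfolding H_def[abs_def] by (rule integral_sum) (auto intro: ih)
  then have "integral UNIV H = 0" using h0 by simp
  moreover have "integral UNIV H = (\<Sum>i\<in>UNIV. integral UNIV (\<lambda>x. trunc_grad \<epsilon> i x * V' i x))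
     + integral UNIV (\<lambda>x. V x * trunc_defect \<epsilon> x) - integral UNIV (\<lambda>x. V x * (trunc' \<epsilon> (v x) * f (v x)))"
    unfolding Heq[abs_def]
    by (simp add: integral_diff integral_add integral_sum integrable_add integrable_sum ig idf iff)
  ultimately show ?thesis by simp
qed

text \<open>The truncated solution is its own test function. The defect enters with a minus sign and
  is nonnegative by convexity of \<open>trunc\<close>, so dropping it leaves an inequality in the
  useful direction.\<close>

lemma trunc_energy:
  assumes \<epsilon>: "\<epsilon> > 0"
  shows "(\<Sum>i\<in>UNIV. integral UNIV (\<lambda>x. (trunc_grad \<epsilon> i x)\<^sup>2)) \<le>
    integral UNIV (\<lambda>x. trunc \<epsilon> (v x) * (trunc' \<epsilon> (v x) * f (v x)))"
proof -
  have "(\<Sum>i\<in>UNIV. integral UNIV (\<lambda>x. trunc_grad \<epsilon> i x * trunc_grad \<epsilon> i x)) =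
    integral UNIV (\<lambda>x. trunc \<epsilon> (v x) * (trunc' \<epsilon> (v x) * f (v x)))
      - integral UNIV (\<lambda>x. trunc \<epsilon> (v x) * trunc_defect \<epsilon> x)"
    by (rule weak_form[OF \<epsilon> cont_trunc_v(1)[OF \<epsilon>] cont_trunc_grad[OF \<epsilon>] DERIV_trunc_v[OF \<epsilon>]])
  moreover have "0 \<le> integral UNIV (\<lambda>x. trunc \<epsilon> (v x) * trunc_defect \<epsilon> x)"
  proof (rule integral_nonneg)
    show "(\<lambda>x. trunc \<epsilon> (v x) * trunc_defect \<epsilon> x) integrable_on UNIV"
      by (rule integrable_dom) (auto intro!: continuous_intros cont_trunc_defect \<epsilon> cont_trunc_v simp: trunc_defect_outside)
  qed (simp add: trunc_defect_nonneg \<epsilon> trunc_bounds v_nonneg)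
  ultimately show ?thesis by (simp add: power2_eq_square)
qed

end

section \<open>Dilations\<close>

lemma square_le_if_quadratic_nonneg:
  fixes a b c :: real
  assumes "\<And>t. 0 \<le> a - 2 * t * c + t\<^sup>2 * b" and "0 \<le> b"
  shows "c\<^sup>2 \<le> a * b"
proof (cases "b = 0")
  case True
  have "c = 0"
  proof (rule ccontr)
    assume "c \<noteq> 0"
    \<comment> \<open>At this argument the expression, then linear in \<open>t\<close>, takes the
      value -1.\<close>
    then show False using assms(1)[of "(a + 1) / (2 * c)"] True by simp
  qed
  then show ?thesis using True by simp
next
  case False
  then have "b > 0" using assms(2) by simp
  with assms(1)[of "c / b"] show ?thesis
    by (simp add: field_simps power2_eq_square)
qed

lemma Cauchy_Schwarz_integral_sum:
  fixes a b :: "'i \<Rightarrow> 'a::euclidean_space \<Rightarrow> real"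
  assumes "\<And>i. i \<in> I \<Longrightarrow> (\<lambda>x. (a i x)\<^sup>2) integrable_on S" "\<And>i. i \<in> I \<Longrightarrow> (\<lambda>x. (b i x)\<^sup>2) integrable_on S"
    "\<And>i. i \<in> I \<Longrightarrow> (\<lambda>x. a i x * b i x) integrable_on S"
  shows "(\<Sum>i\<in>I. integral S (\<lambda>x. a i x * b i x))\<^sup>2 \<le>
    (\<Sum>i\<in>I. integral S (\<lambda>x. (a i x)\<^sup>2)) * (\<Sum>i\<in>I. integral S (\<lambda>x. (b i x)\<^sup>2))"
proof (rule square_le_if_quadratic_nonneg)
  fix t :: real
  have "0 \<le> (\<Sum>i\<in>I. integral S (\<lambda>x. (a i x)\<^sup>2 - (2 * t) * (a i x * b i x) + t\<^sup>2 * (b i x)\<^sup>2))"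
  proof (rule sum_nonneg, rule integral_nonneg)
    fix i assume i: "i \<in> I"
    show "(\<lambda>x. (a i x)\<^sup>2 - (2 * t) * (a i x * b i x) + t\<^sup>2 * (b i x)\<^sup>2) integrable_on S"
      by (intro integrable_add integrable_diff integrable_on_mult_right assms i)
    have "0 \<le> (a i x - t * b i x)\<^sup>2" for x by simp
    then show "0 \<le> (a i x)\<^sup>2 - (2 * t) * (a i x * b i x) + t\<^sup>2 * (b i x)\<^sup>2" for x
      by (simp add: power2_diff power_mult_distrib algebra_simps)
  qed
  also have "\<dots> = (\<Sum>i\<in>I. integral S (\<lambda>x. (a i x)\<^sup>2) - (2 * t) * integral S (\<lambda>x. a i x * b i x)
      + t\<^sup>2 * integral S (\<lambda>x. (b i x)\<^sup>2))"
    by (intro sum.cong refl)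
      (simp add: integral_add integral_diff integrable_diff integrable_on_mult_right assms)
  finally show "0 \<le> (\<Sum>i\<in>I. integral S (\<lambda>x. (a i x)\<^sup>2)) - 2 * t * (\<Sum>i\<in>I. integral S (\<lambda>x. a i x * b i x))
      + t\<^sup>2 * (\<Sum>i\<in>I. integral S (\<lambda>x. (b i x)\<^sup>2))"
    by (simp add: sum.distrib sum_subtractf sum_distrib_left)
next
  show "0 \<le> (\<Sum>i\<in>I. integral S (\<lambda>x. (b i x)\<^sup>2))"
    by (intro sum_nonneg integral_nonneg assms) auto
qed

definition dilation :: "'a::real_vector \<Rightarrow> real \<Rightarrow> 'a \<Rightarrow> 'a" where
  "dilation x0 l x = l *\<^sub>R x + (1 - l) *\<^sub>R x0"

lemma continuous_on_dilation: "continuous_on S (dilation (x0::'a::real_normed_vector) l)"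
  unfolding dilation_def[abs_def] by (intro continuous_intros)

lemma dilation_shift: "dilation x0 l (x + t *\<^sub>R e) = dilation x0 l x + (l * t) *\<^sub>R e"
  by (simp add: dilation_def algebra_simps)

text \<open>The point \<open>x\<close> lies on the segment from \<open>x0\<close> to its image at
  ratio \<open>1/l\<close> < 1, and such segments from an interior point to the closure stay in the
  interior short of their end. Consequently the dilated solution vanishes already before the
  boundary is reached.\<close>

lemma dilation_pre_image_interior:
  fixes S :: "'a::euclidean_space set"
  assumes "convex S" "x0 \<in> interior S" "l > 1" "dilation x0 l x \<in> closure S"
  shows "x \<in> interior S"
proof -
  let ?y = "dilation x0 l x"
  have "?y - (1 - 1/l) *\<^sub>R (?y - x0) \<in> interior S"
    by (rule mem_interior_closure_convex_shrink[OF assms(1,2,4)]) (use assms(3) in auto)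
  moreover have "?y - (1 - 1/l) *\<^sub>R (?y - x0) = x"
  proof -
    have "?y - (1 - 1/l) *\<^sub>R (?y - x0) = (1/l) *\<^sub>R ?y + (1 - 1/l) *\<^sub>R x0"
      by (simp add: algebra_simps)
    also have "\<dots> = x"
      using assms(3) by (simp add: dilation_def scaleR_add_right diff_divide_distrib flip: scaleR_add_left)
    finally show ?thesis .
  qed
  ultimately show ?thesis by simp
qed

locale positive_solution_convex = positive_solution \<Omega> u f
  for \<Omega> :: "(real^'n::finite) set" and u f +
  fixes x0 :: "real^'n"
  assumes convex_dom: "convex \<Omega>" and x0: "x0 \<in> \<Omega>"
begin

abbreviation "dil \<equiv> dilation x0"

lemma dil_in_dom: "l > 1 \<Longrightarrow> dil l x \<in> closure \<Omega> \<Longrightarrow> x \<in> \<Omega>"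
  using dilation_pre_image_interior[OF convex_dom, of x0 l x] x0 open_dom
  by (simp add: interior_open)

lemma dil_outside: "l > 1 \<Longrightarrow> x \<notin> \<Omega> \<Longrightarrow> dil l x \<notin> \<Omega>"
  using dil_in_dom[of l x] closure_subset[of \<Omega>] by blast

text \<open>Taking the preimage of the closure, not of \<Omega>, makes it closed; the support of the
  dilated solution thus sits in a compact subset of \<Omega>.\<close>

lemma compact_dil_pre_image:
  assumes "l > 1"
  shows "compact {x. dil l x \<in> closure \<Omega>}" "{x. dil l x \<in> closure \<Omega>} \<subseteq> \<Omega>"
proof -
  show sub: "{x. dil l x \<in> closure \<Omega>} \<subseteq> \<Omega>" using dil_in_dom[OF assms] by blast
  have "closed (dil l -` closure \<Omega>)"
    by (intro closed_vimage continuous_on_dilation) simp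
  then have "closed {x. dil l x \<in> closure \<Omega>}" by (simp add: vimage_def)
  then show "compact {x. dil l x \<in> closure \<Omega>}"
    using sub bounded_dom bounded_subset compact_eq_bounded_closed by blast
qed

lemma cont_v_dil: "continuous_on UNIV (\<lambda>x. v (dil l x))"
  by (rule continuous_on_compose2[OF cont_v continuous_on_dilation]) simp

lemma v_dil_outside: "l > 1 \<Longrightarrow> x \<notin> \<Omega> \<Longrightarrow> v (dil l x) = 0"
  by (simp add: dil_outside v_outside)

lemma integral_dil:
  assumes "continuous_on UNIV g" "\<And>x. x \<notin> \<Omega> \<Longrightarrow> g x = (0::real)" "l > 0"
  shows "integral UNIV (\<lambda>x. g (dil l x)) = integral UNIV g / l ^ CARD('n)"
  using integral_affinity_UNIV[OF assms(1) bounded_dom assms(2,3), of "(1 - l) *\<^sub>R x0"]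
  by (simp add: dilation_def)

lemma DERIV_trunc_v_dil:
  assumes "\<epsilon> > 0"
  shows "((\<lambda>t. trunc \<epsilon> (v (dil l (x + t *\<^sub>R axis i 1)))) has_real_derivative l * trunc_grad \<epsilon> i (dil l x)) (at 0)"
proof -
  have "((\<lambda>t. l * t) has_real_derivative l) (at 0)"
    using DERIV_cmult[OF DERIV_ident, of l 0] by simp
  moreover have "((\<lambda>s. trunc \<epsilon> (v (dil l x + s *\<^sub>R axis i 1))) has_real_derivative trunc_grad \<epsilon> i (dil l x)) (at (l * 0))"
    using DERIV_trunc_v[OF assms] by simp
  ultimately show ?thesis
    unfolding dilation_shift mult.commute[of l "trunc_grad \<epsilon> i (dil l x)"]
    by (intro DERIV_chain2[of "\<lambda>s. trunc \<epsilon> (v (dil l x + s *\<^sub>R axis i 1))" _ "\<lambda>t. l * t" 0 l UNIV])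
qed

text \<open>The quantity shown to be nonnegative bounds the Dirichlet energy of the difference between the
  truncated solution and its dilation. On the support of the gradient of \<open>\<eta>\<close>, a thin layer along
  the boundary, the dilated function vanishes.\<close>

lemma dilation_inequality_trunc:
  assumes \<epsilon>: "\<epsilon> > 0" and l: "l > 1"
    and \<eta>: "continuous_on UNIV \<eta>" "\<And>i. continuous_on UNIV (\<eta>' i)"
    and der\<eta>: "\<And>i x. ((\<lambda>t. \<eta> (x + t *\<^sub>R axis i 1)) has_real_derivative \<eta>' i x) (at 0)"
    and supp: "\<And>x. x \<notin> S \<Longrightarrow> \<eta> x = 0" "\<And>x i. x \<notin> S \<Longrightarrow> \<eta>' i x = 0" and S: "S \<subseteq> \<Omega>"
    and flat: "\<And>x i. dil l x \<in> \<Omega> \<Longrightarrow> \<eta>' i x = 0"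
    and small: "\<And>x. x \<in> S \<or> dil l x \<in> \<Omega> \<Longrightarrow> 3 * \<epsilon> \<le> v x"
  shows "0 \<le> (1 + l\<^sup>2 / l ^ CARD('n)) * integral UNIV (\<lambda>x. trunc \<epsilon> (v x) * (trunc' \<epsilon> (v x) * f (v x)))
      - 2 * integral UNIV (\<lambda>x. trunc \<epsilon> (v (dil l x)) * (trunc' \<epsilon> (v x) * f (v x)))" (is "0 \<le> ?Q")
    and "(integral UNIV (\<lambda>x. \<eta> x * (trunc' \<epsilon> (v x) * f (v x))))\<^sup>2 \<le>
    ((1 + l\<^sup>2 / l ^ CARD('n)) * integral UNIV (\<lambda>x. trunc \<epsilon> (v x) * (trunc' \<epsilon> (v x) * f (v x)))
      - 2 * integral UNIV (\<lambda>x. trunc \<epsilon> (v (dil l x)) * (trunc' \<epsilon> (v x) * f (v x)))) *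
    (\<Sum>i\<in>UNIV. integral UNIV (\<lambda>x. (\<eta>' i x)\<^sup>2))"
proof -
  let ?U = "trunc_grad \<epsilon>" and ?W = "\<lambda>i x. l * trunc_grad \<epsilon> i (dil l x)"
  let ?E = "\<Sum>i\<in>UNIV. integral UNIV (\<lambda>x. (?U i x)\<^sup>2)"
  let ?A = "integral UNIV (\<lambda>x. trunc \<epsilon> (v x) * (trunc' \<epsilon> (v x) * f (v x)))"
  let ?B = "integral UNIV (\<lambda>x. trunc \<epsilon> (v (dil l x)) * (trunc' \<epsilon> (v x) * f (v x)))"
  \<comment> \<open>By \<open>small\<close> the set where the defect lives misses the supports of
    \<open>\<eta>\<close> and of the dilated function, so \<open>weak_form\<close> holds without
    error for both of them as test functions.\<close>
  have defect0: "trunc_defect \<epsilon> x = 0" if "x \<in> S \<or> dil l x \<in> \<Omega>" for x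
    using small[OF that] \<epsilon> by (auto simp: trunc_defect_def v_def trunc_above)
  have cW: "continuous_on UNIV (?W i)" for i
    by (intro continuous_intros continuous_on_compose2[OF cont_trunc_grad[OF \<epsilon>] continuous_on_dilation]) simp
  have W0: "?W i x = 0" if "x \<notin> \<Omega>" for i x
    using dil_outside[OF l that] by (simp add: trunc_grad_outside)
  have ctW: "continuous_on UNIV (\<lambda>x. trunc \<epsilon> (v (dil l x)))"
    by (rule continuous_on_compose2[OF cont_trunc_v(1)[OF \<epsilon>] continuous_on_dilation]) simp
  have UW: "(\<Sum>i\<in>UNIV. integral UNIV (\<lambda>x. ?U i x * ?W i x)) = ?B"
  proof -
    have "trunc \<epsilon> (v (dil l x)) * trunc_defect \<epsilon> x = 0" for x
      using defect0[of x] \<epsilon> by (cases "dil l x \<in> \<Omega>") (auto simp: v_outside trunc_below)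
    then have "(\<lambda>x. trunc \<epsilon> (v (dil l x)) * trunc_defect \<epsilon> x) = (\<lambda>x. 0)" by (rule ext)
    from weak_form[OF \<epsilon> ctW cW DERIV_trunc_v_dil[OF \<epsilon>], unfolded this]
    show ?thesis by simp
  qed
  \<comment> \<open>The chain rule contributes \<open>l\<^sup>2\<close>, the change of variables
    divides by \<open>l ^ CARD('n)\<close>.\<close>
  have WW: "(\<Sum>i\<in>UNIV. integral UNIV (\<lambda>x. (?W i x)\<^sup>2)) = l\<^sup>2 / l ^ CARD('n) * ?E"
  proof -
    have "integral UNIV (\<lambda>x. (?U i (dil l x))\<^sup>2) = integral UNIV (\<lambda>x. (?U i x)\<^sup>2) / l ^ CARD('n)" for i
      by (rule integral_dil) (use l in \<open>auto intro!: continuous_intros cont_trunc_grad \<epsilon> simp: trunc_grad_outside\<close>)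
    then show ?thesis
      by (simp add: power_mult_distrib sum_distrib_left)
  qed
  have U\<eta>: "(\<Sum>i\<in>UNIV. integral UNIV (\<lambda>x. (?U i x - ?W i x) * \<eta>' i x)) =
      integral UNIV (\<lambda>x. \<eta> x * (trunc' \<epsilon> (v x) * f (v x)))"
  proof -
    have "(?U i x - ?W i x) * \<eta>' i x = ?U i x * \<eta>' i x" for i x
      using flat[of x i] by (cases "dil l x \<in> \<Omega>") (auto simp: trunc_grad_outside)
    moreover have "\<eta> x * trunc_defect \<epsilon> x = 0" for x
      using defect0[of x] supp(1)[of x] by (cases "x \<in> S") auto
    then have "(\<lambda>x. \<eta> x * trunc_defect \<epsilon> x) = (\<lambda>x. 0)" by (rule ext)
    from weak_form[OF \<epsilon> \<eta> der\<eta>, unfolded this]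
    have "(\<Sum>i\<in>UNIV. integral UNIV (\<lambda>x. ?U i x * \<eta>' i x)) =
      integral UNIV (\<lambda>x. \<eta> x * (trunc' \<epsilon> (v x) * f (v x)))" by simp
    ultimately show ?thesis by (simp only:)
  qed
  have supp': "\<eta>' i x = 0" if "x \<notin> \<Omega>" for i x
    using supp(2) S that by blast
  have iUU: "(\<lambda>x. (?U i x)\<^sup>2) integrable_on UNIV" for i
    by (rule integrable_dom) (auto intro!: continuous_intros cont_trunc_grad \<epsilon> simp: trunc_grad_outside)
  have iWW: "(\<lambda>x. (?W i x)\<^sup>2) integrable_on UNIV" for i
    by (rule integrable_dom, intro continuous_intros cW) (simp add: W0)
  have iUW: "(\<lambda>x. ?U i x * ?W i x) integrable_on UNIV" for i
    by (rule integrable_dom, intro continuous_intros cW cont_trunc_grad \<epsilon>) (simp add: W0)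
  have iD: "(\<lambda>x. (?U i x - ?W i x)\<^sup>2) integrable_on UNIV" for i
    by (rule integrable_dom, intro continuous_intros cW cont_trunc_grad \<epsilon>)
      (use W0 in \<open>simp add: trunc_grad_outside\<close>)
  have "(\<Sum>i\<in>UNIV. integral UNIV (\<lambda>x. (?U i x - ?W i x) * \<eta>' i x))\<^sup>2 \<le>
     (\<Sum>i\<in>UNIV. integral UNIV (\<lambda>x. (?U i x - ?W i x)\<^sup>2)) * (\<Sum>i\<in>UNIV. integral UNIV (\<lambda>x. (\<eta>' i x)\<^sup>2))"
  proof (rule Cauchy_Schwarz_integral_sum)
    fix i
    show "(\<lambda>x. (?U i x - ?W i x)\<^sup>2) integrable_on UNIV" by (rule iD)
    show "(\<lambda>x. (\<eta>' i x)\<^sup>2) integrable_on UNIV"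
      by (rule integrable_dom, intro continuous_intros \<eta>) (simp add: supp')
    show "(\<lambda>x. (?U i x - ?W i x) * \<eta>' i x) integrable_on UNIV"
      by (rule integrable_dom, intro continuous_intros cW cont_trunc_grad \<epsilon> \<eta>) (simp add: supp')
  qed
  \<comment> \<open>The mixed term equals \<open>?B\<close> exactly, so the one-sided bound
    \<open>trunc_energy\<close> is applied to \<open>?E\<close> alone, whose coefficient is
    positive.\<close>
  moreover have energy: "(\<Sum>i\<in>UNIV. integral UNIV (\<lambda>x. (?U i x - ?W i x)\<^sup>2)) \<le> (1 + l\<^sup>2 / l ^ CARD('n)) * ?A - 2 * ?B"
  proof -
    have "integral UNIV (\<lambda>x. (?U i x - ?W i x)\<^sup>2) =
        integral UNIV (\<lambda>x. (?U i x)\<^sup>2) + integral UNIV (\<lambda>x. (?W i x)\<^sup>2) - 2 * integral UNIV (\<lambda>x. ?U i x * ?W i x)" for i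
    proof -
      have "integral UNIV (\<lambda>x. (?U i x - ?W i x)\<^sup>2) =
          integral UNIV (\<lambda>x. (?U i x)\<^sup>2 + (?W i x)\<^sup>2 - 2 * (?U i x * ?W i x))"
        by (simp only: power2_diff mult.assoc)
      also have "\<dots> = integral UNIV (\<lambda>x. (?U i x)\<^sup>2) + integral UNIV (\<lambda>x. (?W i x)\<^sup>2)
          - integral UNIV (\<lambda>x. 2 * (?U i x * ?W i x))"
        by (simp only: integral_diff[OF integrable_add[OF iUU iWW] integrable_on_mult_right[OF iUW]]
            integral_add[OF iUU iWW])
      also have "integral UNIV (\<lambda>x. 2 * (?U i x * ?W i x)) = 2 * integral UNIV (\<lambda>x. ?U i x * ?W i x)"
        by (rule integral_mult_right)
      finally show ?thesis .
    qed
    then have "(\<Sum>i\<in>UNIV. integral UNIV (\<lambda>x. (?U i x - ?W i x)\<^sup>2)) = ?E + l\<^sup>2 / l ^ CARD('n) * ?E - 2 * ?B"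
      using UW WW by (simp add: sum.distrib sum_subtractf flip: sum_distrib_left)
    also have "\<dots> = (1 + l\<^sup>2 / l ^ CARD('n)) * ?E - 2 * ?B" by (simp add: algebra_simps)
    also have "\<dots> \<le> (1 + l\<^sup>2 / l ^ CARD('n)) * ?A - 2 * ?B"
      using trunc_energy[OF \<epsilon>] l by (intro diff_right_mono mult_left_mono) auto
    finally show ?thesis .
  qed
  moreover have "0 \<le> (\<Sum>i\<in>UNIV. integral UNIV (\<lambda>x. (\<eta>' i x)\<^sup>2))"
  proof (intro sum_nonneg integral_nonneg)
    show "(\<lambda>x. (\<eta>' i x)\<^sup>2) integrable_on UNIV" for i
      by (rule integrable_dom, intro continuous_intros \<eta>) (simp add: supp')
  qed auto
  ultimately show "(integral UNIV (\<lambda>x. \<eta> x * (trunc' \<epsilon> (v x) * f (v x))))\<^sup>2 \<le>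
      ?Q * (\<Sum>i\<in>UNIV. integral UNIV (\<lambda>x. (\<eta>' i x)\<^sup>2))"
    unfolding U\<eta> by (meson mult_right_mono order_trans)
  have "0 \<le> (\<Sum>i\<in>UNIV. integral UNIV (\<lambda>x. (?U i x - ?W i x)\<^sup>2))"
    by (intro sum_nonneg integral_nonneg iD) auto
  with energy show "0 \<le> ?Q" by linarith
qed

lemma trunc'_f_tendsto:
  "(\<lambda>k. trunc' (inverse (real (Suc k))) (v x) * f (v x)) \<longlonglongrightarrow> f (v x)"
proof (cases "x \<in> \<Omega>")
  case True
  have "(\<lambda>k. trunc' (inverse (real (Suc k))) (v x) * f (v x)) \<longlonglongrightarrow> 1 * f (v x)"
    by (intro tendsto_intros trunc'_tendsto) (simp add: v_pos_iff True)
  then show ?thesis by simp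
qed (simp add: fv_outside)

lemma abs_trunc'_mult_le: "\<epsilon> > 0 \<Longrightarrow> \<bar>trunc' \<epsilon> s * y\<bar> \<le> \<bar>y\<bar>"
  using trunc'_bounds[of \<epsilon> s] by (simp add: abs_mult mult_left_le_one_le)

lemma trunc_integral_tendsto:
  assumes "continuous_on UNIV \<phi>" "\<And>k. continuous_on UNIV (\<phi>' k)"
    and "\<And>k x. \<bar>\<phi>' k x\<bar> \<le> \<bar>\<phi> x\<bar>" and "\<And>x. (\<lambda>k. \<phi>' k x) \<longlonglongrightarrow> \<phi> x"
  shows "(\<lambda>k. integral UNIV (\<lambda>x. \<phi>' k x * (trunc' (inverse (real (Suc k))) (v x) * f (v x))))
    \<longlonglongrightarrow> integral UNIV (\<lambda>x. \<phi> x * f (v x))"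
proof -
  have "\<exists>B>0. \<forall>x. \<bar>\<phi> x * f (v x)\<bar> \<le> B"
    by (rule bounded_continuous_bounded_support[OF _ bounded_dom])
      (auto intro!: continuous_intros assms(1) cont_fv simp: fv_outside)
  then obtain B where B: "\<bar>\<phi> x * f (v x)\<bar> \<le> B" for x by blast
  have ep: "inverse (real (Suc k)) > 0" for k by simp
  show ?thesis
  proof (rule dominated_bounded_support[OF _ bounded_dom])
    show "continuous_on UNIV (\<lambda>x. \<phi>' k x * (trunc' (inverse (real (Suc k))) (v x) * f (v x)))" for k
      by (intro continuous_intros assms(2) cont_trunc_v(2)[OF ep] cont_fv)
    show "\<phi>' k x * (trunc' (inverse (real (Suc k))) (v x) * f (v x)) = 0" if "x \<notin> \<Omega>" for k x
      using that by (simp add: fv_outside)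
    show "\<bar>\<phi>' k x * (trunc' (inverse (real (Suc k))) (v x) * f (v x))\<bar> \<le> B" for k x
    proof -
      have "\<bar>\<phi>' k x * (trunc' (inverse (real (Suc k))) (v x) * f (v x))\<bar> \<le> \<bar>\<phi> x\<bar> * \<bar>f (v x)\<bar>"
        unfolding abs_mult[of "\<phi>' k x"] by (intro mult_mono assms(3) abs_trunc'_mult_le[OF ep]) auto
      also have "\<dots> \<le> B" using B[of x] by (simp add: abs_mult)
      finally show ?thesis .
    qed
    show "(\<lambda>k. \<phi>' k x * (trunc' (inverse (real (Suc k))) (v x) * f (v x))) \<longlonglongrightarrow> \<phi> x * f (v x)" for x
      by (intro tendsto_mult assms(4) trunc'_f_tendsto)
  qed
qed

text \<open>The limit \<epsilon> to 0 at fixed \<open>l\<close>. No derivative of the solution is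
  left in the conclusion, so square integrability of its gradient is not an issue.\<close>

lemma dilation_inequality:
  assumes l: "l > 1"
    and \<eta>: "continuous_on UNIV \<eta>" "\<And>i. continuous_on UNIV (\<eta>' i)"
    and der\<eta>: "\<And>i x. ((\<lambda>t. \<eta> (x + t *\<^sub>R axis i 1)) has_real_derivative \<eta>' i x) (at 0)"
    and supp: "\<And>x. x \<notin> S \<Longrightarrow> \<eta> x = 0" "\<And>x i. x \<notin> S \<Longrightarrow> \<eta>' i x = 0" and S: "compact S" "S \<subseteq> \<Omega>"
    and flat: "\<And>x i. dil l x \<in> \<Omega> \<Longrightarrow> \<eta>' i x = 0"
  shows "0 \<le> (1 + l\<^sup>2 / l ^ CARD('n)) * integral UNIV (\<lambda>x. v x * f (v x))
      - 2 * integral UNIV (\<lambda>x. v (dil l x) * f (v x))" (is "0 \<le> ?Q")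
    and "(integral UNIV (\<lambda>x. \<eta> x * f (v x)))\<^sup>2 \<le>
    ((1 + l\<^sup>2 / l ^ CARD('n)) * integral UNIV (\<lambda>x. v x * f (v x))
      - 2 * integral UNIV (\<lambda>x. v (dil l x) * f (v x))) *
    (\<Sum>i\<in>UNIV. integral UNIV (\<lambda>x. (\<eta>' i x)\<^sup>2))"
proof -
  let ?\<epsilon> = "\<lambda>k. inverse (real (Suc k))"
  have ep: "?\<epsilon> k > 0" for k by simp
  \<comment> \<open>The cut-off and the dilated solution live on compact subsets of \<Omega>, where
    \<open>v\<close> has a positive minimum; once \<open>3 * \<epsilon> \<le> m\<close> the
    hypothesis \<open>small\<close> of the truncated version holds.\<close>
  obtain m where m: "m > 0" "\<forall>x \<in> S \<union> {x. dil l x \<in> closure \<Omega>}. m \<le> v x"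
    using v_lower_bound_compact[of "S \<union> {x. dil l x \<in> closure \<Omega>}"] compact_dil_pre_image[OF l] S by auto
  have ctr: "continuous_on UNIV (\<lambda>x. trunc (?\<epsilon> k) (v (dil l x)))" for k
    by (rule continuous_on_compose2[OF cont_trunc_v(1)[OF ep] continuous_on_dilation]) simp
  have tb: "\<bar>trunc (?\<epsilon> k) (v y)\<bar> \<le> \<bar>v y\<bar>" for k y
    using trunc_bounds[OF ep[of k] v_nonneg[of y]] by simp
  define Q where "Q k = (1 + l\<^sup>2 / l ^ CARD('n)) * integral UNIV (\<lambda>x. trunc (?\<epsilon> k) (v x) * (trunc' (?\<epsilon> k) (v x) * f (v x)))
      - 2 * integral UNIV (\<lambda>x. trunc (?\<epsilon> k) (v (dil l x)) * (trunc' (?\<epsilon> k) (v x) * f (v x)))" for k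
  have Q: "Q \<longlonglongrightarrow> ?Q"
    unfolding Q_def
    by (intro tendsto_mult tendsto_diff tendsto_const trunc_integral_tendsto
        cont_v cont_v_dil cont_trunc_v(1)[OF ep] ctr tb trunc_tendsto v_nonneg)
  have ev: "\<forall>\<^sub>F k in sequentially. 0 \<le> Q k \<and> (integral UNIV (\<lambda>x. \<eta> x * (trunc' (?\<epsilon> k) (v x) * f (v x))))\<^sup>2 \<le>
      Q k * (\<Sum>i\<in>UNIV. integral UNIV (\<lambda>x. (\<eta>' i x)\<^sup>2))"
    using eventually_three_inverse_Suc_less[OF m(1)]
  proof (rule eventually_mono)
    fix k assume k: "3 * ?\<epsilon> k \<le> m"
    have "3 * ?\<epsilon> k \<le> v x" if "x \<in> S \<or> dil l x \<in> \<Omega>" for x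
    proof -
      have "x \<in> S \<union> {x. dil l x \<in> closure \<Omega>}"
        using that closure_subset[of \<Omega>] by auto
      then show ?thesis using m(2) k by force
    qed
    from dilation_inequality_trunc[OF ep l \<eta> der\<eta> supp S(2) flat this]
    show "0 \<le> Q k \<and> (integral UNIV (\<lambda>x. \<eta> x * (trunc' (?\<epsilon> k) (v x) * f (v x))))\<^sup>2 \<le>
      Q k * (\<Sum>i\<in>UNIV. integral UNIV (\<lambda>x. (\<eta>' i x)\<^sup>2))"
      unfolding Q_def by (rule conjI)
  qed
  show "0 \<le> ?Q"
    by (rule tendsto_le[OF sequentially_bot Q tendsto_const]) (use ev in \<open>rule eventually_mono, simp\<close>)
  show "(integral UNIV (\<lambda>x. \<eta> x * f (v x)))\<^sup>2 \<le> ?Q * (\<Sum>i\<in>UNIV. integral UNIV (\<lambda>x. (\<eta>' i x)\<^sup>2))"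
  proof (rule tendsto_le[OF sequentially_bot])
    show "(\<lambda>k. (integral UNIV (\<lambda>x. \<eta> x * (trunc' (?\<epsilon> k) (v x) * f (v x))))\<^sup>2)
        \<longlonglongrightarrow> (integral UNIV (\<lambda>x. \<eta> x * f (v x)))\<^sup>2"
      by (intro tendsto_intros trunc_integral_tendsto \<eta>) auto
    show "(\<lambda>k. Q k * (\<Sum>i\<in>UNIV. integral UNIV (\<lambda>x. (\<eta>' i x)\<^sup>2)))
        \<longlonglongrightarrow> ?Q * (\<Sum>i\<in>UNIV. integral UNIV (\<lambda>x. (\<eta>' i x)\<^sup>2))"
      by (intro tendsto_mult Q tendsto_const)
    show "\<forall>\<^sub>F k in sequentially. (integral UNIV (\<lambda>x. \<eta> x * (trunc' (?\<epsilon> k) (v x) * f (v x))))\<^sup>2 \<le>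
        Q k * (\<Sum>i\<in>UNIV. integral UNIV (\<lambda>x. (\<eta>' i x)\<^sup>2))"
      using ev by (rule eventually_mono) simp
  qed
qed

end

text \<open>\<open>K\<close> is the closure of \<Omega> contracted towards \<open>x0\<close> by s =
  1/l. By convexity the ball about \<open>x0\<close> leaves room of width r(1-s) around
  \<open>K\<close>; half of it is taken for \<tau>, so that the support stays compact in \<Omega>.
  The squared gradient is at most 16/\<tau>^2 = 64/(r^2(1-s)^2) and lives in a layer of volume at
  most N(1-s)|\<Omega>|; the product is the stated bound.\<close>

lemma layer_cutoff:
  fixes \<Omega> :: "(real^'n::finite) set"
  assumes \<Omega>: "open \<Omega>" "bounded \<Omega>" "convex \<Omega>" and r: "r > 0" "ball x0 r \<subseteq> \<Omega>" and l: "l > 1"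
  shows "\<exists>\<eta> \<eta>' S. continuous_on UNIV \<eta> \<and> (\<forall>i::'n. continuous_on UNIV (\<eta>' i)) \<and>
     (\<forall>i x. ((\<lambda>t. \<eta> (x + t *\<^sub>R axis i 1)) has_real_derivative \<eta>' i x) (at 0)) \<and>
     (\<forall>x. 0 \<le> \<eta> x \<and> \<eta> x \<le> 1) \<and> compact S \<and> S \<subseteq> \<Omega> \<and> (\<forall>x. x \<notin> S \<longrightarrow> \<eta> x = 0 \<and> (\<forall>i. \<eta>' i x = 0)) \<and>
     (\<forall>x. dilation x0 l x \<in> \<Omega> \<longrightarrow> \<eta> x = 1 \<and> (\<forall>i. \<eta>' i x = 0)) \<and>
     (\<Sum>i\<in>UNIV. integral UNIV (\<lambda>x. (\<eta>' i x)\<^sup>2)) \<le>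
        64 * real CARD('n) * measure lebesgue \<Omega> / r\<^sup>2 / (1 - 1/l)"
proof -
  define s where "s = 1/l"
  have s: "0 < s" "s < 1" "s * l = 1" using l by (auto simp: s_def)
  define D where "D = (\<lambda>y. (1 - s) *\<^sub>R x0 + s *\<^sub>R y)"
  have x0: "x0 \<in> \<Omega>" using r by auto
  have D_dil: "D (dilation x0 l x) = x" "dilation x0 l (D x) = x" for x
  proof -
    have "s * (1 - l) + (1 - s) = 0" "l * (1 - s) + (1 - l) = 0"
      using s by (simp_all add: algebra_simps)
    then have "(s * (1 - l)) *\<^sub>R x0 + (1 - s) *\<^sub>R x0 = 0" "(l * (1 - s)) *\<^sub>R x0 + (1 - l) *\<^sub>R x0 = 0"
      by (simp_all flip: scaleR_add_left)
    then show "D (dilation x0 l x) = x" "dilation x0 l (D x) = x"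
      using s(3) by (simp_all add: D_def dilation_def scaleR_add_right algebra_simps)
  qed
  define K where "K = D ` closure \<Omega>"
  define \<tau> where "\<tau> = r * (1 - s) / 2"
  have \<tau>: "\<tau> > 0" using r s by (simp add: \<tau>_def)
  have "compact K"
    unfolding K_def D_def using \<Omega>(2)
    by (intro compact_continuous_image continuous_intros) auto
  moreover have "convex K"
    unfolding K_def D_def by (rule convex_affinity[OF convex_closure[OF \<Omega>(3)]])
  moreover have "K \<noteq> {}" using x0 closure_subset[of \<Omega>] by (auto simp: K_def)
  ultimately have K: "compact K" "convex K" "closed K" "K \<noteq> {}" using compact_imp_closed by auto
  define S where "S = {x. infdist x K \<le> \<tau>}"
  have S_sub: "S \<subseteq> \<Omega>"
  proof
    fix x assume "x \<in> S"
    then have le: "infdist x K \<le> \<tau>" by (simp add: S_def)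
    obtain z where z: "z \<in> K" "infdist x K = dist x z"
      using infdist_attains_inf[OF K(3,4)] by blast
    then obtain y where y: "y \<in> closure \<Omega>" "z = D y" by (auto simp: K_def)
    \<comment> \<open>Chosen so that x = s y + (1-s) c: the displacement of \<open>x\<close> from
      \<open>z\<close> is moved into the centre, magnified by 1/(1-s). The choice of \<tau> keeps
      \<open>c\<close> within r/2 of \<open>x0\<close>, and convexity puts \<open>x\<close> in
      \<Omega>.\<close>
    define c where "c = x0 + (1 / (1 - s)) *\<^sub>R (x - z)"
    have "dist x0 c = norm (x - z) / (1 - s)"
      using s by (simp add: c_def dist_norm)
    also have "\<dots> \<le> r / 2"
      using le z(2) s by (simp add: dist_norm \<tau>_def field_simps)
    finally have "c \<in> interior \<Omega>" using r \<Omega>(1) by (auto simp: interior_open)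
    then have "y - (1 - s) *\<^sub>R (y - c) \<in> interior \<Omega>"
      using mem_interior_closure_convex_shrink[OF \<Omega>(3) _ y(1), of c "1 - s"] s by simp
    moreover have "y - (1 - s) *\<^sub>R (y - c) = x"
    proof -
      have "(1 - s) *\<^sub>R c = (1 - s) *\<^sub>R x0 + (x - z)" using s by (simp add: c_def scaleR_add_right)
      then show ?thesis by (simp add: y(2) D_def algebra_simps)
    qed
    ultimately show "x \<in> \<Omega>" using \<Omega>(1) by (simp add: interior_open)
  qed
  have "closed S"
    unfolding S_def by (intro closed_Collect_le continuous_intros)
  then have S: "compact S"
    using S_sub \<Omega>(2) bounded_subset compact_eq_bounded_closed by blast
  obtain \<eta> and \<eta>' :: "'n \<Rightarrow> real^'n \<Rightarrow> real" where
      \<eta>: "continuous_on UNIV \<eta>" "\<forall>i. continuous_on UNIV (\<eta>' i)"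
        "\<forall>i x. ((\<lambda>t. \<eta> (x + t *\<^sub>R axis i 1)) has_real_derivative \<eta>' i x) (at 0)"
        "\<forall>x. 0 \<le> \<eta> x \<and> \<eta> x \<le> 1"
      and inK: "\<forall>x\<in>K. \<eta> x = 1 \<and> (\<forall>i. \<eta>' i x = 0)"
      and far: "\<forall>x. infdist x K \<ge> \<tau> \<longrightarrow> \<eta> x = 0 \<and> (\<forall>i. \<eta>' i x = 0)"
      and sq: "\<forall>x. (\<Sum>i\<in>UNIV. (\<eta>' i x)\<^sup>2) \<le> 16 / \<tau>\<^sup>2"
    using convex_cutoff[OF K(2,3,4) \<tau>] by blast
  have offS: "\<forall>x. x \<notin> S \<longrightarrow> \<eta> x = 0 \<and> (\<forall>i. \<eta>' i x = 0)"
    using far by (auto simp: S_def)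
  have flat: "\<forall>x. dilation x0 l x \<in> \<Omega> \<longrightarrow> \<eta> x = 1 \<and> (\<forall>i. \<eta>' i x = 0)"
  proof (intro allI impI)
    fix x assume "dilation x0 l x \<in> \<Omega>"
    then have "D (dilation x0 l x) \<in> K"
      unfolding K_def using closure_subset[of \<Omega>] by blast
    then show "\<eta> x = 1 \<and> (\<forall>i. \<eta>' i x = 0)"
      using inK unfolding D_dil by blast
  qed
  have meas: "\<Omega> \<in> lmeasurable" using \<Omega> by (intro lmeasurable_open)
  have meas_D: "measure lebesgue (D ` \<Omega>) = s ^ CARD('n) * measure lebesgue \<Omega>"
    using measure_lebesgue_affine[of s "(1 - s) *\<^sub>R x0" \<Omega>] s by (simp add: D_def add.commute)
  have D_sub: "D ` \<Omega> \<subseteq> \<Omega>"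
    unfolding D_def using \<Omega>(3) x0 s by (auto intro: convexD)
  have D_meas: "D ` \<Omega> \<in> lmeasurable"
  proof -
    have "D ` \<Omega> = dilation x0 l -` \<Omega>"
    proof (intro set_eqI iffI)
      fix x assume "x \<in> dilation x0 l -` \<Omega>"
      then have "D (dilation x0 l x) \<in> D ` \<Omega>" by blast
      then show "x \<in> D ` \<Omega>" unfolding D_dil .
    qed (auto simp: D_dil)
    then have "open (D ` \<Omega>)"
      using \<Omega>(1) by (simp add: open_vimage continuous_on_dilation)
    then show ?thesis
      using D_sub \<Omega>(2) bounded_subset by (intro lmeasurable_open) blast+
  qed
  \<comment> \<open>Bernoulli's inequality makes the volume of the layer linear in 1-s, which
    recovers one of the two powers of 1-s lost to 1/\<tau>^2.\<close>
  have vol: "measure lebesgue \<Omega> - s ^ CARD('n) * measure lebesgue \<Omega> \<le> real CARD('n) * (1 - s) * measure lebesgue \<Omega>"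
  proof -
    have "1 + real CARD('n) * (s - 1) \<le> (1 + (s - 1)) ^ CARD('n)"
      by (rule Bernoulli_inequality) (use s in auto)
    then have "1 - s ^ CARD('n) \<le> real CARD('n) * (1 - s)" by (simp add: algebra_simps)
    then have "(1 - s ^ CARD('n)) * measure lebesgue \<Omega> \<le> real CARD('n) * (1 - s) * measure lebesgue \<Omega>"
      by (rule mult_right_mono) simp
    then show ?thesis by (simp add: algebra_simps)
  qed
  have int: "(\<lambda>x. (\<eta>' i x)\<^sup>2) integrable_on UNIV" for i
    by (rule integrable_continuous_bounded_support[OF _ \<Omega>(2)])
      (use \<eta>(2) offS S_sub in \<open>auto intro!: continuous_intros\<close>)
  have "(\<Sum>i\<in>UNIV. integral UNIV (\<lambda>x. (\<eta>' i x)\<^sup>2)) = integral UNIV (\<lambda>x. \<Sum>i\<in>UNIV. (\<eta>' i x)\<^sup>2)"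
    by (rule integral_sum[symmetric]) (auto intro: int)
  also have "\<dots> \<le> integral UNIV (\<lambda>x. 16 / \<tau>\<^sup>2 * indicat_real (\<Omega> - D ` \<Omega>) x)"
  proof (rule integral_le)
    show "(\<lambda>x. \<Sum>i\<in>UNIV. (\<eta>' i x)\<^sup>2) integrable_on UNIV"
      by (rule integrable_sum) (auto intro: int)
    show "(\<lambda>x. 16 / \<tau>\<^sup>2 * indicat_real (\<Omega> - D ` \<Omega>) x) integrable_on UNIV"
      using meas D_meas by (intro integrable_on_mult_right) (simp add: integrable_on_indicator fmeasurable.Diff)
    fix x
    show "(\<Sum>i\<in>UNIV. (\<eta>' i x)\<^sup>2) \<le> 16 / \<tau>\<^sup>2 * indicat_real (\<Omega> - D ` \<Omega>) x"
    proof (cases "x \<in> \<Omega> - D ` \<Omega>")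
      case True
      then show ?thesis using sq by simp
    next
      case False
      have "\<eta>' i x = 0" for i
      proof (cases "x \<in> \<Omega>")
        case True
        with False have "dilation x0 l x \<in> \<Omega>" by (auto simp: D_dil)
        then show ?thesis using flat by blast
      next
        case False
        then show ?thesis using offS S_sub by blast
      qed
      then show ?thesis using False by simp
    qed
  qed
  also have "\<dots> = 16 / \<tau>\<^sup>2 * measure lebesgue (\<Omega> - D ` \<Omega>)"
    using lmeasure_integral_UNIV[OF fmeasurable.Diff[OF meas D_meas]] by simp
  also have "measure lebesgue (\<Omega> - D ` \<Omega>) = measure lebesgue \<Omega> - s ^ CARD('n) * measure lebesgue \<Omega>"
    using measurable_measure_Diff[OF meas _ D_sub] D_meas meas_D by (simp add: fmeasurableD)
  also have "16 / \<tau>\<^sup>2 * (measure lebesgue \<Omega> - s ^ CARD('n) * measure lebesgue \<Omega>) \<le>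
      16 / \<tau>\<^sup>2 * (real CARD('n) * (1 - s) * measure lebesgue \<Omega>)"
    by (rule mult_left_mono[OF vol]) simp
  also have "16 / \<tau>\<^sup>2 * (real CARD('n) * (1 - s) * measure lebesgue \<Omega>) =
      64 * real CARD('n) * measure lebesgue \<Omega> / r\<^sup>2 / (1 - s)"
  proof -
    have "16 / (r * t / 2)\<^sup>2 * (N * t * m) = 64 * N * m / r\<^sup>2 / t" if "t > 0" for t N m :: real
      using r that by (simp add: power2_eq_square field_simps)
    from this[of "1 - s"] show ?thesis using s unfolding \<tau>_def by simp
  qed
  finally have "(\<Sum>i\<in>UNIV. integral UNIV (\<lambda>x. (\<eta>' i x)\<^sup>2)) \<le>
        64 * real CARD('n) * measure lebesgue \<Omega> / r\<^sup>2 / (1 - 1/l)"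
    by (simp add: s_def)
  then show ?thesis
    using \<eta> S S_sub offS flat by blast
qed

text \<open>Coordinates are changed one at a time: the mean value theorem handles each step,
  continuity of the partial derivatives at \<open>x\<close> bounds its error, and \<open>e'\<close>
  is the share of one step in \<open>e\<close>. Dilations move points radially, whereas
  \<open>Ck_on\<close> provides derivatives along the axes only.\<close>

lemma has_derivative_if_continuous_partials:
  fixes g :: "real^'n::finite \<Rightarrow> real"
  assumes der: "\<And>i x. ((\<lambda>t. g (x + t *\<^sub>R axis i 1)) has_real_derivative g' i x) (at 0)"
    and cont: "\<And>i. continuous_on UNIV (g' i)"
  shows "(g has_derivative (\<lambda>h. \<Sum>i\<in>UNIV. h $ i * g' i x)) (at x)"
  unfolding has_derivative_at_alt
proof (intro conjI allI impI)
  show "bounded_linear (\<lambda>h::real^'n. \<Sum>i\<in>UNIV. h $ i * g' i x)"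
    by (intro bounded_linear_sum bounded_linear_mult_const bounded_linear_vec_nth)
  fix e :: real assume "e > 0"
  define e' where "e' = e / real CARD('n)"
  have e': "e' > 0" using \<open>e > 0\<close> by (simp add: e'_def)
  have "\<exists>d>0. \<forall>y. dist y x < d \<longrightarrow> dist (g' i y) (g' i x) < e'" for i
    using cont[of i] e' unfolding continuous_on_iff by fastforce
  then obtain d where d: "\<And>i. d i > 0" "\<And>i y. dist y x < d i \<Longrightarrow> dist (g' i y) (g' i x) < e'"
    by metis
  define d0 where "d0 = Min (range d)"
  have d0: "d0 > 0" "d0 \<le> d i" for i
    using d(1) by (auto simp: d0_def)
  have der': "((\<lambda>s. g (z + s *\<^sub>R axis i 1)) has_real_derivative g' i (z + t *\<^sub>R axis i 1)) (at t)" for z i t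
    using DERIV_shift[of "\<lambda>s. g (z + s *\<^sub>R axis i 1)" "g' i (z + t *\<^sub>R axis i 1)" 0 t]
      der[of "z + t *\<^sub>R axis i 1" i] by (simp add: algebra_simps)
  have step: "\<bar>g (x + (\<Sum>i\<in>A. h $ i *\<^sub>R axis i 1)) - g x - (\<Sum>i\<in>A. h $ i * g' i x)\<bar> \<le> real (card A) * (e' * norm h)"
    if "finite A" "norm h < d0" for A and h :: "real^'n"
    using that(1)
  proof (induction A)
    case (insert j A)
    let ?z = "x + (\<Sum>i\<in>A. h $ i *\<^sub>R axis i 1)"
    have "\<exists>t. \<bar>t\<bar> \<le> \<bar>h $ j\<bar> \<and> g (?z + h $ j *\<^sub>R axis j 1) - g ?z = h $ j * g' j (?z + t *\<^sub>R axis j 1)"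
    proof -
      consider "h $ j = 0" | "h $ j > 0" | "h $ j < 0" by linarith
      then show ?thesis
      proof cases
        case 2
        then have "\<exists>t>0. t < h $ j \<and> g (?z + h $ j *\<^sub>R axis j 1) - g (?z + 0 *\<^sub>R axis j 1) = (h $ j - 0) * g' j (?z + t *\<^sub>R axis j 1)"
          by (intro MVT2 der')
        then obtain t where "t > 0" "t < h $ j" "g (?z + h $ j *\<^sub>R axis j 1) - g ?z = h $ j * g' j (?z + t *\<^sub>R axis j 1)"
          by auto
        then show ?thesis by (intro exI[of _ t]) auto
      next
        case 3
        then have "\<exists>t>h $ j. t < 0 \<and> g (?z + 0 *\<^sub>R axis j 1) - g (?z + h $ j *\<^sub>R axis j 1) = (0 - h $ j) * g' j (?z + t *\<^sub>R axis j 1)"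
          by (intro MVT2 der')
        then obtain t where "t > h $ j" "t < 0" "g ?z - g (?z + h $ j *\<^sub>R axis j 1) = - h $ j * g' j (?z + t *\<^sub>R axis j 1)"
          by auto
        then show ?thesis by (intro exI[of _ t]) auto
      qed auto
    qed
    then obtain t where t: "\<bar>t\<bar> \<le> \<bar>h $ j\<bar>"
      "g (?z + h $ j *\<^sub>R axis j 1) - g ?z = h $ j * g' j (?z + t *\<^sub>R axis j 1)" by blast
    \<comment> \<open>Each component of the displacement is dominated by that of \<open>h\<close>:
      equal on \<open>A\<close>, at most as large at \<open>j\<close>, zero elsewhere.\<close>
    have "dist (?z + t *\<^sub>R axis j 1) x \<le> norm h"
    proof -
      have "dist (?z + t *\<^sub>R axis j 1) x = norm ((\<Sum>i\<in>A. h $ i *\<^sub>R axis i 1) + t *\<^sub>R axis j 1 :: real^'n)"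
        by (simp add: dist_norm algebra_simps)
      also have "\<dots> \<le> norm h"
      proof (rule norm_le_componentwise_cart)
        fix k
        have "(\<Sum>i\<in>A. h $ i *\<^sub>R axis i 1 :: real^'n) $ k = (\<Sum>i\<in>A. if i = k then h $ k else 0)"
          unfolding sum_component by (intro sum.cong) (auto simp: axis_def)
        also have "\<dots> = (if k \<in> A then h $ k else 0)"
          using insert.hyps(1) by (simp add: sum.delta)
        finally show "norm (((\<Sum>i\<in>A. h $ i *\<^sub>R axis i 1) + t *\<^sub>R axis j 1 :: real^'n) $ k) \<le> norm (h $ k)"
          using t(1) insert.hyps(2) by (auto simp: axis_def)
      qed
      finally show ?thesis .
    qed
    with that(2) d0(2)[of j] have "dist (?z + t *\<^sub>R axis j 1) x < d j" by linarith
    from d(2)[OF this] have "\<bar>g' j (?z + t *\<^sub>R axis j 1) - g' j x\<bar> \<le> e'"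
      by (simp add: dist_real_def)
    then have "\<bar>h $ j\<bar> * \<bar>g' j (?z + t *\<^sub>R axis j 1) - g' j x\<bar> \<le> norm h * e'"
      using component_le_norm_cart[of h j] by (intro mult_mono) auto
    then have "\<bar>g (?z + h $ j *\<^sub>R axis j 1) - g ?z - h $ j * g' j x\<bar> \<le> e' * norm h"
      unfolding t(2) right_diff_distrib[symmetric] abs_mult by (simp add: mult.commute)
    with insert.IH have "\<bar>g (?z + h $ j *\<^sub>R axis j 1) - g x - (h $ j * g' j x + (\<Sum>i\<in>A. h $ i * g' i x))\<bar> \<le>
        e' * norm h + real (card A) * (e' * norm h)" by linarith
    moreover have "?z + h $ j *\<^sub>R axis j 1 = x + (\<Sum>i\<in>insert j A. h $ i *\<^sub>R axis i 1)"
      using insert.hyps by (simp add: algebra_simps)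
    ultimately show ?case
      using insert.hyps by (simp add: algebra_simps)
  qed simp
  show "\<exists>d>0. \<forall>y. norm (y - x) < d \<longrightarrow> norm (g y - g x - (\<Sum>i\<in>UNIV. (y - x) $ i * g' i x)) \<le> e * norm (y - x)"
  proof (intro exI[of _ d0] conjI allI impI d0(1))
    fix y assume y: "norm (y - x) < d0"
    have "(\<Sum>i\<in>UNIV. (y - x) $ i *\<^sub>R axis i 1 :: real^'n) = y - x"
      using basis_expansion[of "y - x"] by (simp only: scalar_mult_eq_scaleR)
    with step[OF _ y, of UNIV]
    have "\<bar>g (x + (y - x)) - g x - (\<Sum>i\<in>UNIV. (y - x) $ i * g' i x)\<bar> \<le> real CARD('n) * (e' * norm (y - x))"
      by (simp only: finite simp_thms)
    then show "norm (g y - g x - (\<Sum>i\<in>UNIV. (y - x) $ i * g' i x)) \<le> e * norm (y - x)"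
      by (simp add: e'_def)
  qed
qed

lemma integral_cbox_eq_UNIV:
  fixes h :: "'a::euclidean_space \<Rightarrow> real"
  assumes "continuous_on UNIV h" "S \<subseteq> cbox a b" "\<And>x. x \<notin> S \<Longrightarrow> h x = 0"
  shows "integral (cbox a b) h = integral UNIV h"
proof -
  have "h integrable_on cbox a b"
    by (rule integrable_continuous[OF continuous_on_subset[OF assms(1)]]) simp
  then have "(h has_integral integral (cbox a b) h) UNIV"
    by (intro has_integral_on_superset[OF integrable_integral]) (use assms(2,3) in auto)
  then show ?thesis by (rule integral_unique[symmetric])
qed

context positive_solution
begin

text \<open>Multiplying the equation by \<open>\<eta>\<^sup>2 / u\<close> (Picone's identity).\<close>

lemma picone:
  assumes k: "\<And>t. t > 0 \<Longrightarrow> k * t \<le> f t"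
    and \<eta>: "continuous_on UNIV \<eta>" "\<And>i. continuous_on UNIV (\<eta>' i)"
    and der\<eta>: "\<And>i x. ((\<lambda>t. \<eta> (x + t *\<^sub>R axis i 1)) has_real_derivative \<eta>' i x) (at 0)"
    and supp: "\<And>x. x \<notin> S \<Longrightarrow> \<eta> x = 0" "\<And>x i. x \<notin> S \<Longrightarrow> \<eta>' i x = 0" and S: "compact S" "S \<subseteq> \<Omega>"
  shows "k * integral UNIV (\<lambda>x. (\<eta> x)\<^sup>2) \<le> (\<Sum>i\<in>UNIV. integral UNIV (\<lambda>x. (\<eta>' i x)\<^sup>2))"
proof -
  \<comment> \<open>The partial derivative in direction \<open>i\<close> of \<eta>^2 \<partial>_i u
    / u. The compact support of \<eta> keeps the quotient away from the boundary, where
    \<open>u\<close> tends to 0.\<close>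
  define h where "h i x = 2 * \<eta> x * \<eta>' i x * (pdiff i u x / u x) +
     (\<eta> x)\<^sup>2 * ((iter_pdiff [i, i] u x * u x - pdiff i u x * pdiff i u x) / (u x * u x))" for i x
  have cd: "continuous_on \<Omega> \<eta>" "continuous_on \<Omega> (\<eta>' i)" for i
    using continuous_on_subset[OF \<eta>(1)] continuous_on_subset[OF \<eta>(2)] by auto
  have u0: "\<forall>x\<in>\<Omega>. u x \<noteq> 0" "\<forall>x\<in>\<Omega>. u x * u x \<noteq> 0" using pos by fastforce+
  have ch: "continuous_on \<Omega> (h i)" for i
    unfolding h_def[abs_def] by (intro continuous_intros cd cont_pdiff cont_pdiff2 cont_u u0)
  have h0: "integral UNIV (\<lambda>x. if x \<in> \<Omega> then h i x else 0) = 0" for i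
  proof (rule integral_derivative_compact_support[OF open_dom S,
        where g="\<lambda>x. (\<eta> x)\<^sup>2 * (pdiff i u x / u x)" and e="axis i 1"])
    show "(\<eta> x)\<^sup>2 * (pdiff i u x / u x) = 0" if "x \<in> \<Omega> - S" for x
      using that supp by auto
    show "((\<lambda>t. (\<eta> (x + t *\<^sub>R axis i 1))\<^sup>2 * (pdiff i u (x + t *\<^sub>R axis i 1) / u (x + t *\<^sub>R axis i 1)))
        has_real_derivative h i x) (at 0)" if "x \<in> \<Omega>" for x
    proof -
      have nz: "u (x + 0 *\<^sub>R axis i 1) \<noteq> 0" using u0(1) that by simp
      show ?thesis
        by (rule DERIV_cong[OF DERIV_mult[OF DERIV_power[OF der\<eta>] DERIV_divide[OF DERIV_pdiff[OF that] DERIV_u[OF that] nz]]])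
          (simp add: h_def algebra_simps)
    qed
    show "continuous_on \<Omega> (\<lambda>x. (\<eta> x)\<^sup>2 * (pdiff i u x / u x))"
      by (intro continuous_intros cd cont_pdiff cont_u u0)
  qed (rule ch)
  have chU: "continuous_on UNIV (\<lambda>x. if x \<in> \<Omega> then h i x else 0)" for i
    by (rule continuous_on_extend_zero[OF open_dom S ch]) (use supp in \<open>auto simp: h_def\<close>)
  have ih: "(\<lambda>x. if x \<in> \<Omega> then h i x else 0) integrable_on UNIV" for i
    by (rule integrable_dom[OF chU]) simp
  have off: "\<eta> x = 0" "\<eta>' i x = 0" if "x \<notin> \<Omega>" for x i
    using supp S(2) that by blast+
  have i1: "(\<lambda>x. (\<eta>' i x)\<^sup>2) integrable_on UNIV" for i
    by (rule integrable_dom, intro continuous_intros \<eta>) (simp add: off)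
  have i2: "(\<lambda>x. (\<eta> x)\<^sup>2) integrable_on UNIV"
    by (rule integrable_dom, intro continuous_intros \<eta>) (simp add: off)
  have "0 = integral UNIV (\<lambda>x. \<Sum>i\<in>UNIV. if x \<in> \<Omega> then h i x else 0)"
    using h0 by (subst integral_sum) (auto intro: ih)
  also have "\<dots> \<le> integral UNIV (\<lambda>x. (\<Sum>i\<in>UNIV. (\<eta>' i x)\<^sup>2) - k * (\<eta> x)\<^sup>2)"
  proof (rule integral_le)
    show "(\<lambda>x. \<Sum>i\<in>UNIV. if x \<in> \<Omega> then h i x else 0) integrable_on UNIV"
      by (rule integrable_sum) (auto intro: ih)
    show "(\<lambda>x. (\<Sum>i\<in>UNIV. (\<eta>' i x)\<^sup>2) - k * (\<eta> x)\<^sup>2) integrable_on UNIV"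
      by (intro integrable_diff integrable_sum integrable_on_mult_right i1 i2) auto
    fix x
    show "(\<Sum>i\<in>UNIV. if x \<in> \<Omega> then h i x else 0) \<le> (\<Sum>i\<in>UNIV. (\<eta>' i x)\<^sup>2) - k * (\<eta> x)\<^sup>2"
    proof (cases "x \<in> \<Omega>")
      case True
      have ux: "u x > 0" using pos True .
      \<comment> \<open>The nonnegative remainder in Picone's identity is the complete square
        (\<eta>' - \<eta> \<partial>_i u / u)^2; dropping it leaves only the gradient of \<eta> and
        the second derivative of \<open>u\<close>.\<close>
      have "h i x \<le> (\<eta>' i x)\<^sup>2 + (\<eta> x)\<^sup>2 / u x * iter_pdiff [i, i] u x" for i
      proof -
        have "h i x = (\<eta>' i x)\<^sup>2 + (\<eta> x)\<^sup>2 / u x * iter_pdiff [i, i] u x - (\<eta>' i x - \<eta> x * (pdiff i u x / u x))\<^sup>2"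
          using ux by (simp add: h_def power2_eq_square field_simps)
        then show ?thesis by simp
      qed
      then have "(\<Sum>i\<in>UNIV. h i x) \<le> (\<Sum>i\<in>UNIV. (\<eta>' i x)\<^sup>2 + (\<eta> x)\<^sup>2 / u x * iter_pdiff [i, i] u x)"
        by (rule sum_mono)
      also have "\<dots> = (\<Sum>i\<in>UNIV. (\<eta>' i x)\<^sup>2) + (\<eta> x)\<^sup>2 / u x * laplacian u x"
        by (simp add: sum.distrib laplacian_def sum_distrib_left)
      also have "laplacian u x = - f (u x)" using pde[OF True] by simp
      also have "(\<eta> x)\<^sup>2 / u x * - f (u x) \<le> - (k * (\<eta> x)\<^sup>2)"
      proof -
        have "(\<eta> x)\<^sup>2 / u x * (k * u x) \<le> (\<eta> x)\<^sup>2 / u x * f (u x)"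
          using k[OF ux] ux by (intro mult_left_mono) auto
        then show ?thesis using ux by (simp add: mult.commute)
      qed
      finally show ?thesis using True by simp
    qed (simp add: off)
  qed
  also have "\<dots> = (\<Sum>i\<in>UNIV. integral UNIV (\<lambda>x. (\<eta>' i x)\<^sup>2)) - k * integral UNIV (\<lambda>x. (\<eta> x)\<^sup>2)"
    by (simp add: integral_diff integrable_sum integrable_on_mult_right i1 i2 integral_sum)
  finally show ?thesis by simp
qed

end

section \<open>First-order bound in L1 for the effect of a dilation\<close>

context positive_solution_convex
begin

lemma dil_in_dom': "s \<ge> 1 \<Longrightarrow> dil s x \<in> \<Omega> \<Longrightarrow> x \<in> \<Omega>"
  using dil_in_dom[of s x] closure_subset[of \<Omega>]
  by (cases "s = 1") (auto simp: dilation_def)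

text \<open>The difference is the integral over s from 1 to \<open>l\<close> of the radial
  derivative at the dilated point. After exchanging the integrals, a change of variables shows that
  the slice at \<open>s\<close> contributes the right-hand integral divided by s^(N+1), and s \<ge>
  1.\<close>

lemma dilation_L1:
  assumes l: "l > 1"
    and g: "continuous_on UNIV g" "\<And>i. continuous_on UNIV (g' i)"
    and der: "\<And>i x. ((\<lambda>t. g (x + t *\<^sub>R axis i 1)) has_real_derivative g' i x) (at 0)"
    and supp: "\<And>x. x \<notin> \<Omega> \<Longrightarrow> g x = 0" "\<And>x i. x \<notin> \<Omega> \<Longrightarrow> g' i x = 0"
  shows "integral UNIV (\<lambda>x. \<bar>g (dil l x) - g x\<bar>) \<le>
    (l - 1) * integral UNIV (\<lambda>x. \<bar>\<Sum>i\<in>UNIV. (x - x0) $ i * g' i x\<bar>)"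
proof -
  define H where "H x = \<bar>\<Sum>i\<in>UNIV. (x - x0) $ i * g' i x\<bar>" for x
  define k where "k x s = \<bar>\<Sum>i\<in>UNIV. (x - x0) $ i * g' i (dil s x)\<bar>" for x s
  obtain a where a: "\<Omega> \<subseteq> cbox (-a) a"
    using bounded_subset_cbox_symmetric[OF bounded_dom] by blast
  have cH: "continuous_on UNIV H"
    unfolding H_def[abs_def] by (intro continuous_intros g)
  have H0: "H x = 0" if "x \<notin> \<Omega>" for x using supp that by (simp add: H_def)
  have ck2: "continuous_on A (\<lambda>(x, s). k x s)" for A
    unfolding k_def[abs_def] dilation_def case_prod_beta
    by (intro continuous_intros continuous_on_compose2[OF g(2)]) auto
  have ckx: "continuous_on A (k x)" for A x
    unfolding k_def[abs_def] dilation_def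
    by (intro continuous_intros continuous_on_compose2[OF g(2)]) auto
  have cks: "continuous_on A (\<lambda>x. k x s)" for A s
    unfolding k_def[abs_def] dilation_def
    by (intro continuous_intros continuous_on_compose2[OF g(2)]) auto
  have k_eq: "k x s = H (dil s x) / s" if "s \<ge> 1" for x s
  proof -
    have "dil s x - x0 = s *\<^sub>R (x - x0)" by (simp add: dilation_def algebra_simps)
    then have "H (dil s x) = \<bar>s * (\<Sum>i\<in>UNIV. (x - x0) $ i * g' i (dil s x))\<bar>"
      unfolding H_def by (simp add: sum_distrib_left mult.assoc del: vector_minus_component)
    then show ?thesis using that by (simp add: k_def abs_mult)
  qed
  have gd: "continuous_on UNIV (\<lambda>x. \<bar>g (dil l x) - g x\<bar>)"
    by (intro continuous_intros g continuous_on_compose2[OF g(1) continuous_on_dilation]) auto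
  have gd0: "\<bar>g (dil l x) - g x\<bar> = 0" if "x \<notin> \<Omega>" for x
    using that dil_outside[OF l that] supp(1) by simp
  have ftc: "\<bar>g (dil l x) - g x\<bar> \<le> integral {1..l} (k x)" for x
  proof -
    let ?d = "\<lambda>s. \<Sum>i\<in>UNIV. (x - x0) $ i * g' i (dil s x)"
    have "((\<lambda>s. g (dil s x)) has_vector_derivative ?d s) (at s within {1..l})" for s
    proof -
      have "((\<lambda>s. dil s x) has_derivative (\<lambda>h. h *\<^sub>R (x - x0))) (at s within {1..l})"
        unfolding dilation_def by (auto intro!: derivative_eq_intros simp: algebra_simps)
      from has_derivative_compose[OF this has_derivative_if_continuous_partials[OF der g(2)]]
      have "((\<lambda>s. g (dil s x)) has_derivative (\<lambda>h. \<Sum>i\<in>UNIV. (h *\<^sub>R (x - x0)) $ i * g' i (dil s x))) (at s within {1..l})" .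
      then show ?thesis
        unfolding has_vector_derivative_def
        by (simp add: sum_distrib_left mult.assoc del: vector_minus_component)
    qed
    then have "(?d has_integral g (dil l x) - g (dil 1 x)) {1..l}"
      using l by (intro fundamental_theorem_of_calculus) auto
    moreover have "dil 1 x = x" by (simp add: dilation_def)
    ultimately have hi: "(?d has_integral g (dil l x) - g x) {1..l}" by simp
    have "norm (integral {1..l} ?d) \<le> integral {1..l} (k x)"
    proof (rule integral_norm_bound_integral)
      show "?d integrable_on {1..l}" using hi by (rule has_integral_integrable)
      show "k x integrable_on {1..l}" using ckx by (rule integrable_continuous_interval)
    qed (simp add: k_def)
    then show ?thesis using integral_unique[OF hi] by simp
  qed
  have inner: "integral (cbox (-a) a) (\<lambda>x. k x s) \<le> integral UNIV H" if s: "s \<ge> 1" for s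
  proof -
    have "integral (cbox (-a) a) (\<lambda>x. k x s) = integral UNIV (\<lambda>x. k x s)"
    proof (rule integral_cbox_eq_UNIV[OF cks a])
      fix x assume "x \<notin> \<Omega>"
      then have "dil s x \<notin> \<Omega>" using dil_in_dom'[OF s] by blast
      then show "k x s = 0" using k_eq[OF s] H0 by simp
    qed
    also have "\<dots> = integral UNIV (\<lambda>x. H (dil s x)) / s"
      using s by (simp add: k_eq)
    also have "\<dots> = integral UNIV H / s ^ CARD('n) / s"
      using integral_dil[OF cH H0, of s] s by simp
    also have "\<dots> \<le> integral UNIV H"
    proof -
      have n: "0 \<le> integral UNIV H"
        by (rule integral_nonneg[OF integrable_dom[OF cH H0]]) (auto simp: H_def)
      have "1 \<le> s ^ CARD('n) * s"
        using s one_le_power[OF s] by (metis mult_mono' mult_1 zero_le_one)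
      then have "integral UNIV H / (s ^ CARD('n) * s) \<le> integral UNIV H / 1"
        using n by (intro divide_left_mono) auto
      then show ?thesis by (simp add: divide_divide_eq_left)
    qed
    finally show ?thesis .
  qed
  have "integral UNIV (\<lambda>x. \<bar>g (dil l x) - g x\<bar>) = integral (cbox (-a) a) (\<lambda>x. \<bar>g (dil l x) - g x\<bar>)"
    by (rule integral_cbox_eq_UNIV[OF gd a gd0, symmetric])
  also have "\<dots> \<le> integral (cbox (-a) a) (\<lambda>x. integral (cbox 1 l) (k x))"
  proof (rule integral_le)
    show "(\<lambda>x. \<bar>g (dil l x) - g x\<bar>) integrable_on cbox (-a) a"
      by (rule integrable_continuous[OF continuous_on_subset[OF gd]]) simp
    show "(\<lambda>x. integral (cbox 1 l) (k x)) integrable_on cbox (-a) a"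
      by (rule integrable_continuous[OF integral_continuous_on_param[OF ck2]])
    show "\<bar>g (dil l x) - g x\<bar> \<le> integral (cbox 1 l) (k x)" for x
      using ftc by simp
  qed
  also have "\<dots> = integral (cbox 1 l) (\<lambda>s. integral (cbox (-a) a) (\<lambda>x. k x s))"
    by (rule integral_swap_continuous[OF ck2])
  also have "\<dots> \<le> integral (cbox 1 l) (\<lambda>s. integral UNIV H)"
  proof (rule integral_le)
    have "continuous_on (cbox 1 l \<times> cbox (-a) a) (\<lambda>(s, x). k x s)"
      unfolding k_def[abs_def] dilation_def case_prod_beta
      by (intro continuous_intros continuous_on_compose2[OF g(2)]) auto
    then show "(\<lambda>s. integral (cbox (-a) a) (\<lambda>x. k x s)) integrable_on cbox 1 l"
      by (intro integrable_continuous integral_continuous_on_param)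
    show "(\<lambda>s. integral UNIV H) integrable_on cbox 1 l" by (rule integrable_const)
  qed (use inner in auto)
  also have "\<dots> = (l - 1) * integral UNIV H" using l by simp
  finally show ?thesis unfolding H_def .
qed

text \<open>Although \<nabla>u may be large near the boundary, its truncations are bounded in L1
  uniformly in \<epsilon>: |a| \<le> 1 + a^2 reduces this to the truncated energy, which is at most
  the integral of v |f(v)|. The bound then survives the limit \<epsilon> to 0.\<close>

lemma dilation_L1_solution:
  "\<exists>C\<ge>0. \<forall>l>1. integral UNIV (\<lambda>x. \<bar>v (dil l x) - v x\<bar>) \<le> C * (l - 1)"
proof -
  obtain R where R: "R > 0" "\<Omega> \<subseteq> ball x0 R"
    using bounded_subset_ballD[OF bounded_dom, of x0] by blast
  have meas: "\<Omega> \<in> lmeasurable" using open_dom bounded_dom by (intro lmeasurable_open)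
  define A where "A = integral UNIV (\<lambda>x. v x * \<bar>f (v x)\<bar>)"
  define C where "C = R * (real CARD('n) * measure lebesgue \<Omega> + A)"
  have A: "A \<ge> 0"
    unfolding A_def by (intro integral_nonneg integrable_dom continuous_intros cont_v cont_fv)
      (simp_all add: v_outside v_nonneg)
  have grad: "integral UNIV (\<lambda>x. \<bar>\<Sum>i\<in>UNIV. (x - x0) $ i * trunc_grad \<epsilon> i x\<bar>) \<le> C" if \<epsilon>: "\<epsilon> > 0" for \<epsilon>
  proof -
    have iU: "(\<lambda>x. (trunc_grad \<epsilon> i x)\<^sup>2) integrable_on UNIV" for i
      by (rule integrable_dom, intro continuous_intros cont_trunc_grad \<epsilon>) (simp add: trunc_grad_outside)
    have iI: "(\<lambda>x. indicat_real \<Omega> x) integrable_on UNIV"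
      using meas by (simp add: integrable_on_indicator)
    have isum: "(\<lambda>x. \<Sum>i\<in>UNIV. (trunc_grad \<epsilon> i x)\<^sup>2) integrable_on UNIV"
      by (rule integrable_sum) (auto intro: iU)
    have "integral UNIV (\<lambda>x. \<bar>\<Sum>i\<in>UNIV. (x - x0) $ i * trunc_grad \<epsilon> i x\<bar>) \<le>
      integral UNIV (\<lambda>x. R * (real CARD('n) * indicat_real \<Omega> x + (\<Sum>i\<in>UNIV. (trunc_grad \<epsilon> i x)\<^sup>2)))"
    proof (rule integral_le)
      show "(\<lambda>x. \<bar>\<Sum>i\<in>UNIV. (x - x0) $ i * trunc_grad \<epsilon> i x\<bar>) integrable_on UNIV"
        by (rule integrable_dom, intro continuous_intros cont_trunc_grad \<epsilon>) (simp add: trunc_grad_outside)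
      show "(\<lambda>x. R * (real CARD('n) * indicat_real \<Omega> x + (\<Sum>i\<in>UNIV. (trunc_grad \<epsilon> i x)\<^sup>2))) integrable_on UNIV"
        by (intro integrable_on_mult_right integrable_add isum iI)
      fix x
      show "\<bar>\<Sum>i\<in>UNIV. (x - x0) $ i * trunc_grad \<epsilon> i x\<bar> \<le>
        R * (real CARD('n) * indicat_real \<Omega> x + (\<Sum>i\<in>UNIV. (trunc_grad \<epsilon> i x)\<^sup>2))"
      proof (cases "x \<in> \<Omega>")
        case True
        then have nx: "norm (x - x0) \<le> R" using R by (auto simp: dist_norm norm_minus_commute subset_iff)
        have "\<bar>(x - x0) $ i * trunc_grad \<epsilon> i x\<bar> \<le> R * (1 + (trunc_grad \<epsilon> i x)\<^sup>2)" for i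
        proof -
          have "\<bar>trunc_grad \<epsilon> i x\<bar> \<le> 1 + (trunc_grad \<epsilon> i x)\<^sup>2"
            using zero_le_power2[of "\<bar>trunc_grad \<epsilon> i x\<bar> - 1"] zero_le_power2[of "trunc_grad \<epsilon> i x"]
            by (simp add: power2_diff)
          moreover have "\<bar>(x - x0) $ i\<bar> \<le> R"
            using component_le_norm_cart[of "x - x0" i] nx by linarith
          ultimately show ?thesis unfolding abs_mult using R by (intro mult_mono) auto
        qed
        then have "\<bar>\<Sum>i\<in>UNIV. (x - x0) $ i * trunc_grad \<epsilon> i x\<bar> \<le> (\<Sum>i\<in>UNIV. R * (1 + (trunc_grad \<epsilon> i x)\<^sup>2))"
          by (intro order_trans[OF sum_abs] sum_mono)
        also have "\<dots> = R * (real CARD('n) * indicat_real \<Omega> x + (\<Sum>i\<in>UNIV. (trunc_grad \<epsilon> i x)\<^sup>2))"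
          using True by (simp add: sum.distrib flip: sum_distrib_left)
        finally show ?thesis .
      qed (simp add: trunc_grad_outside)
    qed
    also have "\<dots> = R * (real CARD('n) * measure lebesgue \<Omega> + (\<Sum>i\<in>UNIV. integral UNIV (\<lambda>x. (trunc_grad \<epsilon> i x)\<^sup>2)))"
      using lmeasure_integral_UNIV[OF meas] integral_add[OF integrable_on_mult_right[OF iI] isum]
      by (simp add: integral_sum iU)
    also have "\<dots> \<le> C"
    proof -
      have "integral UNIV (\<lambda>x. trunc \<epsilon> (v x) * (trunc' \<epsilon> (v x) * f (v x))) \<le> A"
        unfolding A_def
      proof (rule integral_dom_mono)
        show "continuous_on UNIV (\<lambda>x. trunc \<epsilon> (v x) * (trunc' \<epsilon> (v x) * f (v x)))"
          by (intro continuous_intros cont_trunc_v \<epsilon> cont_fv)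
        show "continuous_on UNIV (\<lambda>x. v x * \<bar>f (v x)\<bar>)"
          by (intro continuous_intros cont_v cont_fv)
        fix x
        have "trunc' \<epsilon> (v x) * f (v x) \<le> \<bar>f (v x)\<bar>"
          using abs_trunc'_mult_le[OF \<epsilon>, of "v x" "f (v x)"] by linarith
        then have "trunc \<epsilon> (v x) * (trunc' \<epsilon> (v x) * f (v x)) \<le> trunc \<epsilon> (v x) * \<bar>f (v x)\<bar>"
          by (rule mult_left_mono) (simp add: trunc_bounds \<epsilon> v_nonneg)
        also have "\<dots> \<le> v x * \<bar>f (v x)\<bar>"
          by (rule mult_right_mono) (simp_all add: trunc_bounds \<epsilon> v_nonneg)
        finally show "trunc \<epsilon> (v x) * (trunc' \<epsilon> (v x) * f (v x)) \<le> v x * \<bar>f (v x)\<bar>" .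
      qed (simp_all add: fv_outside)
      then show ?thesis
        unfolding C_def using trunc_energy[OF \<epsilon>] R by (intro mult_left_mono add_left_mono) auto
    qed
    finally show ?thesis .
  qed
  have "integral UNIV (\<lambda>x. \<bar>v (dil l x) - v x\<bar>) \<le> C * (l - 1)" if l: "l > 1" for l
  proof -
    let ?\<epsilon> = "\<lambda>k. inverse (real (Suc k))"
    have ep: "?\<epsilon> k > 0" for k by simp
    have ctr: "continuous_on UNIV (\<lambda>x. trunc (?\<epsilon> k) (v (dil l x)))" for k
      by (rule continuous_on_compose2[OF cont_trunc_v(1)[OF ep] continuous_on_dilation]) simp
    obtain M where M: "\<forall>x. \<bar>v x\<bar> \<le> M"
      using bounded_continuous_bounded_support[OF cont_v bounded_dom v_outside] by auto
    have "(\<lambda>k. integral UNIV (\<lambda>x. \<bar>trunc (?\<epsilon> k) (v (dil l x)) - trunc (?\<epsilon> k) (v x)\<bar>)) \<longlonglongrightarrow>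
        integral UNIV (\<lambda>x. \<bar>v (dil l x) - v x\<bar>)"
    proof (rule dominated_bounded_support[OF _ bounded_dom])
      show "continuous_on UNIV (\<lambda>x. \<bar>trunc (?\<epsilon> k) (v (dil l x)) - trunc (?\<epsilon> k) (v x)\<bar>)" for k
        by (intro continuous_intros ctr cont_trunc_v(1)[OF ep])
      show "\<bar>trunc (?\<epsilon> k) (v (dil l x)) - trunc (?\<epsilon> k) (v x)\<bar> = 0" if "x \<notin> \<Omega>" for k x
        using v_outside[OF that] v_dil_outside[OF l that] by simp
      show "\<bar>\<bar>trunc (?\<epsilon> k) (v (dil l x)) - trunc (?\<epsilon> k) (v x)\<bar>\<bar> \<le> M" for k x
      proof -
        have "0 \<le> trunc (?\<epsilon> k) (v y)" "trunc (?\<epsilon> k) (v y) \<le> M" for y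
          using trunc_bounds[OF ep[of k] v_nonneg[of y]] spec[OF M, of y] by auto
        from this[of x] this[of "dil l x"] show ?thesis by linarith
      qed
      show "(\<lambda>k. \<bar>trunc (?\<epsilon> k) (v (dil l x)) - trunc (?\<epsilon> k) (v x)\<bar>) \<longlonglongrightarrow> \<bar>v (dil l x) - v x\<bar>" for x
        by (intro tendsto_intros trunc_tendsto v_nonneg)
    qed
    moreover have "integral UNIV (\<lambda>x. \<bar>trunc (?\<epsilon> k) (v (dil l x)) - trunc (?\<epsilon> k) (v x)\<bar>) \<le> C * (l - 1)" for k
    proof -
      have "trunc (?\<epsilon> k) (v x) = 0" if "x \<notin> \<Omega>" for x
        using that by (simp add: v_outside trunc_below)
      from dilation_L1[OF l cont_trunc_v(1)[OF ep] cont_trunc_grad[OF ep] DERIV_trunc_v[OF ep] this trunc_grad_outside]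
      have "integral UNIV (\<lambda>x. \<bar>trunc (?\<epsilon> k) (v (dil l x)) - trunc (?\<epsilon> k) (v x)\<bar>) \<le>
        (l - 1) * integral UNIV (\<lambda>x. \<bar>\<Sum>i\<in>UNIV. (x - x0) $ i * trunc_grad (?\<epsilon> k) i x\<bar>)" .
      also have "\<dots> \<le> (l - 1) * C" using grad[OF ep] l by (intro mult_left_mono) auto
      finally show ?thesis by (simp add: mult.commute)
    qed
    ultimately show ?thesis
      by (intro LIMSEQ_le_const2) auto
  qed
  moreover have "C \<ge> 0" using A R by (simp add: C_def)
  ultimately show ?thesis by blast
qed

end

section \<open>A Pohozaev inequality with boundary flux\<close>

text \<open>The increment of \<open>F\<close> is (b - a) f(z) for an intermediate z, and replacing
  f(z) by f(a) costs at most d |b - a|. Only a lower bound is required, since the linearised term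
  enters the energy with a minus sign.\<close>

lemma linearization_lower_bound:
  fixes F f :: "real \<Rightarrow> real"
  assumes contF: "continuous_on {0..} F" and derF: "\<And>t. t > 0 \<Longrightarrow> (F has_real_derivative f t) (at t)"
    and ab: "0 \<le> a" "0 \<le> b"
    and osc: "\<And>z. min a b \<le> z \<Longrightarrow> z \<le> max a b \<Longrightarrow> \<bar>f z - f a\<bar> \<le> d"
  shows "F b - F a - d * \<bar>b - a\<bar> \<le> f a * (b - a)"
proof -
  have mvt: "\<exists>z>p. z < q \<and> F q - F p = (q - p) * f z" if "0 \<le> p" "p < q" for p q
  proof -
    have "continuous_on {p..q} F" using contF by (rule continuous_on_subset) (use that in auto)
    moreover have "F differentiable (at z)" if "p < z" for z
      using derF[of z] \<open>0 \<le> p\<close> that by (auto simp: real_differentiable_def)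
    ultimately obtain L z where z: "p < z" "z < q" "DERIV F z :> L" "F q - F p = (q - p) * L"
      using MVT[OF \<open>p < q\<close>, of F] by blast
    have "L = f z" using DERIV_unique[OF z(3) derF] z(1) that by simp
    then show ?thesis using z by blast
  qed
  have bound: "F b - F a = (b - a) * f z \<Longrightarrow> \<bar>f z - f a\<bar> \<le> d \<Longrightarrow> ?thesis" for z
  proof -
    assume z: "F b - F a = (b - a) * f z" "\<bar>f z - f a\<bar> \<le> d"
    have "(b - a) * (f z - f a) \<le> \<bar>b - a\<bar> * \<bar>f z - f a\<bar>"
      by (metis abs_ge_self abs_mult)
    also have "\<dots> \<le> \<bar>b - a\<bar> * d" using z(2) by (intro mult_left_mono) auto
    finally show ?thesis using z(1) by (simp add: algebra_simps)
  qed
  consider "a = b" | "a < b" | "b < a" by linarith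
  then show ?thesis
  proof cases
    case 2
    then obtain z where z: "a < z" "z < b" "F b - F a = (b - a) * f z" using mvt[OF ab(1)] by blast
    show ?thesis by (rule bound[OF z(3) osc]) (use z ab in auto)
  next
    case 3
    then obtain z where z: "b < z" "z < a" "F a - F b = (a - b) * f z" using mvt[OF ab(2)] by blast
    have "F b - F a = (b - a) * f z" using z(3) by (simp add: algebra_simps)
    then show ?thesis by (rule bound[OF _ osc]) (use z ab in auto)
  qed simp
qed

lemma difference_quotient_power_tendsto:
  fixes s :: "nat \<Rightarrow> real"
  assumes "s \<longlonglongrightarrow> 1" "\<And>k. s k \<noteq> 1"
  shows "(\<lambda>k. (s k ^ m - 1) / (1 - s k)) \<longlonglongrightarrow> - real m"
proof -
  have "(\<lambda>k. - (\<Sum>i<m. s k ^ i)) \<longlonglongrightarrow> - (\<Sum>i<m. 1 ^ i)"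
    by (intro tendsto_intros assms)
  moreover have "(s k ^ m - 1) / (1 - s k) = - (\<Sum>i<m. s k ^ i)" for k
  proof -
    have "s k ^ m - 1 = (1 - s k) * - (\<Sum>i<m. s k ^ i)"
      using power_diff_1_eq[of "s k" m] by (simp add: algebra_simps)
    then show ?thesis using assms(2)[of k] by simp
  qed
  ultimately show ?thesis by simp
qed

context positive_solution_convex
begin

text \<open>The integrand is close to F(v after dilation) - F(v), whose integral is known exactly by
  scaling. The error is the oscillation of \<open>f\<close> between neighbouring values of
  \<open>v\<close>, which tends to 0 uniformly, times the L1 distance, which is O(l - 1); hence it
  is o(l - 1).\<close>

lemma pohozaev_remainder:
  assumes contF: "continuous_on {0..} F" and F0: "F 0 = 0"
    and derF: "\<And>t. t > 0 \<Longrightarrow> (F has_real_derivative f t) (at t)" and \<delta>: "\<delta> > 0"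
  shows "\<exists>l0>1. \<forall>l. 1 < l \<longrightarrow> l < l0 \<longrightarrow>
    (1 / l ^ CARD('n) - 1) * integral UNIV (\<lambda>x. F (v x)) - \<delta> * (l - 1) \<le>
    integral UNIV (\<lambda>x. f (v x) * (v (dil l x) - v x))"
proof -
  obtain C where C: "C \<ge> 0" "\<And>l. l > 1 \<Longrightarrow> integral UNIV (\<lambda>x. \<bar>v (dil l x) - v x\<bar>) \<le> C * (l - 1)"
    using dilation_L1_solution by blast
  \<comment> \<open>The added 1 covers the case \<open>C = 0\<close>.\<close>
  define d where "d = \<delta> / (C + 1)"
  have d: "d > 0" "d * C \<le> \<delta>" using \<delta> C(1) by (auto simp: d_def field_simps)
  obtain M where M: "\<forall>x. \<bar>v x\<bar> \<le> M"
    using bounded_continuous_bounded_support[OF cont_v bounded_dom v_outside] by auto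
  have "uniformly_continuous_on {0..M} f"
    by (intro compact_uniformly_continuous continuous_on_subset[OF cont_f]) auto
  then obtain e where e: "e > 0" "\<And>s t. s \<in> {0..M} \<Longrightarrow> t \<in> {0..M} \<Longrightarrow> dist t s < e \<Longrightarrow> dist (f t) (f s) < d"
    using d(1) unfolding uniformly_continuous_on_def by metis
  obtain R where R: "R > 0" "\<Omega> \<subseteq> ball x0 R"
    using bounded_subset_ballD[OF bounded_dom, of x0] by blast
  have "uniformly_continuous_on (cball x0 (2 * R)) v"
    by (intro compact_uniformly_continuous continuous_on_subset[OF cont_v]) auto
  then obtain e1 where e1: "e1 > 0"
    "\<And>x y. x \<in> cball x0 (2 * R) \<Longrightarrow> y \<in> cball x0 (2 * R) \<Longrightarrow> dist y x < e1 \<Longrightarrow> dist (v y) (v x) < e"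
    using e(1) unfolding uniformly_continuous_on_def by metis
  \<comment> \<open>The bound 2 keeps dilated points of \<Omega> in the ball of radius 2R where
    \<open>v\<close> is uniformly continuous; e1/R makes the displacement (l-1)|x - x0| smaller than
    \<open>e1\<close>.\<close>
  define l0 where "l0 = min 2 (1 + e1 / R)"
  have "l0 > 1" using e1(1) R(1) by (simp add: l0_def)
  moreover have "(1 / l ^ CARD('n) - 1) * integral UNIV (\<lambda>x. F (v x)) - \<delta> * (l - 1) \<le>
    integral UNIV (\<lambda>x. f (v x) * (v (dil l x) - v x))" if l: "1 < l" "l < l0" for l
  proof -
    have close: "\<bar>v (dil l x) - v x\<bar> < e" for x
    proof (cases "x \<in> \<Omega>")
      case True
      then have nx: "norm (x - x0) < R" using R(2) by (auto simp: dist_norm norm_minus_commute)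
      have "norm (dil l x - x0) = l * norm (x - x0)"
      proof -
        have "dil l x - x0 = l *\<^sub>R (x - x0)" by (simp add: dilation_def algebra_simps)
        then show ?thesis using l by simp
      qed
      also have "\<dots> \<le> 2 * R" using nx l by (intro mult_mono) (auto simp: l0_def)
      finally have in1: "dil l x \<in> cball x0 (2 * R)" by (simp add: dist_norm norm_minus_commute)
      have in2: "x \<in> cball x0 (2 * R)" using nx R(1) by (simp add: dist_norm norm_minus_commute)
      have "dist (dil l x) x = (l - 1) * norm (x - x0)"
      proof -
        have "dil l x - x = (l - 1) *\<^sub>R (x - x0)" by (simp add: dilation_def algebra_simps)
        then show ?thesis using l by (simp add: dist_norm)
      qed
      also have "\<dots> \<le> (l - 1) * R" using nx l by (intro mult_left_mono) auto
      also have "\<dots> < e1" using l(2) R(1) by (simp add: l0_def field_simps)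
      finally show ?thesis using e1(2)[OF in2 in1] by (simp add: dist_real_def)
    next
      case False
      then show ?thesis using e(1) by (simp add: v_outside v_dil_outside[OF l(1)])
    qed
    have pw: "F (v (dil l x)) - F (v x) - d * \<bar>v (dil l x) - v x\<bar> \<le> f (v x) * (v (dil l x) - v x)" for x
    proof (rule linearization_lower_bound[OF contF derF v_nonneg v_nonneg])
      fix z assume z: "min (v x) (v (dil l x)) \<le> z" "z \<le> max (v x) (v (dil l x))"
      have vM: "0 \<le> v y" "v y \<le> M" for y using v_nonneg[of y] spec[OF M, of y] by auto
      have "\<bar>f z - f (v x)\<bar> < d"
      proof -
        have "0 \<le> z" "z \<le> M" "\<bar>z - v x\<bar> < e"
          using z close[of x] vM[of x] vM[of "dil l x"] by linarith+
        then show ?thesis using e(2)[of "v x" z] vM[of x] by (simp add: dist_real_def)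
      qed
      then show "\<bar>f z - f (v x)\<bar> \<le> d" by simp
    qed
    have cF: "continuous_on UNIV (\<lambda>x. F (v x))" by (rule cont_comp_v[OF contF])
    have cFd: "continuous_on UNIV (\<lambda>x. F (v (dil l x)))"
      by (rule continuous_on_compose2[OF cF continuous_on_dilation]) simp
    have i1: "(\<lambda>x. F (v x)) integrable_on UNIV"
      by (rule integrable_dom[OF cF]) (simp add: v_outside F0)
    have i2: "(\<lambda>x. F (v (dil l x))) integrable_on UNIV"
      by (rule integrable_dom[OF cFd]) (simp add: v_dil_outside[OF l(1)] F0)
    have i3: "(\<lambda>x. \<bar>v (dil l x) - v x\<bar>) integrable_on UNIV"
      by (rule integrable_dom, intro continuous_intros cont_v cont_v_dil)
        (simp add: v_dil_outside[OF l(1)] v_outside)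
    have "integral UNIV (\<lambda>x. F (v (dil l x)) - F (v x) - d * \<bar>v (dil l x) - v x\<bar>) \<le>
        integral UNIV (\<lambda>x. f (v x) * (v (dil l x) - v x))"
    proof (rule integral_le)
      show "(\<lambda>x. F (v (dil l x)) - F (v x) - d * \<bar>v (dil l x) - v x\<bar>) integrable_on UNIV"
        by (intro integrable_diff integrable_on_mult_right i1 i2 i3)
      show "(\<lambda>x. f (v x) * (v (dil l x) - v x)) integrable_on UNIV"
        by (rule integrable_dom, intro continuous_intros cont_v cont_v_dil cont_fv) (simp add: fv_outside)
    qed (rule pw)
    moreover have "integral UNIV (\<lambda>x. F (v (dil l x)) - F (v x) - d * \<bar>v (dil l x) - v x\<bar>) =
        integral UNIV (\<lambda>x. F (v (dil l x))) - integral UNIV (\<lambda>x. F (v x)) - d * integral UNIV (\<lambda>x. \<bar>v (dil l x) - v x\<bar>)"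
      using integral_diff[OF integrable_diff[OF i2 i1] integrable_on_mult_right[OF i3, of d]]
        integral_diff[OF i2 i1] by simp
    moreover have "integral UNIV (\<lambda>x. F (v (dil l x))) = integral UNIV (\<lambda>x. F (v x)) / l ^ CARD('n)"
      by (rule integral_dil[OF cF]) (use l in \<open>auto simp: v_outside F0\<close>)
    moreover have "d * integral UNIV (\<lambda>x. \<bar>v (dil l x) - v x\<bar>) \<le> \<delta> * (l - 1)"
    proof -
      have "d * integral UNIV (\<lambda>x. \<bar>v (dil l x) - v x\<bar>) \<le> d * (C * (l - 1))"
        using C(2)[OF l(1)] d(1) by (intro mult_left_mono) auto
      also have "\<dots> = d * C * (l - 1)" by simp
      also have "\<dots> \<le> \<delta> * (l - 1)" using d(2) l by (intro mult_right_mono) auto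
      finally show ?thesis .
    qed
    ultimately show ?thesis by (simp add: algebra_simps)
  qed
  ultimately show ?thesis by blast
qed

text \<open>By the divergence theorem \<open>\<integral>f(u)\<close> is the total flux of \<open>-\<nabla>u\<close> through the boundary, so its
  square is a lower bound for the boundary term of Pohozaev's identity.\<close>

theorem pohozaev_flux:
  assumes r: "r > 0" "ball x0 r \<subseteq> \<Omega>" and N: "CARD('n) \<ge> 2"
    and contF: "continuous_on {0..} F" and F0: "F 0 = 0"
    and derF: "\<And>t. t > 0 \<Longrightarrow> (F has_real_derivative f t) (at t)"
  shows "0 \<le> 2 * real CARD('n) * integral UNIV (\<lambda>x. F (v x)) - (real CARD('n) - 2) * integral UNIV (\<lambda>x. v x * f (v x))"
    (is "0 \<le> ?P")
    and "(integral UNIV (\<lambda>x. f (v x)))\<^sup>2 \<le> 64 * real CARD('n) * measure lebesgue \<Omega> / r\<^sup>2 *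
    (2 * real CARD('n) * integral UNIV (\<lambda>x. F (v x)) - (real CARD('n) - 2) * integral UNIV (\<lambda>x. v x * f (v x)))"
proof -
  define C where "C = 64 * real CARD('n) * measure lebesgue \<Omega> / r\<^sup>2"
  define A where "A = integral UNIV (\<lambda>x. v x * f (v x))"
  define I where "I = integral UNIV (\<lambda>x. F (v x))"
  have C: "C \<ge> 0" by (simp add: C_def)
  define l where "l k = 1 + inverse (real (Suc k))" for k
  have l1: "l k > 1" for k by (simp add: l_def)
  have llim: "l \<longlonglongrightarrow> 1"
    unfolding l_def using tendsto_add[OF tendsto_const[of 1] LIMSEQ_inverse_real_of_nat] by simp
  \<comment> \<open>The energy bound of \<open>dilation_inequality\<close> regrouped so that each
    part tends to 0 with \<open>l k - 1\<close>.\<close>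
  define B where "B k = (l k)\<^sup>2 / l k ^ CARD('n) * A - A - 2 * integral UNIV (\<lambda>x. f (v x) * (v (dil (l k) x) - v x))" for k
  \<comment> \<open>The gradient of the cut-off is already replaced by its bound from
    \<open>layer_cutoff\<close>, so a predicate on \<eta> alone suffices to choose a
    sequence.\<close>
  define Cut where "Cut k \<eta> \<longleftrightarrow> continuous_on UNIV \<eta> \<and> (\<forall>x. 0 \<le> \<eta> x \<and> \<eta> x \<le> 1) \<and>
      (\<forall>x. dil (l k) x \<in> \<Omega> \<longrightarrow> \<eta> x = 1) \<and>
      0 \<le> B k \<and> (integral UNIV (\<lambda>x. \<eta> x * f (v x)))\<^sup>2 \<le> C * (B k / (1 - 1 / l k))" for k \<eta>
  have "\<exists>\<eta>. Cut k \<eta>" for k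
  proof -
    obtain \<eta> and \<eta>' :: "'n \<Rightarrow> real^'n \<Rightarrow> real" and S where
      \<eta>: "continuous_on UNIV \<eta>" "\<forall>i. continuous_on UNIV (\<eta>' i)"
        "\<forall>i x. ((\<lambda>t. \<eta> (x + t *\<^sub>R axis i 1)) has_real_derivative \<eta>' i x) (at 0)"
        and \<eta>01: "\<forall>x. 0 \<le> \<eta> x \<and> \<eta> x \<le> 1" and S: "compact S" "S \<subseteq> \<Omega>"
        and supp: "\<forall>x. x \<notin> S \<longrightarrow> \<eta> x = 0 \<and> (\<forall>i. \<eta>' i x = 0)"
        and flat: "\<forall>x. dil (l k) x \<in> \<Omega> \<longrightarrow> \<eta> x = 1 \<and> (\<forall>i. \<eta>' i x = 0)"
        and H: "(\<Sum>i\<in>UNIV. integral UNIV (\<lambda>x. (\<eta>' i x)\<^sup>2)) \<le> C / (1 - 1 / l k)"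
      using layer_cutoff[OF open_dom bounded_dom convex_dom r l1[of k]] unfolding C_def by blast
    have c\<eta>: "continuous_on UNIV (\<eta>' i)" for i using \<eta>(2) by blast
    have der\<eta>: "((\<lambda>t. \<eta> (x + t *\<^sub>R axis i 1)) has_real_derivative \<eta>' i x) (at 0)" for i x
      using \<eta>(3) by blast
    have supp1: "\<eta> x = 0" "\<eta>' i x = 0" if "x \<notin> S" for x i using supp that by blast+
    have flat1: "\<eta>' i x = 0" if "dil (l k) x \<in> \<Omega>" for x i using flat that by blast
    have i1: "(\<lambda>x. v (dil (l k) x) * f (v x)) integrable_on UNIV"
      by (rule integrable_dom, intro continuous_intros cont_v cont_v_dil cont_fv) (simp add: fv_outside)
    have i2: "(\<lambda>x. v x * f (v x)) integrable_on UNIV"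
      by (rule integrable_dom, intro continuous_intros cont_v cont_fv) (simp add: fv_outside)
    have "integral UNIV (\<lambda>x. f (v x) * (v (dil (l k) x) - v x)) = integral UNIV (\<lambda>x. v (dil (l k) x) * f (v x)) - A"
      using integral_diff[OF i1 i2] by (simp add: A_def algebra_simps)
    then have Beq: "(1 + (l k)\<^sup>2 / l k ^ CARD('n)) * A - 2 * integral UNIV (\<lambda>x. v (dil (l k) x) * f (v x)) = B k"
      by (simp add: B_def algebra_simps)
    have B0: "0 \<le> B k"
      unfolding Beq[symmetric] A_def
      by (rule dilation_inequality[OF l1 \<eta>(1) c\<eta> der\<eta> _ _ S]) (auto intro: supp1 flat1)
    have "(integral UNIV (\<lambda>x. \<eta> x * f (v x)))\<^sup>2 \<le> B k * (\<Sum>i\<in>UNIV. integral UNIV (\<lambda>x. (\<eta>' i x)\<^sup>2))"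
      unfolding Beq[symmetric] A_def
      by (rule dilation_inequality[OF l1 \<eta>(1) c\<eta> der\<eta> _ _ S]) (auto intro: supp1 flat1)
    also have "\<dots> \<le> B k * (C / (1 - 1 / l k))"
      using H B0 by (intro mult_left_mono)
    finally have "(integral UNIV (\<lambda>x. \<eta> x * f (v x)))\<^sup>2 \<le> C * (B k / (1 - 1 / l k))"
      by (simp add: mult.commute)
    then have "Cut k \<eta>" using \<eta>(1) \<eta>01 flat B0 unfolding Cut_def by blast
    then show ?thesis by blast
  qed
  then obtain \<eta> where cut: "\<And>k. Cut k (\<eta> k)" by metis
  then have \<eta>: "continuous_on UNIV (\<eta> k)" "0 \<le> \<eta> k x \<and> \<eta> k x \<le> 1" "dil (l k) x \<in> \<Omega> \<Longrightarrow> \<eta> k x = 1"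
    and ineq: "0 \<le> B k" "(integral UNIV (\<lambda>x. \<eta> k x * f (v x)))\<^sup>2 \<le> C * (B k / (1 - 1 / l k))" for k x
    unfolding Cut_def by blast+
  obtain Bf where Bf: "\<forall>x. \<bar>f (v x)\<bar> \<le> Bf"
    using bounded_continuous_bounded_support[OF cont_fv bounded_dom fv_outside] by auto
  have lim1: "(\<lambda>k. integral UNIV (\<lambda>x. \<eta> k x * f (v x))) \<longlonglongrightarrow> integral UNIV (\<lambda>x. f (v x))"
  proof (rule dominated_bounded_support[OF _ bounded_dom])
    show "continuous_on UNIV (\<lambda>x. \<eta> k x * f (v x))" for k
      by (intro continuous_intros \<eta>(1) cont_fv)
    show "\<eta> k x * f (v x) = 0" if "x \<notin> \<Omega>" for k x using that by (simp add: fv_outside)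
    show "\<bar>\<eta> k x * f (v x)\<bar> \<le> Bf" for k x
    proof -
      have "\<bar>\<eta> k x * f (v x)\<bar> \<le> 1 * Bf"
        unfolding abs_mult using \<eta>(2)[of k x] Bf by (intro mult_mono) auto
      then show ?thesis by simp
    qed
    show "(\<lambda>k. \<eta> k x * f (v x)) \<longlonglongrightarrow> f (v x)" for x
    proof (cases "x \<in> \<Omega>")
      case True
      have "(\<lambda>k. dil (l k) x) \<longlonglongrightarrow> 1 *\<^sub>R x + (1 - 1) *\<^sub>R x0"
        unfolding dilation_def by (intro tendsto_intros llim)
      then have "(\<lambda>k. dil (l k) x) \<longlonglongrightarrow> x" by simp
      then have "\<forall>\<^sub>F k in sequentially. dil (l k) x \<in> \<Omega>"
        using open_dom True by (rule topological_tendstoD)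
      then have "\<forall>\<^sub>F k in sequentially. \<eta> k x * f (v x) = f (v x)"
        by (rule eventually_mono) (simp add: \<eta>(3))
      then show ?thesis by (rule tendsto_eventually)
    qed (simp add: fv_outside)
  qed
  define P where "P = 2 * real CARD('n) * I - (real CARD('n) - 2) * A"
  \<comment> \<open>The remainder is below \<delta> (l - 1) for every \<delta> only once
    \<open>l\<close> is close enough to 1; this leaves the slack \<open>2 * \<delta>\<close>,
    removed at the end.\<close>
  have main: "0 \<le> P + 2 * \<delta>" "(integral UNIV (\<lambda>x. f (v x)))\<^sup>2 \<le> C * (P + 2 * \<delta>)" if \<delta>: "\<delta> > 0" for \<delta>
  proof -
    define s where "s k = 1 / l k" for k
    have slim: "s \<longlonglongrightarrow> 1"
      unfolding s_def using tendsto_divide[OF tendsto_const[of 1] llim] by simp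
    have s: "s k \<noteq> 1" "s k < 1" "s k > 0" for k using l1[of k] by (simp_all add: s_def)
    \<comment> \<open>An upper bound for \<open>B k / (1 - s k)\<close> after inserting the
      remainder estimate. Its quotients are difference quotients at 1 of the powers N-2 and N, the
      source of the coefficients N-2 and 2N; the last factor \<open>l k\<close> is
      (l-1)/(1-s).\<close>
    define Q where "Q k = (s k ^ (CARD('n) - 2) - 1) / (1 - s k) * A - 2 * ((s k ^ CARD('n) - 1) / (1 - s k)) * I + 2 * \<delta> * l k" for k
    have Qlim: "Q \<longlonglongrightarrow> - real (CARD('n) - 2) * A - 2 * (- real CARD('n)) * I + 2 * \<delta> * 1"
      unfolding Q_def by (intro tendsto_intros difference_quotient_power_tendsto slim s llim)
    have Plim: "- real (CARD('n) - 2) * A - 2 * (- real CARD('n)) * I + 2 * \<delta> * 1 = P + 2 * \<delta>"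
      using N by (simp add: P_def of_nat_diff algebra_simps)
    obtain l0 where l0: "l0 > 1" "\<And>l. 1 < l \<Longrightarrow> l < l0 \<Longrightarrow>
        (1 / l ^ CARD('n) - 1) * I - \<delta> * (l - 1) \<le> integral UNIV (\<lambda>x. f (v x) * (v (dil l x) - v x))"
      using pohozaev_remainder[OF contF F0 derF \<delta>] unfolding I_def by blast
    have "\<forall>\<^sub>F k in sequentially. l k < l0"
      using order_tendstoD(2)[OF llim l0(1)] .
    then have ev: "\<forall>\<^sub>F k in sequentially. 0 \<le> Q k \<and> (integral UNIV (\<lambda>x. \<eta> k x * f (v x)))\<^sup>2 \<le> C * Q k"
    proof (rule eventually_mono)
      fix k assume k: "l k < l0"
      have sl: "s k * l k = 1" using l1[of k] by (simp add: s_def)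
      have "(l k)\<^sup>2 / l k ^ CARD('n) = s k ^ (CARD('n) - 2)"
      proof -
        have "l k ^ CARD('n) = (l k)\<^sup>2 * l k ^ (CARD('n) - 2)"
          using power_add[of "l k" 2 "CARD('n) - 2"] unfolding le_add_diff_inverse[OF N] .
        then show ?thesis using l1[of k] by (simp add: s_def power_divide)
      qed
      moreover have "1 / l k ^ CARD('n) = s k ^ CARD('n)" by (simp add: s_def power_divide)
      ultimately have "B k \<le> (s k ^ (CARD('n) - 2) - 1) * A - 2 * ((s k ^ CARD('n) - 1) * I - \<delta> * (l k - 1))"
        using l0(2)[OF l1 k] by (simp add: B_def algebra_simps)
      then have "B k / (1 - s k) \<le> ((s k ^ (CARD('n) - 2) - 1) * A - 2 * ((s k ^ CARD('n) - 1) * I - \<delta> * (l k - 1))) / (1 - s k)"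
        using s(2)[of k] by (intro divide_right_mono) auto
      also have "\<dots> = (s k ^ (CARD('n) - 2) - 1) / (1 - s k) * A - 2 * ((s k ^ CARD('n) - 1) / (1 - s k)) * I
          + 2 * \<delta> * ((l k - 1) / (1 - s k))"
        by (simp add: add_divide_distrib diff_divide_distrib algebra_simps)
      also have "(l k - 1) / (1 - s k) = l k"
      proof -
        have "l k - 1 = l k * (1 - s k)" using sl by (simp add: algebra_simps)
        then show ?thesis using s(1)[of k] by simp
      qed
      finally have BQ: "B k / (1 - s k) \<le> Q k" by (simp add: Q_def)
      have "0 \<le> B k / (1 - s k)" using ineq(1)[of k] s(2)[of k] by (intro divide_nonneg_pos) auto
      then have "0 \<le> Q k" using BQ by linarith
      moreover have "(integral UNIV (\<lambda>x. \<eta> k x * f (v x)))\<^sup>2 \<le> C * Q k"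
        using ineq(2)[of k, folded s_def] mult_left_mono[OF BQ C] by (rule order_trans)
      ultimately show "0 \<le> Q k \<and> (integral UNIV (\<lambda>x. \<eta> k x * f (v x)))\<^sup>2 \<le> C * Q k" by simp
    qed
    show "0 \<le> P + 2 * \<delta>"
      by (rule tendsto_le[OF sequentially_bot Qlim[unfolded Plim] tendsto_const])
        (use ev in \<open>rule eventually_mono, simp\<close>)
    show "(integral UNIV (\<lambda>x. f (v x)))\<^sup>2 \<le> C * (P + 2 * \<delta>)"
    proof (rule tendsto_le[OF sequentially_bot])
      show "(\<lambda>k. C * Q k) \<longlonglongrightarrow> C * (P + 2 * \<delta>)"
        using Qlim unfolding Plim by (intro tendsto_intros)
      show "(\<lambda>k. (integral UNIV (\<lambda>x. \<eta> k x * f (v x)))\<^sup>2) \<longlonglongrightarrow> (integral UNIV (\<lambda>x. f (v x)))\<^sup>2"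
        by (intro tendsto_intros lim1)
      show "\<forall>\<^sub>F k in sequentially. (integral UNIV (\<lambda>x. \<eta> k x * f (v x)))\<^sup>2 \<le> C * Q k"
        using ev by (rule eventually_mono) simp
    qed
  qed
  have Peq: "?P = P" by (simp add: P_def A_def I_def)
  show "0 \<le> ?P"
    unfolding Peq
  proof (rule field_le_epsilon)
    fix e :: real assume "0 < e"
    then show "0 \<le> P + e" using main(1)[of "e / 2"] by simp
  qed
  show "(integral UNIV (\<lambda>x. f (v x)))\<^sup>2 \<le> 64 * real CARD('n) * measure lebesgue \<Omega> / r\<^sup>2 * ?P"
    unfolding Peq C_def[symmetric]
  proof (rule LIMSEQ_le_const)
    have "(\<lambda>k. C * (P + 2 * inverse (real (Suc k)))) \<longlonglongrightarrow> C * (P + 2 * 0)"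
      by (intro tendsto_intros LIMSEQ_inverse_real_of_nat)
    then show "(\<lambda>k. C * (P + 2 * inverse (real (Suc k)))) \<longlonglongrightarrow> C * P" by simp
    show "\<exists>N. \<forall>n\<ge>N. (integral UNIV (\<lambda>x. f (v x)))\<^sup>2 \<le> C * (P + 2 * inverse (real (Suc n)))"
      by (intro exI allI impI main) simp
  qed
qed

end

section \<open>Bound on the mass\<close>

text \<open>Sorted by powers of \<open>t\<close>: the coefficient of \<open>t powr q\<close> is 2N/q
  - (N-2), nonpositive exactly because \<open>q\<close> is at least the critical exponent;
  \<open>t powr p\<close> is at most 1 + t^2 as p \<le> 2; and the multiplier terms -N and N-2 add
  up to -2.\<close>

lemma pohozaev_density_le:
  fixes t p q \<mu> \<omega> N :: real
  assumes t: "0 \<le> t" and p: "1 < p" "p \<le> 2" and N: "2 < N" and q: "2 * N / (N - 2) \<le> q" and \<mu>: "0 \<le> \<mu>"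
  shows "2 * N * (\<mu> / p * t powr p + t powr q / q - \<omega> / 2 * t\<^sup>2)
      - (N - 2) * (t * (\<mu> * t powr (p - 1) + t powr (q - 1) - \<omega> * t))
    \<le> 2 * N * \<mu> * (1 + t\<^sup>2) - 2 * \<omega> * t\<^sup>2"
proof -
  have q0: "q > 0" using q N by (smt (verit) divide_pos_pos)
  have "t powr p \<le> 1 + t\<^sup>2"
  proof (cases "t \<le> 1")
    case True
    then have "t powr p \<le> 1" using t p by (intro powr_le1) auto
    then show ?thesis by (smt (verit) zero_le_power2)
  next
    case False
    then have "t powr p \<le> t powr 2" using p by (intro powr_mono) auto
    then show ?thesis using False by (simp add: powr_numeral)
  qed
  moreover have "2 * N * \<mu> / p - (N - 2) * \<mu> \<le> 2 * N * \<mu>"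
  proof -
    have "2 * N * \<mu> / p \<le> 2 * N * \<mu> / 1" using p \<mu> N by (intro divide_left_mono) auto
    moreover have "0 \<le> (N - 2) * \<mu>" using N \<mu> by simp
    ultimately show ?thesis by simp
  qed
  ultimately have "(2 * N * \<mu> / p - (N - 2) * \<mu>) * t powr p \<le> 2 * N * \<mu> * (1 + t\<^sup>2)"
    using N \<mu> by (intro order_trans[OF mult_right_mono mult_left_mono]) auto
  moreover have "(2 * N / q - (N - 2)) * t powr q \<le> 0"
  proof -
    have "2 * N / q \<le> N - 2" using q q0 N by (simp add: field_simps)
    then show ?thesis by (intro mult_nonpos_nonneg) auto
  qed
  moreover have "t * t powr (p - 1) = t powr p" "t * t powr (q - 1) = t powr q"
    using t by (simp_all add: powr_mult_base)
  then have "(N - 2) * (t * (\<mu> * t powr (p - 1) + t powr (q - 1) - \<omega> * t)) =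
      (N - 2) * (\<mu> * t powr p + t powr q - \<omega> * t\<^sup>2)"
    by (simp add: algebra_simps power2_eq_square)
  ultimately show ?thesis by (simp add: algebra_simps)
qed

text \<open>Since q - 1 \<ge> 2, the leading power is at least t^2 - 1, and half of t^2 absorbs the
  linear term W t by Young's inequality.\<close>

lemma nonlinearity_lower_bound:
  fixes t p q \<mu> \<omega> W :: real
  assumes "0 \<le> t" "0 \<le> \<mu>" "3 \<le> q" "\<omega> \<le> W"
  shows "t\<^sup>2 / 2 - (1 + W\<^sup>2 / 2) \<le> \<mu> * t powr (p - 1) + t powr (q - 1) - \<omega> * t"
proof -
  have "t\<^sup>2 - 1 \<le> t powr (q - 1)"
  proof (cases "t \<le> 1")
    case True
    then have "t\<^sup>2 \<le> 1" using assms(1) by (simp add: power_le_one)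
    then show ?thesis by (smt (verit) powr_ge_zero)
  next
    case False
    then have "t powr 2 \<le> t powr (q - 1)" using assms by (intro powr_mono) auto
    then show ?thesis using False by (simp add: powr_numeral)
  qed
  moreover have "\<omega> * t \<le> W * t" using assms by (intro mult_right_mono)
  moreover have "W * t \<le> t\<^sup>2 / 2 + W\<^sup>2 / 2"
    using zero_le_power2[of "t - W"] by (simp add: power2_diff mult.commute)
  moreover have "0 \<le> \<mu> * t powr (p - 1)" using assms by simp
  ultimately show ?thesis by linarith
qed

lemma continuous_on_powr_nonneg:
  "a > 0 \<Longrightarrow> continuous_on {0..} (\<lambda>t::real. t powr a)"
  by (intro continuous_on_powr') auto

text \<open>The summands of the bound serve different purposes: 1 makes \<rho> positive,
  \<open>m\<close> gives m + \<rho> \<le> 2\<rho>, the third gives \<rho>/2 - c \<ge> \<rho>/4, and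
  the last is contradicted by the flux estimate, quadratic in \<rho> on the left and linear on the
  right.\<close>

theorem solution_mass_bound:
  fixes \<Omega> :: "(real^'n::finite) set" and u :: "real^'n \<Rightarrow> real" and p q \<mu> \<omega> \<rho> \<kappa> r :: real
  defines "N \<equiv> real CARD('n)" and "m \<equiv> measure lebesgue \<Omega>"
  assumes N: "CARD('n) \<ge> 3" and p: "1 < p" "p \<le> 2" and q: "2 * N / (N - 2) \<le> q" "3 \<le> q" and \<mu>: "\<mu> > 0"
    and sol: "positive_solution_convex \<Omega> u (\<lambda>t. \<mu> * t powr (p - 1) + t powr (q - 1) - \<omega> * t) x0"
    and r: "r > 0" "ball x0 r \<subseteq> \<Omega>"
    and \<kappa>: "- \<omega> \<le> \<kappa>" and mass: "((\<lambda>x. (u x)\<^sup>2) has_integral \<rho>) \<Omega>"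
  shows "\<rho> \<le> 1 + m + 4 * (1 + (2 * N * \<mu>)\<^sup>2 / 2) * m + 16 * (64 * N * m / r\<^sup>2) * (4 * N * \<mu> + 2 * \<bar>\<kappa>\<bar>)"
proof (rule ccontr)
  define c where "c = (1 + (2 * N * \<mu>)\<^sup>2 / 2) * m"
  define C where "C = 64 * N * m / r\<^sup>2"
  have N2: "N > 2" using N by (simp add: N_def)
  have nn: "m \<ge> 0" "c \<ge> 0" "C \<ge> 0" using N2 by (auto simp: m_def c_def C_def)
  assume "\<not> ?thesis"
  then have \<rho>: "\<rho> > 1 + m + 4 * c + 16 * C * (4 * N * \<mu> + 2 * \<bar>\<kappa>\<bar>)"
    by (simp add: c_def C_def algebra_simps)
  have "0 \<le> 16 * C * (4 * N * \<mu> + 2 * \<bar>\<kappa>\<bar>)"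
    using nn N2 \<mu> by simp
  with \<rho> nn have big: "\<rho> > m" "\<rho> > 4 * c" "\<rho> > 16 * C * (4 * N * \<mu> + 2 * \<bar>\<kappa>\<bar>)" "\<rho> > 0" by linarith+
  define f where "f t = \<mu> * t powr (p - 1) + t powr (q - 1) - \<omega> * t" for t
  define F where "F t = \<mu> / p * t powr p + t powr q / q - \<omega> / 2 * t\<^sup>2" for t
  interpret positive_solution_convex \<Omega> u f x0
    using sol unfolding f_def .
  have meas: "\<Omega> \<in> lmeasurable" using open_dom bounded_dom by (intro lmeasurable_open)
  have v2: "integral UNIV (\<lambda>x. (v x)\<^sup>2) = \<rho>"
  proof -
    have "((\<lambda>x. if x \<in> \<Omega> then (u x)\<^sup>2 else 0) has_integral \<rho>) UNIV"
      using mass by (simp only: has_integral_restrict_UNIV)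
    moreover have "(\<lambda>x. (v x)\<^sup>2) = (\<lambda>x. if x \<in> \<Omega> then (u x)\<^sup>2 else 0)" by (auto simp: v_def)
    ultimately show ?thesis by (simp add: integral_unique)
  qed
  have iv2: "(\<lambda>x. (v x)\<^sup>2) integrable_on UNIV"
    by (rule integrable_dom, intro continuous_intros cont_v) (simp add: v_outside)
  have iI: "(\<lambda>x. indicat_real \<Omega> x) integrable_on UNIV"
    using meas by (simp add: integrable_on_indicator)
  have I: "integral UNIV (\<lambda>x. indicat_real \<Omega> x) = m"
    using lmeasure_integral_UNIV[OF meas] by (simp add: m_def)
  have contF: "continuous_on {0..} F"
    unfolding F_def[abs_def] using p q by (intro continuous_intros continuous_on_powr_nonneg) auto
  have F0: "F 0 = 0" by (simp add: F_def)
  have derF: "(F has_real_derivative f t) (at t)" if "t > 0" for t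
  proof -
    have "((\<lambda>t. \<mu> / p * t powr p + t powr q / q - \<omega> / 2 * t\<^sup>2) has_real_derivative
        \<mu> / p * (p * t powr (p - 1)) + q * t powr (q - 1) / q - \<omega> / 2 * (2 * t)) (at t)"
      by (intro DERIV_diff DERIV_add DERIV_cmult DERIV_cdivide has_real_derivative_powr that)
        (auto intro!: derivative_eq_intros)
    then show ?thesis
      unfolding F_def[abs_def] f_def by (rule DERIV_cong) (use p q in simp)
  qed
  define P where "P = 2 * N * integral UNIV (\<lambda>x. F (v x)) - (N - 2) * integral UNIV (\<lambda>x. v x * f (v x))"
  have poho: "0 \<le> P" "(integral UNIV (\<lambda>x. f (v x)))\<^sup>2 \<le> C * P"
    using pohozaev_flux[OF r _ contF F0 derF] N unfolding P_def N_def C_def m_def by auto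
  have P_le: "P \<le> 2 * N * \<mu> * (m + \<rho>) - 2 * \<omega> * \<rho>"
  proof -
    have cF: "continuous_on UNIV (\<lambda>x. F (v x))" by (rule cont_comp_v[OF contF])
    have iF: "(\<lambda>x. F (v x)) integrable_on UNIV"
      by (rule integrable_dom[OF cF]) (simp add: v_outside F0)
    have ivf: "(\<lambda>x. v x * f (v x)) integrable_on UNIV"
      by (rule integrable_dom, intro continuous_intros cont_v cont_fv) (simp add: v_outside)
    have "P = integral UNIV (\<lambda>x. 2 * N * F (v x) - (N - 2) * (v x * f (v x)))"
      using integral_diff[OF integrable_on_mult_right[OF iF, of "2 * N"] integrable_on_mult_right[OF ivf, of "N - 2"]]
      by (simp add: P_def)
    also have "\<dots> \<le> integral UNIV (\<lambda>x. 2 * N * \<mu> * (indicat_real \<Omega> x + (v x)\<^sup>2) - 2 * \<omega> * (v x)\<^sup>2)"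
    proof (rule integral_le)
      show "(\<lambda>x. 2 * N * F (v x) - (N - 2) * (v x * f (v x))) integrable_on UNIV"
        by (intro integrable_diff integrable_on_mult_right iF ivf)
      show "(\<lambda>x. 2 * N * \<mu> * (indicat_real \<Omega> x + (v x)\<^sup>2) - 2 * \<omega> * (v x)\<^sup>2) integrable_on UNIV"
        by (intro integrable_diff integrable_add integrable_on_mult_right iI iv2)
      show "2 * N * F (v x) - (N - 2) * (v x * f (v x)) \<le> 2 * N * \<mu> * (indicat_real \<Omega> x + (v x)\<^sup>2) - 2 * \<omega> * (v x)\<^sup>2" for x
      proof (cases "x \<in> \<Omega>")
        case True
        then show ?thesis
          using pohozaev_density_le[OF v_nonneg p N2 q(1), of \<mu> x \<omega>] \<mu> by (simp add: F_def f_def)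
      qed (simp add: v_outside F0)
    qed
    also have "\<dots> = 2 * N * \<mu> * (m + \<rho>) - 2 * \<omega> * \<rho>"
      using integral_diff[OF integrable_on_mult_right[OF integrable_add[OF iI iv2], of "2 * N * \<mu>"]
          integrable_on_mult_right[OF iv2, of "2 * \<omega>"]] integral_add[OF iI iv2]
      by (simp add: I v2)
    finally show ?thesis .
  qed
  \<comment> \<open>Otherwise \<open>P_le\<close> together with m < \<rho> would make
    \<open>P\<close> negative.\<close>
  have \<omega>_le: "\<omega> \<le> 2 * N * \<mu>"
  proof (rule ccontr)
    assume "\<not> ?thesis"
    then have "2 * N * \<mu> * \<rho> < \<omega> * \<rho>" using big by simp
    moreover have "N * \<mu> * (m + \<rho>) \<le> N * \<mu> * (2 * \<rho>)"
      using big N2 \<mu> by (intro mult_left_mono) auto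
    ultimately show False using poho(1) P_le by (simp add: algebra_simps)
  qed
  have "\<rho> / 2 - c \<le> integral UNIV (\<lambda>x. f (v x))"
  proof -
    let ?K = "1 + (2 * N * \<mu>)\<^sup>2 / 2"
    have ivh: "(\<lambda>x. (v x)\<^sup>2 / 2) integrable_on UNIV"
      by (rule integrable_dom, intro continuous_intros cont_v) (simp_all add: v_outside)
    have "integral UNIV (\<lambda>x. (v x)\<^sup>2 / 2 - ?K * indicat_real \<Omega> x) \<le> integral UNIV (\<lambda>x. f (v x))"
    proof (rule integral_le)
      show "(\<lambda>x. (v x)\<^sup>2 / 2 - ?K * indicat_real \<Omega> x) integrable_on UNIV"
        by (intro integrable_diff integrable_on_mult_right iI ivh)
      show "(\<lambda>x. f (v x)) integrable_on UNIV"
        by (rule integrable_dom[OF cont_fv fv_outside])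
      show "(v x)\<^sup>2 / 2 - ?K * indicat_real \<Omega> x \<le> f (v x)" for x
      proof (cases "x \<in> \<Omega>")
        case True
        then show ?thesis
          using nonlinearity_lower_bound[OF v_nonneg _ q(2) \<omega>_le, of \<mu> x p] \<mu> by (simp add: f_def)
      qed (simp add: v_outside f_0)
    qed
    moreover have "integral UNIV (\<lambda>x. (v x)\<^sup>2 / 2 - ?K * indicat_real \<Omega> x) = \<rho> / 2 - c"
      using integral_diff[OF ivh integrable_on_mult_right[OF iI, of ?K]] by (simp add: I v2 c_def)
    ultimately show ?thesis by simp
  qed
  then have "\<rho> / 4 \<le> integral UNIV (\<lambda>x. f (v x))" using big by linarith
  then have "(\<rho> / 4)\<^sup>2 \<le> (integral UNIV (\<lambda>x. f (v x)))\<^sup>2" using big by (intro power_mono) auto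
  also have "\<dots> \<le> C * P" by (rule poho(2))
  \<comment> \<open>Replacing \<open>m\<close> by \<rho> turns the affine bound on \<open>P\<close>
    into a multiple of \<rho>, so that one factor \<rho> cancels against the square on the
    left.\<close>
  also have "\<dots> \<le> C * ((4 * N * \<mu> + 2 * \<bar>\<kappa>\<bar>) * \<rho>)"
  proof (rule mult_left_mono[OF _ nn(3)])
    have "- \<omega> * \<rho> \<le> \<bar>\<kappa>\<bar> * \<rho>" using \<kappa> big by (intro mult_right_mono) auto
    moreover have "N * \<mu> * (m + \<rho>) \<le> N * \<mu> * (2 * \<rho>)"
      using big N2 \<mu> by (intro mult_left_mono) auto
    ultimately show "P \<le> (4 * N * \<mu> + 2 * \<bar>\<kappa>\<bar>) * \<rho>"
      using P_le by (simp add: algebra_simps)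
  qed
  finally have "\<rho> * \<rho> \<le> (16 * C * (4 * N * \<mu> + 2 * \<bar>\<kappa>\<bar>)) * \<rho>"
    by (simp add: power2_eq_square algebra_simps)
  then have "\<rho> \<le> 16 * C * (4 * N * \<mu> + 2 * \<bar>\<kappa>\<bar>)"
    using big(4) by (simp only: mult_le_cancel_right_pos)
  with big(3) show False by simp
qed

theorem theorem1p3:
  fixes \<Omega> :: "(real^'n::finite) set" and p q \<mu> :: real
  assumes "CARD('n) \<ge> 3"
    and "1 < p" and "p \<le> 2"
    and "q \<ge> max (2 * real CARD('n) / (real CARD('n) - 2)) 3"
    and "\<mu> > 0"
    and "open \<Omega>" and "connected \<Omega>" and "\<Omega> \<noteq> {}" and "bounded \<Omega>" and "convex \<Omega>"
    and "smooth_boundary \<Omega>"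
  shows "\<exists>\<rho>bar>0. \<forall>\<rho>>\<rho>bar. \<not> (\<exists>(\<omega>::real) (u :: real^'n \<Rightarrow> real).
           H10 \<Omega> u \<and>
           Ck_on 2 \<Omega> u \<and> continuous_on (closure \<Omega>) u \<and>
           (\<forall>x\<in>\<Omega>. - laplacian u x + \<omega> * u x = \<mu> * u x powr (p - 1) + u x powr (q - 1)) \<and>
           (\<forall>x\<in>\<Omega>. u x > 0) \<and>
           (\<forall>x\<in>frontier \<Omega>. u x = 0) \<and>
           ((\<lambda>x. (u x)^2) has_integral \<rho>) \<Omega>)"
proof -
  obtain x0 where x0: "x0 \<in> \<Omega>" using assms(8) by blast
  then obtain r where r: "r > 0" "ball x0 r \<subseteq> \<Omega>"
    using assms(6) open_contains_ball by blast
  \<comment> \<open>The layer cut-off is reused with l = 2 as a test function for Picone's identity.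
    It is 1 on the ball of radius r/2, since dilation by 2 doubles distances to \<open>x0\<close>;
    this makes \<open>J\<close> positive.\<close>
  obtain \<eta> and \<eta>' :: "'n \<Rightarrow> real^'n \<Rightarrow> real" and S where
      \<eta>: "continuous_on UNIV \<eta>" "\<forall>i. continuous_on UNIV (\<eta>' i)"
        "\<forall>i x. ((\<lambda>t. \<eta> (x + t *\<^sub>R axis i 1)) has_real_derivative \<eta>' i x) (at 0)"
    and S: "compact S" "S \<subseteq> \<Omega>"
    and supp: "\<forall>x. x \<notin> S \<longrightarrow> \<eta> x = 0 \<and> (\<forall>i. \<eta>' i x = 0)"
    and one: "\<forall>x. dilation x0 2 x \<in> \<Omega> \<longrightarrow> \<eta> x = 1 \<and> (\<forall>i. \<eta>' i x = 0)"
    using layer_cutoff[OF assms(6,9,10) r, of 2] by fastforce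
  define J where "J = integral UNIV (\<lambda>x. (\<eta> x)\<^sup>2)"
  define H where "H = (\<Sum>i\<in>UNIV. integral UNIV (\<lambda>x. (\<eta>' i x)\<^sup>2))"
  have J: "J > 0"
  proof -
    have ball: "ball x0 (r / 2) \<in> lmeasurable" by simp
    have "0 < measure lebesgue (ball x0 (r / 2))"
      using content_ball_pos[of "r / 2" x0] r by simp
    also have "\<dots> = integral UNIV (indicat_real (ball x0 (r / 2)))"
      by (rule lmeasure_integral_UNIV[OF ball])
    also have "\<dots> \<le> J"
      unfolding J_def
    proof (rule integral_le)
      show "indicat_real (ball x0 (r / 2)) integrable_on UNIV"
        using ball by (simp add: integrable_on_indicator)
      show "(\<lambda>x. (\<eta> x)\<^sup>2) integrable_on UNIV"
        by (rule integrable_continuous_bounded_support[OF _ compact_imp_bounded[OF S(1)]])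
          (use supp \<eta>(1) in \<open>auto intro!: continuous_intros\<close>)
      show "indicat_real (ball x0 (r / 2)) x \<le> (\<eta> x)\<^sup>2" for x
      proof (cases "x \<in> ball x0 (r / 2)")
        case True
        have "x0 - dilation x0 2 x = 2 *\<^sub>R (x0 - x)"
          by (simp add: dilation_def algebra_simps scaleR_2)
        then have "dist x0 (dilation x0 2 x) = 2 * dist x0 x" by (simp add: dist_norm)
        then have "dilation x0 2 x \<in> \<Omega>" using True r(2) by auto
        then show ?thesis using one by simp
      qed simp
    qed
    finally show ?thesis .
  qed
  \<comment> \<open>The Rayleigh quotient of the cut-off, an upper bound for the first Dirichlet
    eigenvalue. It is fixed before \<omega> and \<open>u\<close>, so \<open>\<rho>bar\<close> does
    not depend on the solution.\<close>
  define \<kappa> where "\<kappa> = H / J"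
  define N where "N = real CARD('n)"
  define m where "m = measure lebesgue \<Omega>"
  define \<rho>bar where "\<rho>bar = 1 + m + 4 * (1 + (2 * N * \<mu>)\<^sup>2 / 2) * m + 16 * (64 * N * m / r\<^sup>2) * (4 * N * \<mu> + 2 * \<bar>\<kappa>\<bar>)"
  have "0 \<le> m" "0 \<le> N" by (auto simp: m_def N_def)
  then have "0 \<le> 4 * (1 + (2 * N * \<mu>)\<^sup>2 / 2) * m" "0 \<le> 16 * (64 * N * m / r\<^sup>2) * (4 * N * \<mu> + 2 * \<bar>\<kappa>\<bar>)"
    using assms(5) by simp_all
  with \<open>0 \<le> m\<close> have "\<rho>bar > 0" unfolding \<rho>bar_def by linarith
  moreover have "\<rho> \<le> \<rho>bar"
    if u: "Ck_on 2 \<Omega> u" "continuous_on (closure \<Omega>) u"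
      "\<forall>x\<in>\<Omega>. - laplacian u x + \<omega> * u x = \<mu> * u x powr (p - 1) + u x powr (q - 1)"
      "\<forall>x\<in>\<Omega>. u x > 0" "\<forall>x\<in>frontier \<Omega>. u x = 0" "((\<lambda>x. (u x)^2) has_integral \<rho>) \<Omega>"
    for \<rho> \<omega> :: real and u :: "real^'n \<Rightarrow> real"
  proof -
    let ?f = "\<lambda>t. \<mu> * t powr (p - 1) + t powr (q - 1) - \<omega> * t"
    have q: "2 * real CARD('n) / (real CARD('n) - 2) \<le> q" "3 \<le> q" using assms(4) by auto
    have sol: "positive_solution_convex \<Omega> u ?f x0"
    proof
      show "continuous_on {0..} ?f"
        using assms(2) q by (intro continuous_intros continuous_on_powr_nonneg) auto
      show "- laplacian u x = ?f (u x)" if "x \<in> \<Omega>" for x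
        using u(3) that by (simp add: algebra_simps)
    qed (use assms u x0 in auto)
    then interpret positive_solution_convex \<Omega> u ?f x0 .
    have "- \<omega> * J \<le> H"
      unfolding J_def H_def
    proof (rule picone[OF _ \<eta>(1) _ _ _ _ S])
      \<comment> \<open>Both powers are nonnegative, so Picone's identity applies with k =
        -\<omega>.\<close>
      show "- \<omega> * t \<le> ?f t" if "t > 0" for t
        using assms(5) that by simp
      show "continuous_on UNIV (\<eta>' i)" for i using \<eta>(2) by blast
      show "((\<lambda>t. \<eta> (x + t *\<^sub>R axis i 1)) has_real_derivative \<eta>' i x) (at 0)" for i x
        using \<eta>(3) by blast
    qed (use supp in auto)
    then have "- \<omega> \<le> \<kappa>" using J by (simp add: \<kappa>_def field_simps)
    from solution_mass_bound[OF assms(1-3) q assms(5) sol r this u(6)]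
    show ?thesis unfolding \<rho>bar_def N_def m_def .
  qed
  ultimately show ?thesis
    by (intro exI[of _ \<rho>bar]) (metis not_le)
qed

end
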